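(* Let $S\colon\mathbf{CAT}\to\mathbf{CAT}$ be the 2-monad for monoidal categories, or symmetric monoidal categories, or monoidal categories in which the unit is a terminal object, or symmetric monoidal categories in which the unit is a terminal object. Then the relative pseudomonad of presheaves $P$ over the inclusion $J\colon\mathbf{Cat}\to\mathbf{CAT}$ has a lifting to strict $S$-algebras, $\bar P\colon S\text{-}\mathrm{Alg}_{\mathbf{Cat}}\to S\text{-}\mathrm{Alg}_{\mathbf{CAT}}$.
   Context: $\mathbf{CAT}$ is the 2-category of locally small categories, $\mathbf{Cat}$ its full sub-2-category of small categories, $J$ the inclusion. The 2-monads. The strict algebras for $S$ are the locally small categories equipped with the indicated (not necessarily strict) monoidal structure; $S$ restricts to a 2-monad on $\mathbf{Cat}$. $S\text{-}\mathrm{Alg}_{\mathbf{CAT}}$ (respectively $S\text{-}\mathrm{Alg}_{\mathbf{Cat}}$) is the 2-category of (small) strict algebras, pseudomorphisms and algebra 2-cells: a pseudomorphism $(A,a)\to(B,b)$ is a functor $f\colon A\to B$ with an invertible natural transformation $\bar f\colon b\,S(f)\to f\,a$ satisfying the usual two coherence axioms (so, strong (symmetric) monoidal functors); an algebra 2-cell is a natural transformation compatible with these (so, a monoidal natural transformation). The relative pseudomonad of presheaves. For a small category $\mathbb{X}$, $P(\mathbb{X})=[\mathbb{X}^{\mathrm{op}},\mathbf{Set}]$, with unit the Yoneda embedding $\mathrm{y}_{\mathbb{X}}\colon\mathbb{X}\to P(\mathbb{X})$. For $F\colon\mathbb{X}\to P(\mathbb{Y})$, $F^*\colon P(\mathbb{X})\to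 P(\mathbb{Y})$ is the left Kan extension of $F$ along $\mathrm{y}_{\mathbb{X}}$, $F^*(p)(y)=\int^{x\in\mathbb{X}}F(x)(y)\times p(x)$, with canonical invertible $\eta_F\colon F\to F^*\mathrm{y}_{\mathbb{X}}$. The invertible 2-cells $\mu_{G,F}\colon(G^*F)^*\to G^*F^*$ and $\theta_{\mathbb{X}}\colon(\mathrm{y}_{\mathbb{X}})^*\to1_{P(\mathbb{X})}$ are the unique ones such that $(\mu_{G,F}\,\mathrm{y}_{\mathbb{X}})\cdot\eta_{G^*F}=G^*\eta_F$ and $(\theta_{\mathbb{X}}\,\mathrm{y}_{\mathbb{X}})\cdot\eta_{\mathrm{y}_{\mathbb{X}}}=1$. Lifting. A lifting of $P$ to strict algebras for $S$ consists of: a strict $S$-algebra structure on $P(\mathbb{A})$ for every $\mathbb{A}\in S\text{-}\mathrm{Alg}_{\mathbf{Cat}}$; a pseudomorphism structure on $F^*\colon P(\mathbb{A})\to P(\mathbb{B})$ for every pseudomorphism $F\colon\mathbb{A}\to P(\mathbb{B})$; a pseudomorphism structure on $\mathrm{y}_{\mathbb{A}}\colon\mathbb{A}\to P(\mathbb{A})$ for every $\mathbb{A}\in S\text{-}\mathrm{Alg}_{\mathbf{Cat}}$; such that $\mu_{G,F}$, $\eta_F$ (for all pseudomorphisms $F\colon\mathbb{A}\to P(\mathbb{B})$, $G\colon\mathbb{B}\to P(\mathbb{C})$) and $\theta_{\mathbb{A}}$ are algebra 2-cells. *)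

theory Defs
  imports "HOL-Library.FuncSet"
begin

unbundle cardinal_syntax

section \<open>Size\<close>

text \<open>
  A type in this class plays the role of the universe with respect to which small and locally small
  are understood: its cardinality is infinite, regular and strong limit, and a set (over any type)
  is small if its cardinality is below that of the type.  Every small set is in bijection with a
  small subset of the type, so small sets and small categories are represented, without loss of
  generality, by small subsets of the type.  Uncountability is not needed and not imposed (the
  remaining case consists of the finite sets); every inaccessible cardinality is covered.
\<close>

class universe =
  assumes infinite_universe: "infinite (UNIV :: 'a set)"
    and small_Pow: "\<And>A :: 'a set. |A| <o |UNIV :: 'a set| \<Longrightarrow> |Pow A| <o |UNIV :: 'a set|"
    and small_UN: "\<And>(A :: 'a set) (B :: 'a \<Rightarrow> 'a set).
      |A| <o |UNIV :: 'a set| \<Longrightarrow> (\<And>x. x \<in> A \<Longrightarrow> |B x| <o |UNIV :: 'a set| ) \<Longrightarrow>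
      |\<Union> (B ` A)| <o |UNIV :: 'a set|"

definition small :: "'u itself \<Rightarrow> 'b set \<Rightarrow> bool" where
  "small U A \<longleftrightarrow> |A| <o |UNIV :: 'u set|"

instance nat :: universe
proof
  have fin: "|X| <o |UNIV :: nat set| \<longleftrightarrow> finite X" for X :: "'b set"
    by (metis card_of_nat finite_iff_ordLess_natLeq ordIso_symmetric ordLess_ordIso_trans)
  show "infinite (UNIV :: nat set)" by simp
  show "|Pow A| <o |UNIV :: nat set|" if "|A| <o |UNIV :: nat set|" for A :: "nat set"
    using that by (simp add: fin)
  show "|\<Union> (B ` A)| <o |UNIV :: nat set|"
    if "|A| <o |UNIV :: nat set|" "\<And>x. x \<in> A \<Longrightarrow> |B x| <o |UNIV :: nat set|"
    for A :: "nat set" and B :: "nat \<Rightarrow> nat set"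
    using that by (simp add: fin)
qed


section \<open>Categories, functors, natural transformations\<close>

record ('o, 'a) cat =
  objs :: "'o set"
  arrs :: "'a set"
  src :: "'a \<Rightarrow> 'o"
  tgt :: "'a \<Rightarrow> 'o"
  ident :: "'o \<Rightarrow> 'a"
  cmp :: "'a \<Rightarrow> 'a \<Rightarrow> 'a"

abbreviation cmp_syntax :: "'a \<Rightarrow> ('o, 'a) cat \<Rightarrow> 'a \<Rightarrow> 'a"
    (\<open>(_ \<cdot>\<^bsub>_\<^esub> _)\<close> [66, 0, 65] 65) where
  "g \<cdot>\<^bsub>C\<^esub> f \<equiv> cmp C g f"

definition hom :: "('o, 'a) cat \<Rightarrow> 'o \<Rightarrow> 'o \<Rightarrow> 'a set" where
  "hom C x y = {f \<in> arrs C. src C f = x \<and> tgt C f = y}"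

definition category :: "('o, 'a) cat \<Rightarrow> bool" where
  "category C \<longleftrightarrow>
     (\<forall>f\<in>arrs C. src C f \<in> objs C \<and> tgt C f \<in> objs C) \<and>
     (\<forall>x\<in>objs C. ident C x \<in> hom C x x) \<and>
     (\<forall>f\<in>arrs C. \<forall>g\<in>arrs C. tgt C f = src C g \<longrightarrow> g \<cdot>\<^bsub>C\<^esub> f \<in> hom C (src C f) (tgt C g)) \<and>
     (\<forall>f\<in>arrs C. f \<cdot>\<^bsub>C\<^esub> ident C (src C f) = f \<and> ident C (tgt C f) \<cdot>\<^bsub>C\<^esub> f = f) \<and>
     (\<forall>f\<in>arrs C. \<forall>g\<in>arrs C. \<forall>h\<in>arrs C. tgt C f = src C g \<longrightarrow> tgt C g = src C h \<longrightarrow>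
        (h \<cdot>\<^bsub>C\<^esub> g) \<cdot>\<^bsub>C\<^esub> f = h \<cdot>\<^bsub>C\<^esub> (g \<cdot>\<^bsub>C\<^esub> f))"

definition small_category :: "'u itself \<Rightarrow> ('o, 'a) cat \<Rightarrow> bool" where
  "small_category U C \<longleftrightarrow> category C \<and> small U (objs C) \<and> small U (arrs C)"

definition locally_small_category :: "'u itself \<Rightarrow> ('o, 'a) cat \<Rightarrow> bool" where
  "locally_small_category U C \<longleftrightarrow>
     category C \<and> (\<forall>x\<in>objs C. \<forall>y\<in>objs C. small U (hom C x y))"

definition iso_in :: "('o, 'a) cat \<Rightarrow> 'a \<Rightarrow> bool" where
  "iso_in C f \<longleftrightarrow> f \<in> arrs C \<and>
     (\<exists>g\<in>hom C (tgt C f) (src C f).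
        g \<cdot>\<^bsub>C\<^esub> f = ident C (src C f) \<and> f \<cdot>\<^bsub>C\<^esub> g = ident C (tgt C f))"

definition is_terminal :: "('o, 'a) cat \<Rightarrow> 'o \<Rightarrow> bool" where
  "is_terminal C t \<longleftrightarrow> t \<in> objs C \<and> (\<forall>x\<in>objs C. \<exists>!f. f \<in> hom C x t)"

definition op_cat :: "('o, 'a) cat \<Rightarrow> ('o, 'a) cat" where
  "op_cat C = \<lparr>objs = objs C, arrs = arrs C, src = tgt C, tgt = src C, ident = ident C,
     cmp = (\<lambda>g f. f \<cdot>\<^bsub>C\<^esub> g)\<rparr>"

definition prod_cat :: "('o, 'a) cat \<Rightarrow> ('p, 'b) cat \<Rightarrow> ('o \<times> 'p, 'a \<times> 'b) cat" where
  "prod_cat C D = \<lparr>objs = objs C \<times> objs D, arrs = arrs C \<times> arrs D,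
     src = map_prod (src C) (src D), tgt = map_prod (tgt C) (tgt D),
     ident = map_prod (ident C) (ident D),
     cmp = (\<lambda>(g, g') (f, f'). (g \<cdot>\<^bsub>C\<^esub> f, g' \<cdot>\<^bsub>D\<^esub> f'))\<rparr>"

text \<open>
  Functors and transformations are extensional functions (\<open>undefined\<close> off their domain), so that
  equality in HOL is equality of functors and of transformations.
\<close>

record ('o, 'a, 'p, 'b) ftor =
  fobj :: "'o \<Rightarrow> 'p"
  farr :: "'a \<Rightarrow> 'b"

definition is_functor :: "('o, 'a) cat \<Rightarrow> ('p, 'b) cat \<Rightarrow> ('o, 'a, 'p, 'b) ftor \<Rightarrow> bool" where
  "is_functor C D F \<longleftrightarrow>
     fobj F \<in> objs C \<rightarrow>\<^sub>E objs D \<and> farr F \<in> extensional (arrs C) \<and>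
     (\<forall>f\<in>arrs C. farr F f \<in> hom D (fobj F (src C f)) (fobj F (tgt C f))) \<and>
     (\<forall>x\<in>objs C. farr F (ident C x) = ident D (fobj F x)) \<and>
     (\<forall>f\<in>arrs C. \<forall>g\<in>arrs C. tgt C f = src C g \<longrightarrow>
        farr F (g \<cdot>\<^bsub>C\<^esub> f) = farr F g \<cdot>\<^bsub>D\<^esub> farr F f)"

definition make_functor ::
    "('o, 'a) cat \<Rightarrow> ('o \<Rightarrow> 'p) \<Rightarrow> ('a \<Rightarrow> 'b) \<Rightarrow> ('o, 'a, 'p, 'b) ftor" where
  "make_functor C fo fa = \<lparr>fobj = restrict fo (objs C), farr = restrict fa (arrs C)\<rparr>"

definition id_functor :: "('o, 'a) cat \<Rightarrow> ('o, 'a, 'o, 'a) ftor" where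
  "id_functor C = make_functor C (\<lambda>x. x) (\<lambda>f. f)"

definition comp_functor :: "('o, 'a) cat \<Rightarrow> ('p, 'b, 'q, 'c) ftor \<Rightarrow> ('o, 'a, 'p, 'b) ftor \<Rightarrow>
    ('o, 'a, 'q, 'c) ftor" where
  "comp_functor C G F = make_functor C (\<lambda>x. fobj G (fobj F x)) (\<lambda>f. farr G (farr F f))"

definition nat_trans :: "('o, 'a) cat \<Rightarrow> ('p, 'b) cat \<Rightarrow> ('o, 'a, 'p, 'b) ftor \<Rightarrow>
    ('o, 'a, 'p, 'b) ftor \<Rightarrow> ('o \<Rightarrow> 'b) \<Rightarrow> bool" where
  "nat_trans C D F G t \<longleftrightarrow>
     is_functor C D F \<and> is_functor C D G \<and> t \<in> extensional (objs C) \<and>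
     (\<forall>x\<in>objs C. t x \<in> hom D (fobj F x) (fobj G x)) \<and>
     (\<forall>f\<in>arrs C. farr G f \<cdot>\<^bsub>D\<^esub> t (src C f) = t (tgt C f) \<cdot>\<^bsub>D\<^esub> farr F f)"

definition nat_iso :: "('o, 'a) cat \<Rightarrow> ('p, 'b) cat \<Rightarrow> ('o, 'a, 'p, 'b) ftor \<Rightarrow>
    ('o, 'a, 'p, 'b) ftor \<Rightarrow> ('o \<Rightarrow> 'b) \<Rightarrow> bool" where
  "nat_iso C D F G t \<longleftrightarrow> nat_trans C D F G t \<and> (\<forall>x\<in>objs C. iso_in D (t x))"

type_synonym ('o, 'a, 'p, 'b) transf =
  "('o, 'a, 'p, 'b) ftor \<times> ('o, 'a, 'p, 'b) ftor \<times> ('o \<Rightarrow> 'b)"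

definition functor_cat :: "('o, 'a) cat \<Rightarrow> ('p, 'b) cat \<Rightarrow>
    (('o, 'a, 'p, 'b) ftor, ('o, 'a, 'p, 'b) transf) cat" where
  "functor_cat C D =
     \<lparr>objs = {F. is_functor C D F},
      arrs = {(F, G, t). nat_trans C D F G t},
      src = (\<lambda>(F, G, t). F),
      tgt = (\<lambda>(F, G, t). G),
      ident = (\<lambda>F. (F, F, \<lambda>x\<in>objs C. ident D (fobj F x))),
      cmp = (\<lambda>(G', H, t) (F, G, s). (F, H, \<lambda>x\<in>objs C. t x \<cdot>\<^bsub>D\<^esub> s x))\<rparr>"


section \<open>Presheaves\<close>

type_synonym 'u set_arrow = "'u set \<times> 'u set \<times> ('u \<Rightarrow> 'u)"

definition set_cat :: "('u set, 'u set_arrow) cat" where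
  "set_cat =
     \<lparr>objs = {A. small TYPE('u) A},
      arrs = {(A, B, f). small TYPE('u) A \<and> small TYPE('u) B \<and> f \<in> A \<rightarrow>\<^sub>E B},
      src = (\<lambda>(A, B, f). A),
      tgt = (\<lambda>(A, B, f). B),
      ident = (\<lambda>A. (A, A, \<lambda>a\<in>A. a)),
      cmp = (\<lambda>(B', C, g) (A, B, f). (A, C, compose A g f))\<rparr>"

definition app :: "'u set_arrow \<Rightarrow> 'u \<Rightarrow> 'u" where
  "app f = snd (snd f)"

type_synonym 'u psh = "('u, 'u, 'u set, 'u set_arrow) ftor"
type_synonym 'u psh_arrow = "('u, 'u, 'u set, 'u set_arrow) transf"

definition presheaves :: "('u, 'u) cat \<Rightarrow> ('u psh, 'u psh_arrow) cat" where
  "presheaves X = functor_cat (op_cat X) set_cat"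

definition component :: "'u psh_arrow \<Rightarrow> 'u \<Rightarrow> 'u \<Rightarrow> 'u" where
  "component t y = app (snd (snd t) y)"

definition yoneda_obj :: "('u, 'u) cat \<Rightarrow> 'u \<Rightarrow> 'u psh" where
  "yoneda_obj X x = make_functor (op_cat X)
     (\<lambda>w. hom X w x)
     (\<lambda>f. (hom X (tgt X f) x, hom X (src X f) x, \<lambda>g\<in>hom X (tgt X f) x. g \<cdot>\<^bsub>X\<^esub> f))"

definition yoneda :: "('u, 'u) cat \<Rightarrow> ('u, 'u, 'u psh, 'u psh_arrow) ftor" where
  "yoneda X = make_functor X (yoneda_obj X)
     (\<lambda>f. (yoneda_obj X (src X f), yoneda_obj X (tgt X f),
        \<lambda>w\<in>objs X. (hom X w (src X f), hom X w (tgt X f), \<lambda>g\<in>hom X w (src X f). f \<cdot>\<^bsub>X\<^esub> g)))"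


section \<open>The left Kan extension along the Yoneda embedding\<close>

text \<open>
  The coend of \<open>F(x)(y) \<times> p(x)\<close> over \<open>x\<close> is the set of triples \<open>(x, s, t)\<close> with \<open>s \<in> F(x)(y)\<close> and
  \<open>t \<in> p(x)\<close>, modulo the equivalence relation generated by
  \<open>(x, s, p(f)(t)) ~ (x', F(f)(s), t)\<close> for \<open>f : x \<rightarrow> x'\<close>, \<open>s \<in> F(x)(y)\<close>, \<open>t \<in> p(x')\<close>.
  To obtain a subset of the universe, each class is replaced by a chosen representative, encoded as
  a single element by a fixed injection.
\<close>

definition triple_code :: "'u \<times> 'u \<times> 'u \<Rightarrow> 'u" where
  "triple_code = (SOME e. inj e)"

type_synonym 'u pdiagram = "('u, 'u, 'u psh, 'u psh_arrow) ftor"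

definition coend_triples ::
    "('u, 'u) cat \<Rightarrow> 'u pdiagram \<Rightarrow> 'u psh \<Rightarrow> 'u \<Rightarrow> ('u \<times> 'u \<times> 'u) set" where
  "coend_triples X F p y =
     {(x, s, t). x \<in> objs X \<and> s \<in> fobj (fobj F x) y \<and> t \<in> fobj p x}"

definition coend_rel ::
    "('u, 'u) cat \<Rightarrow> 'u pdiagram \<Rightarrow> 'u psh \<Rightarrow> 'u \<Rightarrow> (('u \<times> 'u \<times> 'u) \<times> ('u \<times> 'u \<times> 'u)) set" where
  "coend_rel X F p y =
     {((src X f, s, app (farr p f) t), (tgt X f, component (farr F f) y s, t)) | f s t.
        f \<in> arrs X \<and> s \<in> fobj (fobj F (src X f)) y \<and> t \<in> fobj p (tgt X f)}"

definition coend_class ::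
    "('u, 'u) cat \<Rightarrow> 'u pdiagram \<Rightarrow> 'u psh \<Rightarrow> 'u \<Rightarrow> 'u \<times> 'u \<times> 'u \<Rightarrow> 'u" where
  "coend_class X F p y w =
     triple_code (SOME v. (w, v) \<in> (coend_rel X F p y \<union> (coend_rel X F p y)\<inverse>)\<^sup>*)"

definition coend :: "('u, 'u) cat \<Rightarrow> 'u pdiagram \<Rightarrow> 'u psh \<Rightarrow> 'u \<Rightarrow> 'u set" where
  "coend X F p y = coend_class X F p y ` coend_triples X F p y"

definition coend_map :: "('u, 'u) cat \<Rightarrow> 'u pdiagram \<Rightarrow> 'u psh \<Rightarrow> 'u psh \<Rightarrow> 'u \<Rightarrow> 'u \<Rightarrow>
    ('u \<times> 'u \<times> 'u \<Rightarrow> 'u \<times> 'u \<times> 'u) \<Rightarrow> 'u set_arrow" where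
  "coend_map X F p q y z h =
     (coend X F p y, coend X F q z, \<lambda>c\<in>coend X F p y. coend_class X F q z (h (inv triple_code c)))"

definition kan_obj :: "('u, 'u) cat \<Rightarrow> ('u, 'u) cat \<Rightarrow> 'u pdiagram \<Rightarrow> 'u psh \<Rightarrow> 'u psh" where
  "kan_obj X Y F p = make_functor (op_cat Y)
     (\<lambda>y. coend X F p y)
     (\<lambda>g. coend_map X F p p (tgt Y g) (src Y g) (\<lambda>(x, s, t). (x, app (farr (fobj F x) g) s, t)))"

text \<open>\<open>kan X Y F\<close> is the functor \<open>F\<^sup>*\<close> from presheaves on \<open>X\<close> to presheaves on \<open>Y\<close>.\<close>

definition kan :: "('u, 'u) cat \<Rightarrow> ('u, 'u) cat \<Rightarrow> 'u pdiagram \<Rightarrow>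
    ('u psh, 'u psh_arrow, 'u psh, 'u psh_arrow) ftor" where
  "kan X Y F = make_functor (presheaves X) (kan_obj X Y F)
     (\<lambda>(p, q, a). (kan_obj X Y F p, kan_obj X Y F q,
        \<lambda>y\<in>objs Y. coend_map X F p q y y (\<lambda>(x, s, t). (x, s, app (a x) t))))"

definition eta :: "('u, 'u) cat \<Rightarrow> ('u, 'u) cat \<Rightarrow> 'u pdiagram \<Rightarrow> 'u \<Rightarrow> 'u psh_arrow" where
  "eta X Y F = (\<lambda>x\<in>objs X. (fobj F x, kan_obj X Y F (yoneda_obj X x),
     \<lambda>y\<in>objs Y. (fobj (fobj F x) y, coend X F (yoneda_obj X x) y,
       \<lambda>s\<in>fobj (fobj F x) y. coend_class X F (yoneda_obj X x) y (x, s, ident X x))))"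

definition mu :: "('u, 'u) cat \<Rightarrow> ('u, 'u) cat \<Rightarrow> ('u, 'u) cat \<Rightarrow> 'u pdiagram \<Rightarrow> 'u pdiagram \<Rightarrow>
    'u psh \<Rightarrow> 'u psh_arrow" where
  "mu X Y Z G F = (THE m.
     nat_iso (presheaves X) (presheaves Z)
       (kan X Z (comp_functor X (kan Y Z G) F))
       (comp_functor (presheaves X) (kan Y Z G) (kan X Y F)) m \<and>
     (\<forall>x\<in>objs X.
        m (yoneda_obj X x) \<cdot>\<^bsub>presheaves Z\<^esub> eta X Z (comp_functor X (kan Y Z G) F) x =
        farr (kan Y Z G) (eta X Y F x)))"

definition theta :: "('u, 'u) cat \<Rightarrow> 'u psh \<Rightarrow> 'u psh_arrow" where
  "theta X = (THE t.
     nat_iso (presheaves X) (presheaves X) (kan X X (yoneda X)) (id_functor (presheaves X)) t \<and>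
     (\<forall>x\<in>objs X.
        t (yoneda_obj X x) \<cdot>\<^bsub>presheaves X\<^esub> eta X X (yoneda X) x =
        ident (presheaves X) (yoneda_obj X x)))"


section \<open>Strict algebras, pseudomorphisms and algebra 2-cells\<close>

text \<open>
  The four 2-monads are those for monoidal categories and for symmetric monoidal categories,
  without or with the requirement that the unit object be terminal.  Their strict algebras are
  these (not necessarily strict) monoidal categories, their pseudomorphisms the strong (symmetric)
  monoidal functors, and their algebra 2-cells the monoidal natural transformations.
\<close>

datatype doctrine =
    Monoidal
  | Symmetric_Monoidal
  | Terminal_Unit_Monoidal
  | Terminal_Unit_Symmetric_Monoidal

definition symmetric_doctrine :: "doctrine \<Rightarrow> bool" where
  "symmetric_doctrine S \<longleftrightarrow> S \<in> {Symmetric_Monoidal, Terminal_Unit_Symmetric_Monoidal}"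

definition terminal_unit_doctrine :: "doctrine \<Rightarrow> bool" where
  "terminal_unit_doctrine S \<longleftrightarrow> S \<in> {Terminal_Unit_Monoidal, Terminal_Unit_Symmetric_Monoidal}"

text \<open>
  The symmetry is \<open>None\<close> for the non-symmetric doctrines, so that no spurious data are carried along.
\<close>

record ('o, 'a) algebra_structure =
  tensor :: "('o \<times> 'o, 'a \<times> 'a, 'o, 'a) ftor"
  munit :: 'o
  associator :: "'o \<times> 'o \<times> 'o \<Rightarrow> 'a"
  lunitor :: "'o \<Rightarrow> 'a"
  runitor :: "'o \<Rightarrow> 'a"
  symmetry :: "('o \<times> 'o \<Rightarrow> 'a) option"

type_synonym ('o, 'a) algebra = "('o, 'a) cat \<times> ('o, 'a) algebra_structure"

abbreviation tensor_obj :: "('o, 'a) algebra_structure \<Rightarrow> 'o \<Rightarrow> 'o \<Rightarrow> 'o" where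
  "tensor_obj M x y \<equiv> fobj (tensor M) (x, y)"

abbreviation tensor_arr :: "('o, 'a) algebra_structure \<Rightarrow> 'a \<Rightarrow> 'a \<Rightarrow> 'a" where
  "tensor_arr M f g \<equiv> farr (tensor M) (f, g)"

definition monoidal_category :: "('o, 'a) algebra \<Rightarrow> bool" where
  "monoidal_category = (\<lambda>(C, M).
     let ob = tensor_obj M; ar = tensor_arr M; I = munit M; i = ident C;
         al = (\<lambda>x y z. associator M (x, y, z)); l = lunitor M; r = runitor M
     in category C \<and>
        is_functor (prod_cat C C) C (tensor M) \<and>
        I \<in> objs C \<and>
        nat_iso (prod_cat C (prod_cat C C)) C
          (make_functor (prod_cat C (prod_cat C C))
             (\<lambda>(x, y, z). ob (ob x y) z) (\<lambda>(f, g, h). ar (ar f g) h))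
          (make_functor (prod_cat C (prod_cat C C))
             (\<lambda>(x, y, z). ob x (ob y z)) (\<lambda>(f, g, h). ar f (ar g h)))
          (associator M) \<and>
        nat_iso C C (make_functor C (\<lambda>x. ob I x) (\<lambda>f. ar (i I) f)) (id_functor C) l \<and>
        nat_iso C C (make_functor C (\<lambda>x. ob x I) (\<lambda>f. ar f (i I))) (id_functor C) r \<and>
        (\<forall>w\<in>objs C. \<forall>x\<in>objs C. \<forall>y\<in>objs C. \<forall>z\<in>objs C.
           al w x (ob y z) \<cdot>\<^bsub>C\<^esub> al (ob w x) y z =
           ar (i w) (al x y z) \<cdot>\<^bsub>C\<^esub> al w (ob x y) z \<cdot>\<^bsub>C\<^esub> ar (al w x y) (i z)) \<and>
        (\<forall>x\<in>objs C. \<forall>y\<in>objs C.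
           ar (i x) (l y) \<cdot>\<^bsub>C\<^esub> al x I y = ar (r x) (i y)))"

definition symmetric_structure ::
    "('o, 'a) algebra \<Rightarrow> ('o \<times> 'o \<Rightarrow> 'a) \<Rightarrow> bool" where
  "symmetric_structure = (\<lambda>(C, M) sw.
     let ob = tensor_obj M; ar = tensor_arr M; i = ident C;
         al = (\<lambda>x y z. associator M (x, y, z)); s = (\<lambda>x y. sw (x, y))
     in nat_iso (prod_cat C C) C (tensor M)
          (make_functor (prod_cat C C) (\<lambda>(x, y). ob y x) (\<lambda>(f, g). ar g f)) sw \<and>
        (\<forall>x\<in>objs C. \<forall>y\<in>objs C. s y x \<cdot>\<^bsub>C\<^esub> s x y = i (ob x y)) \<and>
        (\<forall>x\<in>objs C. \<forall>y\<in>objs C. \<forall>z\<in>objs C.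
           al y z x \<cdot>\<^bsub>C\<^esub> s x (ob y z) \<cdot>\<^bsub>C\<^esub> al x y z =
           ar (i y) (s x z) \<cdot>\<^bsub>C\<^esub> al y x z \<cdot>\<^bsub>C\<^esub> ar (s x y) (i z)))"

definition strict_algebra :: "'u itself \<Rightarrow> doctrine \<Rightarrow> ('o, 'a) algebra \<Rightarrow> bool" where
  "strict_algebra U S A \<longleftrightarrow>
     locally_small_category U (fst A) \<and>
     monoidal_category A \<and>
     (case symmetry (snd A) of
        None \<Rightarrow> \<not> symmetric_doctrine S
      | Some s \<Rightarrow> symmetric_doctrine S \<and> symmetric_structure A s) \<and>
     (terminal_unit_doctrine S \<longrightarrow> is_terminal (fst A) (munit (snd A)))"

definition small_strict_algebra :: "doctrine \<Rightarrow> ('u, 'u) algebra \<Rightarrow> bool" where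
  "small_strict_algebra S A \<longleftrightarrow>
     strict_algebra TYPE('u) S A \<and> small_category TYPE('u) (fst A)"

record ('o, 'b) pseudo_structure =
  tensor_cell :: "'o \<times> 'o \<Rightarrow> 'b"
  unit_cell :: 'b

type_synonym ('o, 'a, 'p, 'b) pseudo = "('o, 'a, 'p, 'b) ftor \<times> ('o, 'b) pseudo_structure"

definition pseudomorphism :: "doctrine \<Rightarrow> ('o, 'a) algebra \<Rightarrow> ('p, 'b) algebra \<Rightarrow>
    ('o, 'a, 'p, 'b) pseudo \<Rightarrow> bool" where
  "pseudomorphism S = (\<lambda>(C, M) (D, N) (F, P).
     let Fo = fobj F; Fa = farr F; c = (\<lambda>x y. tensor_cell P (x, y)); c0 = unit_cell P;
         ob = tensor_obj M; ob' = tensor_obj N; ar' = tensor_arr N; i' = ident D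
     in is_functor C D F \<and>
        nat_iso (prod_cat C C) D
          (make_functor (prod_cat C C) (\<lambda>(x, y). ob' (Fo x) (Fo y)) (\<lambda>(f, g). ar' (Fa f) (Fa g)))
          (comp_functor (prod_cat C C) F (tensor M))
          (tensor_cell P) \<and>
        c0 \<in> hom D (munit N) (Fo (munit M)) \<and> iso_in D c0 \<and>
        (\<forall>x\<in>objs C. \<forall>y\<in>objs C. \<forall>z\<in>objs C.
           Fa (associator M (x, y, z)) \<cdot>\<^bsub>D\<^esub> c (ob x y) z \<cdot>\<^bsub>D\<^esub> ar' (c x y) (i' (Fo z)) =
           c x (ob y z) \<cdot>\<^bsub>D\<^esub> ar' (i' (Fo x)) (c y z) \<cdot>\<^bsub>D\<^esub> associator N (Fo x, Fo y, Fo z)) \<and>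
        (\<forall>x\<in>objs C.
           Fa (lunitor M x) \<cdot>\<^bsub>D\<^esub> c (munit M) x \<cdot>\<^bsub>D\<^esub> ar' c0 (i' (Fo x)) = lunitor N (Fo x)) \<and>
        (\<forall>x\<in>objs C.
           Fa (runitor M x) \<cdot>\<^bsub>D\<^esub> c x (munit M) \<cdot>\<^bsub>D\<^esub> ar' (i' (Fo x)) c0 = runitor N (Fo x)) \<and>
        (symmetric_doctrine S \<longrightarrow>
           (\<forall>x\<in>objs C. \<forall>y\<in>objs C.
              Fa (the (symmetry M) (x, y)) \<cdot>\<^bsub>D\<^esub> c x y =
              c y x \<cdot>\<^bsub>D\<^esub> the (symmetry N) (Fo x, Fo y))))"

definition id_pseudo :: "('o, 'a) algebra \<Rightarrow> ('o, 'a, 'o, 'a) pseudo" where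
  "id_pseudo = (\<lambda>(C, M). (id_functor C,
     \<lparr>tensor_cell = (\<lambda>(x, y)\<in>objs C \<times> objs C. ident C (tensor_obj M x y)),
      unit_cell = ident C (munit M)\<rparr>))"

definition comp_pseudo :: "('o, 'a) cat \<Rightarrow> ('q, 'c) cat \<Rightarrow> ('p, 'b, 'q, 'c) pseudo \<Rightarrow>
    ('o, 'a, 'p, 'b) pseudo \<Rightarrow> ('o, 'a, 'q, 'c) pseudo" where
  "comp_pseudo C E = (\<lambda>(G, Q) (F, P). (comp_functor C G F,
     \<lparr>tensor_cell = (\<lambda>(x, y)\<in>objs C \<times> objs C.
        farr G (tensor_cell P (x, y)) \<cdot>\<^bsub>E\<^esub> tensor_cell Q (fobj F x, fobj F y)),
      unit_cell = farr G (unit_cell P) \<cdot>\<^bsub>E\<^esub> unit_cell Q\<rparr>))"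

definition algebra_2cell :: "('o, 'a) algebra \<Rightarrow> ('p, 'b) algebra \<Rightarrow>
    ('o, 'a, 'p, 'b) pseudo \<Rightarrow> ('o, 'a, 'p, 'b) pseudo \<Rightarrow> ('o \<Rightarrow> 'b) \<Rightarrow> bool" where
  "algebra_2cell = (\<lambda>(C, M) (D, N) (F, P) (G, Q) t.
     nat_trans C D F G t \<and>
     (\<forall>x\<in>objs C. \<forall>y\<in>objs C.
        t (tensor_obj M x y) \<cdot>\<^bsub>D\<^esub> tensor_cell P (x, y) =
        tensor_cell Q (x, y) \<cdot>\<^bsub>D\<^esub> tensor_arr N (t x) (t y)) \<and>
     t (munit M) \<cdot>\<^bsub>D\<^esub> unit_cell P = unit_cell Q)"


section \<open>Liftings\<close>

text \<open>
  A lifting is given by \<open>alg A\<close>, an algebra structure on the presheaves on \<open>A\<close>; \<open>ext A B F\<close>, a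
  pseudomorphism structure on \<open>F\<^sup>*\<close> (which may depend on that of \<open>F\<close>); and \<open>yon A\<close>, a
  pseudomorphism structure on the Yoneda embedding.
\<close>

type_synonym 'u small_algebra = "('u, 'u) algebra"
type_synonym 'u presheaf_pseudo = "('u, 'u, 'u psh, 'u psh_arrow) pseudo"

definition is_lifting :: "doctrine \<Rightarrow>
    ('u::universe small_algebra \<Rightarrow> ('u psh, 'u psh_arrow) algebra_structure) \<Rightarrow>
    ('u small_algebra \<Rightarrow> 'u small_algebra \<Rightarrow> 'u presheaf_pseudo \<Rightarrow>
       ('u psh, 'u psh_arrow) pseudo_structure) \<Rightarrow>
    ('u small_algebra \<Rightarrow> ('u, 'u psh_arrow) pseudo_structure) \<Rightarrow> bool" where
  "is_lifting S alg ext yon \<longleftrightarrow>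
     (let PA = (\<lambda>A. (presheaves (fst A), alg A));
          star = (\<lambda>A B F. (kan (fst A) (fst B) (fst F), ext A B F));
          y = (\<lambda>A. (yoneda (fst A), yon A));
          Alg = Collect (small_strict_algebra S);
          Ps = (\<lambda>A B. Collect (pseudomorphism S A (PA B)));
          cp = (\<lambda>A C. comp_pseudo (fst A) (presheaves (fst C)));
          cpP = (\<lambda>A C. comp_pseudo (presheaves (fst A)) (presheaves (fst C)))
      in
       (\<forall>A\<in>Alg. strict_algebra TYPE('u) S (PA A)) \<and>
       (\<forall>A\<in>Alg. \<forall>B\<in>Alg. \<forall>F\<in>Ps A B. pseudomorphism S (PA A) (PA B) (star A B F)) \<and>
       (\<forall>A\<in>Alg. pseudomorphism S A (PA A) (y A)) \<and>
       (\<forall>A\<in>Alg. \<forall>B\<in>Alg. \<forall>C\<in>Alg. \<forall>F\<in>Ps A B. \<forall>G\<in>Ps B C.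
          algebra_2cell (PA A) (PA C)
            (star A C (cp A C (star B C G) F))
            (cpP A C (star B C G) (star A B F))
            (mu (fst A) (fst B) (fst C) (fst G) (fst F))) \<and>
       (\<forall>A\<in>Alg. \<forall>B\<in>Alg. \<forall>F\<in>Ps A B.
          algebra_2cell A (PA B) F (cp A B (star A B F) (y A)) (eta (fst A) (fst B) (fst F))) \<and>
       (\<forall>A\<in>Alg.
          algebra_2cell (PA A) (PA A) (star A A (y A)) (id_pseudo (PA A)) (theta (fst A))))"

end

theory Submission
  imports Defs
begin

text \<open>
  The presheaves on \<open>A\<close> carry Day convolution: \<open>p \<otimes> q\<close> is the universal recipient of families
  \<open>p(x) \<times> q(y) \<rightarrow> r(x \<otimes> y)\<close> natural in \<open>x\<close> and \<open>y\<close>, and the unit is the representable at the unit of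
  \<open>A\<close>.  As for tensor products of modules, an arrow out of \<open>p \<otimes> q\<close> is the same as such a bilinear
  family, and two arrows agree once they agree on the generators \<open>s \<otimes> t\<close>; likewise \<open>F\<^sup>*(p)\<close> is
  generated by the classes \<open>[s, t]\<close> with \<open>s \<in> F(x)(y)\<close> and \<open>t \<in> p(x)\<close>.  Every cell of the lifting is
  therefore given by a formula on generators:
  \<open>(s \<otimes> t) \<otimes> w\<close> goes to the restriction of \<open>s \<otimes> (t \<otimes> w)\<close> along the associator of \<open>A\<close>;
  the structure of \<open>F\<^sup>*\<close> sends \<open>[s, t] \<otimes> [s', t']\<close> to \<open>[c(s \<otimes> s'), t \<otimes> t']\<close>, where \<open>c\<close> is that of \<open>F\<close>;
  \<open>mu\<close> sends \<open>[[r, s], t]\<close> to \<open>[r, [s, t]]\<close>; and \<open>theta\<close> sends \<open>[g, t]\<close> to \<open>p(g)(t)\<close>.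
  Each coherence axiom then reduces to the corresponding axiom of \<open>A\<close> or of \<open>F\<close>.
\<close>

section \<open>Small sets\<close>

text \<open>The coends of the statement are sets of codes of chosen representatives, and nothing
  about them is usable until two facts about such quotients are extracted: related tuples have equal
  codes, and a map that respects the relations can be evaluated on any code through the
  representative stored in it. The universal properties used later rest on these two facts. No coend
  calculus is set up; Fubini and co-Yoneda appear only as pairs of mutually inverse formulas on
  generators. The delicate point is that some arguments which ought to be generators are arbitrary
  elements. The inner factor of a threefold tensor product is written as a restriction of a
  generator, and that restriction is moved outside. The preimage of an element under the invertible
  cell of \<open>F\<close> has no such formula, so it is handled by whole arrows instead
  (\<open>iso_in_kan_tensor\<close>). Since \<open>mu\<close> and \<open>theta\<close> are definite
  descriptions, their formulas on generators require uniqueness, which comes from the density of the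
  representables.\<close>

lemma small_subset: "small U A \<Longrightarrow> B \<subseteq> A \<Longrightarrow> small U B"
  unfolding small_def using card_of_mono1 ordLeq_ordLess_trans by blast

lemma small_image: "small U A \<Longrightarrow> small U (f ` A)"
  unfolding small_def using card_of_image ordLeq_ordLess_trans by blast

lemma small_inj_on: "inj_on f A \<Longrightarrow> small U (f ` A) \<Longrightarrow> small U A"
  unfolding small_def
  using card_of_ordLeq ordLeq_ordLess_trans
  by (metis order.refl)

lemma small_embed:
  assumes "small TYPE('u) A"
  obtains f :: "'a \<Rightarrow> 'u" where "inj_on f A"
  using assms unfolding small_def
  by (metis card_of_ordLeq ordLess_imp_ordLeq)

text \<open>The power-set axiom of the class \<open>universe\<close> speaks only of subsets of the
  type itself. An injection carries an arbitrary small set there, and the induced injection of power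
  sets brings smallness back.\<close>

lemma small_Pow_set:
  assumes "small TYPE('u::universe) A"
  shows "small TYPE('u) (Pow A)"
proof -
  obtain f :: "'a \<Rightarrow> 'u" where f: "inj_on f A" using small_embed[OF assms] .
  have "small TYPE('u) (Pow (f ` A))"
    using small_image[OF assms] unfolding small_def by (rule small_Pow)
  then show ?thesis
    by (intro small_inj_on[OF inj_on_image_Pow[OF f]]) (metis image_Pow_surj)
qed

lemma inj_pairing: "\<exists>e :: 'u::universe \<times> 'u \<Rightarrow> 'u. inj e"
proof -
  have "|UNIV \<times> UNIV :: ('u \<times> 'u) set| \<le>o |UNIV :: 'u set|"
    using card_of_Times_same_infinite[OF infinite_universe] ordIso_iff_ordLeq by blast
  then show ?thesis by (metis UNIV_Times_UNIV card_of_ordLeq)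
qed

text \<open>Makes the choice in \<open>triple_code\<close> a genuine injection, so that an element
  of a coend can be decoded into its representative triple.\<close>

lemma inj_tripling: "\<exists>e :: 'u::universe \<times> 'u \<times> 'u \<Rightarrow> 'u. inj e"
proof -
  obtain e :: "'u \<times> 'u \<Rightarrow> 'u" where e: "inj e" using inj_pairing by blast
  have "inj (\<lambda>(x, y, z). e (x, e (y, z)))"
    by (auto intro!: injI simp: inj_eq[OF e])
  then show ?thesis by blast
qed

lemma inj_quintupling: "\<exists>e :: 'u::universe \<times> 'u \<times> 'u \<times> 'u \<times> 'u \<Rightarrow> 'u. inj e"
proof -
  obtain e :: "'u \<times> 'u \<Rightarrow> 'u" where e: "inj e" using inj_pairing by blast
  have "inj (\<lambda>(x, y, z, v, w). e (x, e (y, e (z, e (v, w)))))"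
    by (auto intro!: injI simp: inj_eq[OF e])
  then show ?thesis by blast
qed

text \<open>This is regularity of the universe. The axiom on unions wants the index set and the
  members inside the universe type, hence the injections \<open>f\<close> and \<open>g x\<close>,
  glued by the pairing \<open>e\<close>.\<close>

lemma small_Sigma:
  assumes A: "small TYPE('u::universe) A" and B: "\<And>x. x \<in> A \<Longrightarrow> small TYPE('u) (B x)"
  shows "small TYPE('u) (Sigma A B)"
proof -
  obtain e :: "'u \<times> 'u \<Rightarrow> 'u" where e: "inj e" using inj_pairing by blast
  obtain f :: "'a \<Rightarrow> 'u" where f: "inj_on f A" using small_embed[OF A] .
  have "\<forall>x\<in>A. \<exists>g :: 'b \<Rightarrow> 'u. inj_on g (B x)" using small_embed[OF B] by metis
  then obtain g :: "'a \<Rightarrow> 'b \<Rightarrow> 'u" where g: "\<And>x. x \<in> A \<Longrightarrow> inj_on (g x) (B x)"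
    by metis
  define h where "h = (\<lambda>(x, y). e (f x, g x y))"
  have "inj_on h (Sigma A B)"
  proof (rule inj_onI)
    fix v w assume vw: "v \<in> Sigma A B" "w \<in> Sigma A B" "h v = h w"
    then have "f (fst v) = f (fst w)" "g (fst v) (snd v) = g (fst w) (snd w)"
      by (auto simp: h_def split_beta dest: injD[OF e])
    with vw show "v = w"
      using inj_onD[OF f, of "fst v" "fst w"] inj_onD[OF g, of "fst v" "snd v" "snd w"]
      by (auto simp: prod_eq_iff)
  qed
  moreover have "small TYPE('u) (h ` Sigma A B)"
  proof -
    \<comment> \<open>\<open>K u\<close> is the image under \<open>h\<close> of the fibre whose
      index has code \<open>u\<close>; \<open>inv_into A f\<close> recovers that index, so the union
      runs over codes in the universe rather than over \<open>A\<close>.\<close>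
    define K where "K u = (\<lambda>y. e (u, g (inv_into A f u) y)) ` B (inv_into A f u)" for u
    have "h ` Sigma A B \<subseteq> \<Union> (K ` f ` A)"
      using f by (force simp: h_def K_def)
    moreover have "small TYPE('u) (\<Union> (K ` f ` A))"
      using small_image[OF A, of f] B f
      unfolding small_def
      by (intro small_UN) (auto simp: K_def small_def[symmetric, where U="TYPE('u)"] intro!: small_image)
    ultimately show ?thesis using small_subset by blast
  qed
  ultimately show ?thesis by (rule small_inj_on)
qed

lemma small_Times:
  "small TYPE('u::universe) A \<Longrightarrow> small TYPE('u) B \<Longrightarrow> small TYPE('u) (A \<times> B)"
  by (rule small_Sigma)


section \<open>Categories\<close>

lemma
  assumes "category C"
  shows cat_src[simp]: "f \<in> arrs C \<Longrightarrow> src C f \<in> objs C"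
    and cat_tgt[simp]: "f \<in> arrs C \<Longrightarrow> tgt C f \<in> objs C"
    and ident_arr[simp]: "x \<in> objs C \<Longrightarrow> ident C x \<in> arrs C"
    and src_ident[simp]: "x \<in> objs C \<Longrightarrow> src C (ident C x) = x"
    and tgt_ident[simp]: "x \<in> objs C \<Longrightarrow> tgt C (ident C x) = x"
    and cmp_arr[simp]: "f \<in> arrs C \<Longrightarrow> g \<in> arrs C \<Longrightarrow> tgt C f = src C g \<Longrightarrow> g \<cdot>\<^bsub>C\<^esub> f \<in> arrs C"
    and src_cmp[simp]: "f \<in> arrs C \<Longrightarrow> g \<in> arrs C \<Longrightarrow> tgt C f = src C g \<Longrightarrow> src C (g \<cdot>\<^bsub>C\<^esub> f) = src C f"
    and tgt_cmp[simp]: "f \<in> arrs C \<Longrightarrow> g \<in> arrs C \<Longrightarrow> tgt C f = src C g \<Longrightarrow> tgt C (g \<cdot>\<^bsub>C\<^esub> f) = tgt C g"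
    and cmp_ident_right[simp]: "f \<in> arrs C \<Longrightarrow> src C f = x \<Longrightarrow> f \<cdot>\<^bsub>C\<^esub> ident C x = f"
    and cmp_ident_left[simp]: "f \<in> arrs C \<Longrightarrow> tgt C f = x \<Longrightarrow> ident C x \<cdot>\<^bsub>C\<^esub> f = f"
    and cmp_assoc: "f \<in> arrs C \<Longrightarrow> g \<in> arrs C \<Longrightarrow> h \<in> arrs C \<Longrightarrow> tgt C f = src C g \<Longrightarrow>
      tgt C g = src C h \<Longrightarrow> (h \<cdot>\<^bsub>C\<^esub> g) \<cdot>\<^bsub>C\<^esub> f = h \<cdot>\<^bsub>C\<^esub> (g \<cdot>\<^bsub>C\<^esub> f)"
  using assms by (auto simp: category_def hom_def)

lemma hom_arr: "f \<in> hom C x y \<Longrightarrow> f \<in> arrs C"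
  and hom_src: "f \<in> hom C x y \<Longrightarrow> src C f = x"
  and hom_tgt: "f \<in> hom C x y \<Longrightarrow> tgt C f = y"
  by (auto simp: hom_def)

lemma hom_cmp: "category C \<Longrightarrow> f \<in> hom C x y \<Longrightarrow> g \<in> hom C y z \<Longrightarrow> g \<cdot>\<^bsub>C\<^esub> f \<in> hom C x z"
  by (auto simp: hom_def)

lemma small_category_category[simp]: "small_category U C \<Longrightarrow> category C"
  by (simp add: small_category_def)

lemma op_cat_simps[simp]:
  "objs (op_cat C) = objs C" "arrs (op_cat C) = arrs C" "src (op_cat C) = tgt C"
  "tgt (op_cat C) = src C" "ident (op_cat C) = ident C" "g \<cdot>\<^bsub>op_cat C\<^esub> f = f \<cdot>\<^bsub>C\<^esub> g"
  by (simp_all add: op_cat_def)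

lemma prod_cat_simps[simp]:
  "objs (prod_cat C D) = objs C \<times> objs D" "arrs (prod_cat C D) = arrs C \<times> arrs D"
  "src (prod_cat C D) (f, f') = (src C f, src D f')"
  "tgt (prod_cat C D) (f, f') = (tgt C f, tgt D f')"
  "ident (prod_cat C D) (x, x') = (ident C x, ident D x')"
  "(g, g') \<cdot>\<^bsub>prod_cat C D\<^esub> (f, f') = (g \<cdot>\<^bsub>C\<^esub> f, g' \<cdot>\<^bsub>D\<^esub> f')"
  by (simp_all add: prod_cat_def)

lemma make_functor_simps[simp]:
  "x \<in> objs C \<Longrightarrow> fobj (make_functor C fo fa) x = fo x"
  "f \<in> arrs C \<Longrightarrow> farr (make_functor C fo fa) f = fa f"
  by (simp_all add: make_functor_def)

lemma functor_simps:
  assumes "is_functor C D F"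
  shows fobj_mem: "x \<in> objs C \<Longrightarrow> fobj F x \<in> objs D"
    and farr_arr: "f \<in> arrs C \<Longrightarrow> farr F f \<in> arrs D"
    and farr_src: "f \<in> arrs C \<Longrightarrow> src D (farr F f) = fobj F (src C f)"
    and farr_tgt: "f \<in> arrs C \<Longrightarrow> tgt D (farr F f) = fobj F (tgt C f)"
    and farr_ident: "x \<in> objs C \<Longrightarrow> farr F (ident C x) = ident D (fobj F x)"
    and farr_cmp: "f \<in> arrs C \<Longrightarrow> g \<in> arrs C \<Longrightarrow> tgt C f = src C g \<Longrightarrow>
      farr F (g \<cdot>\<^bsub>C\<^esub> f) = farr F g \<cdot>\<^bsub>D\<^esub> farr F f"
  using assms by (auto simp: is_functor_def hom_def)

lemma is_functor_make_functor:
  assumes "category C"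
    and "\<And>x. x \<in> objs C \<Longrightarrow> fo x \<in> objs D"
    and "\<And>f. f \<in> arrs C \<Longrightarrow> fa f \<in> hom D (fo (src C f)) (fo (tgt C f))"
    and "\<And>x. x \<in> objs C \<Longrightarrow> fa (ident C x) = ident D (fo x)"
    and "\<And>f g. f \<in> arrs C \<Longrightarrow> g \<in> arrs C \<Longrightarrow> tgt C f = src C g \<Longrightarrow> fa (g \<cdot>\<^bsub>C\<^esub> f) = fa g \<cdot>\<^bsub>D\<^esub> fa f"
  shows "is_functor C D (make_functor C fo fa)"
  using assms unfolding is_functor_def make_functor_def by auto

lemma category_op_cat: "category C \<Longrightarrow> category (op_cat C)"
  unfolding category_def by (auto simp: hom_def)

lemma category_prod_cat[simp]: "category C \<Longrightarrow> category D \<Longrightarrow> category (prod_cat C D)"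
  unfolding category_def by (auto simp: hom_def)

lemma is_functor_comp_functor:
  assumes "category C" "is_functor C D F" "is_functor D E G"
  shows "is_functor C E (comp_functor C G F)"
  unfolding comp_functor_def
  using assms
  by (intro is_functor_make_functor)
    (auto simp: functor_simps[OF assms(2)] functor_simps[OF assms(3)] hom_def)

lemma is_functor_id_functor: "category C \<Longrightarrow> is_functor C C (id_functor C)"
  unfolding id_functor_def by (intro is_functor_make_functor) (auto simp: hom_def)

lemma comp_functor_simps[simp]:
  "x \<in> objs C \<Longrightarrow> fobj (comp_functor C G F) x = fobj G (fobj F x)"
  "f \<in> arrs C \<Longrightarrow> farr (comp_functor C G F) f = farr G (farr F f)"
  by (simp_all add: comp_functor_def)

lemma id_functor_simps[simp]:
  "x \<in> objs C \<Longrightarrow> fobj (id_functor C) x = x"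
  "f \<in> arrs C \<Longrightarrow> farr (id_functor C) f = f"
  by (simp_all add: id_functor_def)

lemma nat_transD:
  assumes "nat_trans C D F G t"
  shows "x \<in> objs C \<Longrightarrow> t x \<in> hom D (fobj F x) (fobj G x)"
    and "f \<in> arrs C \<Longrightarrow> farr G f \<cdot>\<^bsub>D\<^esub> t (src C f) = t (tgt C f) \<cdot>\<^bsub>D\<^esub> farr F f"
  using assms by (auto simp: nat_trans_def)

lemma nat_isoD:
  assumes "nat_iso C D F G t"
  shows "x \<in> objs C \<Longrightarrow> t x \<in> hom D (fobj F x) (fobj G x)"
    and "f \<in> arrs C \<Longrightarrow> farr G f \<cdot>\<^bsub>D\<^esub> t (src C f) = t (tgt C f) \<cdot>\<^bsub>D\<^esub> farr F f"
    and "x \<in> objs C \<Longrightarrow> iso_in D (t x)"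
  using assms by (auto simp: nat_iso_def nat_trans_def)

lemma iso_inE:
  assumes "iso_in C f"
  obtains g where "g \<in> arrs C" "src C g = tgt C f" "tgt C g = src C f"
    "g \<cdot>\<^bsub>C\<^esub> f = ident C (src C f)" "f \<cdot>\<^bsub>C\<^esub> g = ident C (tgt C f)"
  using assms by (auto simp: iso_in_def hom_def)

lemma iso_in_cmp:
  assumes C: "category C" and f: "iso_in C f" and g: "iso_in C g" and fg: "tgt C f = src C g"
  shows "iso_in C (g \<cdot>\<^bsub>C\<^esub> f)"
proof -
  have fa: "f \<in> arrs C" "g \<in> arrs C" using f g by (auto simp: iso_in_def)
  obtain f' where f': "f' \<in> arrs C" "src C f' = tgt C f" "tgt C f' = src C f"
    "f' \<cdot>\<^bsub>C\<^esub> f = ident C (src C f)" "f \<cdot>\<^bsub>C\<^esub> f' = ident C (tgt C f)" by (rule iso_inE[OF f])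
  obtain g' where g': "g' \<in> arrs C" "src C g' = tgt C g" "tgt C g' = src C g"
    "g' \<cdot>\<^bsub>C\<^esub> g = ident C (src C g)" "g \<cdot>\<^bsub>C\<^esub> g' = ident C (tgt C g)" by (rule iso_inE[OF g])
  have "(f' \<cdot>\<^bsub>C\<^esub> g') \<cdot>\<^bsub>C\<^esub> (g \<cdot>\<^bsub>C\<^esub> f) = f' \<cdot>\<^bsub>C\<^esub> ((g' \<cdot>\<^bsub>C\<^esub> g) \<cdot>\<^bsub>C\<^esub> f)"
    using C fa f'(1-3) g'(1-3) fg by (simp add: cmp_assoc)
  also have "\<dots> = ident C (src C (g \<cdot>\<^bsub>C\<^esub> f))" using C fa f' g' fg by simp
  finally have 1: "(f' \<cdot>\<^bsub>C\<^esub> g') \<cdot>\<^bsub>C\<^esub> (g \<cdot>\<^bsub>C\<^esub> f) = ident C (src C (g \<cdot>\<^bsub>C\<^esub> f))" .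
  have "(g \<cdot>\<^bsub>C\<^esub> f) \<cdot>\<^bsub>C\<^esub> (f' \<cdot>\<^bsub>C\<^esub> g') = g \<cdot>\<^bsub>C\<^esub> ((f \<cdot>\<^bsub>C\<^esub> f') \<cdot>\<^bsub>C\<^esub> g')"
    using C fa f'(1-3) g'(1-3) fg by (simp add: cmp_assoc)
  also have "\<dots> = ident C (tgt C (g \<cdot>\<^bsub>C\<^esub> f))" using C fa f' g' fg by simp
  finally have 2: "(g \<cdot>\<^bsub>C\<^esub> f) \<cdot>\<^bsub>C\<^esub> (f' \<cdot>\<^bsub>C\<^esub> g') = ident C (tgt C (g \<cdot>\<^bsub>C\<^esub> f))" .
  show ?thesis unfolding iso_in_def
    using C fa f'(1-3) g'(1-3) fg 1 2
    by (intro conjI bexI[of _ "f' \<cdot>\<^bsub>C\<^esub> g'"]) (auto simp: hom_def)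
qed

lemma iso_in_ident: "category C \<Longrightarrow> x \<in> objs C \<Longrightarrow> iso_in C (ident C x)"
  unfolding iso_in_def by (auto intro!: bexI[of _ "ident C x"] simp: hom_def)


section \<open>Presheaves as sets with an action\<close>

text \<open>Together with \<open>ap\<close> this hides the triples of \<open>set_cat\<close>: a
  presheaf becomes a family of sets with a contravariant action and an arrow a family of equivariant
  maps, so that rewriting takes place on elements.\<close>

definition act :: "('u, 'u) cat \<Rightarrow> 'u psh \<Rightarrow> 'u \<Rightarrow> 'u \<Rightarrow> 'u" where
  "act X p f t = app (farr p f) t"

definition ap :: "('u, 'u) cat \<Rightarrow> 'u psh_arrow \<Rightarrow> 'u \<Rightarrow> 'u \<Rightarrow> 'u" where
  "ap X m y = component m y"

definition presheaf :: "('u, 'u) cat \<Rightarrow> 'u psh \<Rightarrow> bool" where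
  "presheaf X p \<longleftrightarrow> is_functor (op_cat X) set_cat p"

lemma objs_presheaves[simp]: "p \<in> objs (presheaves X) \<longleftrightarrow> presheaf X p"
  by (simp add: presheaves_def functor_cat_def presheaf_def)

lemma set_cat_simps[simp]:
  "A \<in> objs (set_cat :: ('u set, 'u set_arrow) cat) \<longleftrightarrow> small TYPE('u) A"
  "src set_cat m = fst m" "tgt set_cat m = fst (snd m)"
  "ident set_cat A = (A, A, \<lambda>a\<in>A. a)"
  "m' \<cdot>\<^bsub>set_cat\<^esub> m = (fst m, fst (snd m'), compose (fst m) (app m') (app m))"
  by (auto simp: set_cat_def app_def split: prod.splits)

lemma arrs_set_cat:
  "m \<in> arrs (set_cat :: ('u set, 'u set_arrow) cat) \<longleftrightarrow>
    small TYPE('u) (fst m) \<and> small TYPE('u) (fst (snd m)) \<and> app m \<in> fst m \<rightarrow>\<^sub>E fst (snd m)"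
  by (auto simp: set_cat_def app_def split: prod.splits)

lemma set_arrow_eqI: "fst m = fst m' \<Longrightarrow> fst (snd m) = fst (snd m') \<Longrightarrow> app m = app m' \<Longrightarrow> m = m'"
  by (auto simp: app_def prod_eq_iff)

lemma app_triple[simp]: "app (A, B, h) = h"
  by (simp add: app_def)

lemma
  assumes p: "presheaf (X :: ('u, 'u) cat) p"
  shows presheaf_small[simp]: "x \<in> objs X \<Longrightarrow> small TYPE('u) (fobj p x)"
    and fst_farr_presheaf: "f \<in> arrs X \<Longrightarrow> fst (farr p f) = fobj p (tgt X f)"
    and fst_snd_farr_presheaf: "f \<in> arrs X \<Longrightarrow> fst (snd (farr p f)) = fobj p (src X f)"
    and act_mem: "f \<in> arrs X \<Longrightarrow> t \<in> fobj p (tgt X f) \<Longrightarrow> act X p f t \<in> fobj p (src X f)"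
    and act_ident[simp]: "x \<in> objs X \<Longrightarrow> t \<in> fobj p x \<Longrightarrow> act X p (ident X x) t = t"
    and act_cmp: "f \<in> arrs X \<Longrightarrow> g \<in> arrs X \<Longrightarrow> tgt X f = src X g \<Longrightarrow> t \<in> fobj p (tgt X g) \<Longrightarrow>
      act X p (g \<cdot>\<^bsub>X\<^esub> f) t = act X p f (act X p g t)"
proof -
  note p' = functor_simps[OF p[unfolded presheaf_def], simplified]
  show "x \<in> objs X \<Longrightarrow> small TYPE('u) (fobj p x)" by (rule p')
  show 1: "f \<in> arrs X \<Longrightarrow> fst (farr p f) = fobj p (tgt X f)" for f using p' by metis
  show 2: "f \<in> arrs X \<Longrightarrow> fst (snd (farr p f)) = fobj p (src X f)" for f using p' by metis
  have 3: "f \<in> arrs X \<Longrightarrow> app (farr p f) \<in> fobj p (tgt X f) \<rightarrow>\<^sub>E fobj p (src X f)" for f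
    using p'(2)[of f] by (simp add: arrs_set_cat 1 2)
  show "f \<in> arrs X \<Longrightarrow> t \<in> fobj p (tgt X f) \<Longrightarrow> act X p f t \<in> fobj p (src X f)"
    unfolding act_def using 3 by blast
  show "x \<in> objs X \<Longrightarrow> t \<in> fobj p x \<Longrightarrow> act X p (ident X x) t = t"
    using p'(5)[of x] by (simp add: act_def)
  show "f \<in> arrs X \<Longrightarrow> g \<in> arrs X \<Longrightarrow> tgt X f = src X g \<Longrightarrow> t \<in> fobj p (tgt X g) \<Longrightarrow>
      act X p (g \<cdot>\<^bsub>X\<^esub> f) t = act X p f (act X p g t)"
    using p'(6)[of g f] by (simp add: compose_def 1 act_def)
qed

lemma act_mem'[simp]:
  "presheaf X p \<Longrightarrow> f \<in> arrs X \<Longrightarrow> t \<in> fobj p (tgt X f) \<Longrightarrow> src X f = x \<Longrightarrow> act X p f t \<in> fobj p x"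
  by (metis act_mem)

definition make_presheaf ::
    "('u, 'u) cat \<Rightarrow> ('u \<Rightarrow> 'u set) \<Rightarrow> ('u \<Rightarrow> 'u \<Rightarrow> 'u) \<Rightarrow> 'u psh" where
  "make_presheaf X P a = make_functor (op_cat X) P
     (\<lambda>f. (P (tgt X f), P (src X f), \<lambda>t\<in>P (tgt X f). a f t))"

lemma make_presheaf_simps[simp]:
  "x \<in> objs X \<Longrightarrow> fobj (make_presheaf X P a) x = P x"
  "f \<in> arrs X \<Longrightarrow> t \<in> P (tgt X f) \<Longrightarrow> act X (make_presheaf X P a) f t = a f t"
  by (simp_all add: make_presheaf_def act_def)

lemma presheaf_make_presheaf:
  fixes X :: "('u, 'u) cat"
  assumes X: "category X" and P: "\<And>x. x \<in> objs X \<Longrightarrow> small TYPE('u) (P x)"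
    and "\<And>f t. f \<in> arrs X \<Longrightarrow> t \<in> P (tgt X f) \<Longrightarrow> a f t \<in> P (src X f)"
    and "\<And>x t. x \<in> objs X \<Longrightarrow> t \<in> P x \<Longrightarrow> a (ident X x) t = t"
    and "\<And>f g t. f \<in> arrs X \<Longrightarrow> g \<in> arrs X \<Longrightarrow> tgt X f = src X g \<Longrightarrow> t \<in> P (tgt X g) \<Longrightarrow>
      a (g \<cdot>\<^bsub>X\<^esub> f) t = a f (a g t)"
  shows "presheaf X (make_presheaf X P a)"
  unfolding presheaf_def make_presheaf_def
proof (intro is_functor_make_functor category_op_cat X)
  fix f g assume "f \<in> arrs (op_cat X)" "g \<in> arrs (op_cat X)" "tgt (op_cat X) f = src (op_cat X) g"
  then show "(P (tgt X (g \<cdot>\<^bsub>op_cat X\<^esub> f)), P (src X (g \<cdot>\<^bsub>op_cat X\<^esub> f)),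
      \<lambda>t\<in>P (tgt X (g \<cdot>\<^bsub>op_cat X\<^esub> f)). a (g \<cdot>\<^bsub>op_cat X\<^esub> f) t) =
    (P (tgt X g), P (src X g), \<lambda>t\<in>P (tgt X g). a g t) \<cdot>\<^bsub>set_cat\<^esub>
      (P (tgt X f), P (src X f), \<lambda>t\<in>P (tgt X f). a f t)"
    using assms(3)[of f] by (auto simp: X compose_def restrict_def fun_eq_iff assms(5))
qed (use assms in \<open>auto simp: hom_def arrs_set_cat cong: restrict_cong\<close>)

definition make_arrow :: "('u, 'u) cat \<Rightarrow> 'u psh \<Rightarrow> 'u psh \<Rightarrow> ('u \<Rightarrow> 'u \<Rightarrow> 'u) \<Rightarrow> 'u psh_arrow" where
  "make_arrow X p q h = (p, q, \<lambda>x\<in>objs X. (fobj p x, fobj q x, \<lambda>t\<in>fobj p x. h x t))"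

lemma ap_make_arrow[simp]:
  "x \<in> objs X \<Longrightarrow> t \<in> fobj p x \<Longrightarrow> ap X (make_arrow X p q h) x t = h x t"
  by (simp add: ap_def component_def make_arrow_def)

lemma src_presheaves: "src (presheaves X) m = fst m"
  and tgt_presheaves: "tgt (presheaves X) m = fst (snd m)"
  by (auto simp: presheaves_def functor_cat_def split: prod.splits)

lemma hom_presheaves_iff:
  "m \<in> hom (presheaves X) p q \<longleftrightarrow> fst m = p \<and> fst (snd m) = q \<and>
    nat_trans (op_cat X) set_cat p q (snd (snd m))"
  by (auto simp: hom_def src_presheaves tgt_presheaves)
    (auto simp: presheaves_def functor_cat_def split: prod.splits)

lemma hom_presheavesD:
  assumes m: "m \<in> hom (presheaves X) p q"
  shows "presheaf X p" "presheaf X q"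
    and "x \<in> objs X \<Longrightarrow> fst (snd (snd m) x) = fobj p x"
    and "x \<in> objs X \<Longrightarrow> fst (snd (snd (snd m) x)) = fobj q x"
    and "x \<in> objs X \<Longrightarrow> ap X m x \<in> fobj p x \<rightarrow>\<^sub>E fobj q x"
    and "x \<in> objs X \<Longrightarrow> t \<in> fobj p x \<Longrightarrow> ap X m x t \<in> fobj q x"
proof -
  have nt: "nat_trans (op_cat X) set_cat p q (snd (snd m))"
    using m by (simp add: hom_presheaves_iff)
  show p: "presheaf X p" "presheaf X q" using nt by (auto simp: nat_trans_def presheaf_def)
  note n = nat_transD[OF nt, simplified]
  show 1: "x \<in> objs X \<Longrightarrow> fst (snd (snd m) x) = fobj p x"
    "x \<in> objs X \<Longrightarrow> fst (snd (snd (snd m) x)) = fobj q x" for x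
    using n(1) by (auto simp: hom_def)
  show 3: "x \<in> objs X \<Longrightarrow> ap X m x \<in> fobj p x \<rightarrow>\<^sub>E fobj q x" for x
    using n(1)[of x] by (auto simp: hom_def arrs_set_cat ap_def component_def)
  then show "x \<in> objs X \<Longrightarrow> t \<in> fobj p x \<Longrightarrow> ap X m x t \<in> fobj q x" by blast
qed

lemma ap_natural:
  assumes X: "category X" and m: "m \<in> hom (presheaves X) p q"
    and f: "f \<in> arrs X" and t: "t \<in> fobj p (tgt X f)"
  shows "ap X m (src X f) (act X p f t) = act X q f (ap X m (tgt X f) t)"
proof -
  have "nat_trans (op_cat X) set_cat p q (snd (snd m))"
    using m by (simp add: hom_presheaves_iff)
  note n = nat_transD(2)[OF this, simplified, OF f]
  show ?thesis
    using n t X f hom_presheavesD(1-4)[OF m]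
    by (auto simp: ap_def act_def component_def compose_def fst_farr_presheaf fun_eq_iff split: if_splits)
qed


text \<open>Arrows record their source, their target and extensional component functions, so HOL
  equality of arrows is equality at every element. The uniqueness principles on generators below all
  end here.\<close>

lemma presheaf_arrow_eqI:
  assumes "m \<in> hom (presheaves X) p q" "m' \<in> hom (presheaves X) p q"
    and "\<And>x t. x \<in> objs X \<Longrightarrow> t \<in> fobj p x \<Longrightarrow> ap X m x t = ap X m' x t"
  shows "m = m'"
proof -
  note D = hom_presheavesD[OF assms(1)] and D' = hom_presheavesD[OF assms(2)]
  have "snd (snd m) x = snd (snd m') x" if "x \<in> objs X" for x
  proof (rule set_arrow_eqI)
    have "ap X m x = ap X m' x"
      using that assms(3) by (intro PiE_ext[OF D(5) D'(5)]) auto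
    then show "app (snd (snd m) x) = app (snd (snd m') x)" by (simp add: ap_def component_def)
  qed (use that D D' in simp_all)
  then have "snd (snd m) = snd (snd m')"
    using assms(1,2) by (intro extensionalityI[of _ "objs X"])
      (auto simp: hom_presheaves_iff nat_trans_def)
  with assms(1,2) show ?thesis by (simp add: hom_presheaves_iff prod_eq_iff)
qed

lemma make_arrow_hom:
  fixes X :: "('u, 'u) cat"
  assumes X: "category X" and p: "presheaf X p" and q: "presheaf X q"
    and h: "\<And>x t. x \<in> objs X \<Longrightarrow> t \<in> fobj p x \<Longrightarrow> h x t \<in> fobj q x"
    and nat: "\<And>f t. f \<in> arrs X \<Longrightarrow> t \<in> fobj p (tgt X f) \<Longrightarrow>
      h (src X f) (act X p f t) = act X q f (h (tgt X f) t)"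
  shows "make_arrow X p q h \<in> hom (presheaves X) p q"
proof -
  have "farr q f \<cdot>\<^bsub>set_cat\<^esub> (fobj p (tgt X f), fobj q (tgt X f), \<lambda>t\<in>fobj p (tgt X f). h (tgt X f) t) =
      (fobj p (src X f), fobj q (src X f), \<lambda>t\<in>fobj p (src X f). h (src X f) t) \<cdot>\<^bsub>set_cat\<^esub> farr p f"
    if f: "f \<in> arrs X" for f
    using f nat[OF f] act_mem[OF p f]
    by (auto simp: act_def fst_farr_presheaf[OF p f] fst_snd_farr_presheaf[OF q f] compose_def fun_eq_iff)
  then have "\<forall>f\<in>arrs (op_cat X). farr q f \<cdot>\<^bsub>set_cat\<^esub> snd (snd (make_arrow X p q h)) (src (op_cat X) f) =
      snd (snd (make_arrow X p q h)) (tgt (op_cat X) f) \<cdot>\<^bsub>set_cat\<^esub> farr p f"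
    using X by (simp add: make_arrow_def del: set_cat_simps)
  then show ?thesis
    using X p q h unfolding hom_presheaves_iff nat_trans_def
    by (simp add: hom_def arrs_set_cat presheaf_def[symmetric] del: set_cat_simps(5))
      (simp add: make_arrow_def)
qed

lemma ident_presheaves:
  "ident (presheaves X) p = make_arrow X p p (\<lambda>x t. t)"
  by (simp add: presheaves_def functor_cat_def make_arrow_def)

lemma cmp_presheaves:
  assumes "m \<in> hom (presheaves X) p q" "m' \<in> hom (presheaves X) q r"
  shows "m' \<cdot>\<^bsub>presheaves X\<^esub> m = make_arrow X p r (\<lambda>x t. ap X m' x (ap X m x t))"
proof -
  obtain s s' where m: "m = (p, q, s)" "m' = (q, r, s')"
    using assms by (cases m, cases m') (auto simp: hom_presheaves_iff)
  show ?thesis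
    using hom_presheavesD(3,4)[OF assms(1)] hom_presheavesD(3,4)[OF assms(2)] unfolding m
    by (auto simp: presheaves_def functor_cat_def make_arrow_def ap_def component_def compose_def fun_eq_iff)
qed

lemma category_presheaves[simp]:
  assumes X: "category (X :: ('u, 'u) cat)"
  shows "category (presheaves X)"
proof -
  let ?P = "presheaves X"
  have hom: "f \<in> hom ?P (src ?P f) (tgt ?P f)" if "f \<in> arrs ?P" for f
    using that by (simp add: hom_def)
  have id: "ident ?P p \<in> hom ?P p p" if "presheaf X p" for p
    unfolding ident_presheaves using that X by (intro make_arrow_hom) auto
  have cmp: "g \<cdot>\<^bsub>?P\<^esub> f \<in> hom ?P p r" if "f \<in> hom ?P p q" "g \<in> hom ?P q r" for f g p q r
    unfolding cmp_presheaves[OF that]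
    using hom_presheavesD[OF that(1)] hom_presheavesD[OF that(2)]
    by (intro make_arrow_hom X) (auto simp: ap_natural[OF X that(1)] ap_natural[OF X that(2)] X)
  have ccmp: "ap X (g \<cdot>\<^bsub>?P\<^esub> f) x t = ap X g x (ap X f x t)"
    if "f \<in> hom ?P p q" "g \<in> hom ?P q r" "x \<in> objs X" "t \<in> fobj p x" for f g p q r x t
    using that(3,4) by (simp add: cmp_presheaves[OF that(1,2)])
  have cid: "ap X (ident ?P p) x t = t" if "x \<in> objs X" "t \<in> fobj p x" for p x t
    using that by (simp add: ident_presheaves)
  show ?thesis unfolding category_def
  proof (intro conjI ballI impI)
    fix f assume f: "f \<in> arrs ?P"
    note D = hom_presheavesD[OF hom[OF f]]
    show "src ?P f \<in> objs ?P" "tgt ?P f \<in> objs ?P" using D by auto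
    show "f \<cdot>\<^bsub>?P\<^esub> ident ?P (src ?P f) = f"
      by (rule presheaf_arrow_eqI[OF cmp[OF id hom] hom])
        (simp_all add: f D cid ccmp[OF id[OF D(1)] hom[OF f]])
    show "ident ?P (tgt ?P f) \<cdot>\<^bsub>?P\<^esub> f = f"
      by (rule presheaf_arrow_eqI[OF cmp[OF hom id] hom])
        (simp_all add: f D cid ccmp[OF hom[OF f] id[OF D(2)]])
  next
    fix f g h assume f: "f \<in> arrs ?P" and g: "g \<in> arrs ?P" and h: "h \<in> arrs ?P"
      and fg: "tgt ?P f = src ?P g" and gh: "tgt ?P g = src ?P h"
    note f = hom[OF f, unfolded fg] and g = hom[OF g, unfolded gh] and h = hom[OF h]
    show "(h \<cdot>\<^bsub>?P\<^esub> g) \<cdot>\<^bsub>?P\<^esub> f = h \<cdot>\<^bsub>?P\<^esub> (g \<cdot>\<^bsub>?P\<^esub> f)"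
      by (rule presheaf_arrow_eqI[OF cmp[OF f cmp[OF g h]] cmp[OF cmp[OF f g] h]])
        (simp add: ccmp[OF f cmp[OF g h]] ccmp[OF cmp[OF f g] h] ccmp[OF f g] ccmp[OF g h]
          hom_presheavesD[OF f])
  qed (use id cmp hom in \<open>auto simp: hom_def\<close>)
qed

lemma ap_ident[simp]:
  "x \<in> objs X \<Longrightarrow> t \<in> fobj p x \<Longrightarrow> ap X (ident (presheaves X) p) x t = t"
  by (simp add: ident_presheaves)

lemma ap_cmp[simp]:
  assumes "m \<in> arrs (presheaves X)" "m' \<in> arrs (presheaves X)"
    "tgt (presheaves X) m = src (presheaves X) m'" "x \<in> objs X" "t \<in> fobj (src (presheaves X) m) x"
  shows "ap X (m' \<cdot>\<^bsub>presheaves X\<^esub> m) x t = ap X m' x (ap X m x t)"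
proof -
  have "m \<in> hom (presheaves X) (src (presheaves X) m) (src (presheaves X) m')"
    "m' \<in> hom (presheaves X) (src (presheaves X) m') (tgt (presheaves X) m')"
    using assms by (auto simp: hom_def)
  from cmp_presheaves[OF this] assms show ?thesis by simp
qed

lemma ap_mem[simp]:
  assumes "m \<in> arrs (presheaves X)" "tgt (presheaves X) m = q" "x \<in> objs X"
    "t \<in> fobj (src (presheaves X) m) x"
  shows "ap X m x t \<in> fobj q x"
  using hom_presheavesD(6)[of m X "src (presheaves X) m" q] assms by (auto simp: hom_def)

lemma ap_act[simp]:
  assumes "category X" "m \<in> arrs (presheaves X)" "f \<in> arrs X" "src X f = x"
    "t \<in> fobj (src (presheaves X) m) (tgt X f)" "src (presheaves X) m = p"
  shows "ap X m x (act X p f t) = act X (tgt (presheaves X) m) f (ap X m (tgt X f) t)"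
  using ap_natural[of X m "src (presheaves X) m" "tgt (presheaves X) m"] assms
  by (auto simp: hom_def)

lemma presheaf_src[simp]: "m \<in> arrs (presheaves X) \<Longrightarrow> presheaf X (src (presheaves X) m)"
  and presheaf_tgt[simp]: "m \<in> arrs (presheaves X) \<Longrightarrow> presheaf X (tgt (presheaves X) m)"
  using hom_presheavesD(1,2)[of m X "src (presheaves X) m" "tgt (presheaves X) m"]
  by (auto simp: hom_def)

lemma iso_in_presheavesI:
  assumes X: "category X" and m: "m \<in> hom (presheaves X) p q" and m': "m' \<in> hom (presheaves X) q p"
    and "\<And>x t. x \<in> objs X \<Longrightarrow> t \<in> fobj p x \<Longrightarrow> ap X m' x (ap X m x t) = t"
    and "\<And>x t. x \<in> objs X \<Longrightarrow> t \<in> fobj q x \<Longrightarrow> ap X m x (ap X m' x t) = t"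
  shows "iso_in (presheaves X) m"
proof -
  have pq: "presheaf X p" "presheaf X q" using m by (auto dest: hom_presheavesD)
  have "m' \<cdot>\<^bsub>presheaves X\<^esub> m = ident (presheaves X) p"
    using assms pq by (intro presheaf_arrow_eqI[OF hom_cmp[OF _ m m'], of "ident (presheaves X) p"])
      (auto simp: hom_def)
  moreover have "m \<cdot>\<^bsub>presheaves X\<^esub> m' = ident (presheaves X) q"
    using assms pq by (intro presheaf_arrow_eqI[OF hom_cmp[OF _ m' m], of "ident (presheaves X) q"])
      (auto simp: hom_def)
  ultimately show ?thesis
    using m m' unfolding iso_in_def by (intro conjI bexI[of _ m']) (auto simp: hom_def)
qed

text \<open>An arrow is determined by its graph, a set of triples \<open>(x, t, m_x(t))\<close>
  inside a small set; there is only a small set of such subsets. This is where the strong limit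
  property of the universe enters.\<close>

lemma small_hom_presheaves:
  fixes X :: "('u::universe, 'u) cat"
  assumes X: "small_category TYPE('u) X"
  shows "small TYPE('u) (hom (presheaves X) p q)"
proof (cases "presheaf X p \<and> presheaf X q")
  case True
  define graph :: "'u psh_arrow \<Rightarrow> ('u \<times> 'u \<times> 'u) set"
    where "graph m = (SIGMA x:objs X. (\<lambda>t. (t, ap X m x t)) ` fobj p x)" for m
  have "inj_on graph (hom (presheaves X) p q)"
  proof (rule inj_onI)
    fix m m' assume m: "m \<in> hom (presheaves X) p q" "m' \<in> hom (presheaves X) p q"
      and eq: "graph m = graph m'"
    show "m = m'"
    proof (rule presheaf_arrow_eqI[OF m])
      fix x t assume "x \<in> objs X" "t \<in> fobj p x"
      then have "(x, t, ap X m x t) \<in> graph m'" unfolding eq[symmetric] by (auto simp: graph_def)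
      then show "ap X m x t = ap X m' x t" by (auto simp: graph_def)
    qed
  qed
  moreover have "graph ` hom (presheaves X) p q \<subseteq> Pow (SIGMA x:objs X. fobj p x \<times> fobj q x)"
    by (auto simp: graph_def dest: hom_presheavesD(6))
  moreover have "small TYPE('u) (Pow (SIGMA x:objs X. fobj p x \<times> fobj q x))"
    using X True by (intro small_Pow_set small_Sigma small_Times) (auto simp: small_category_def)
  ultimately have "inj_on graph (hom (presheaves X) p q)" "small TYPE('u) (graph ` hom (presheaves X) p q)"
    by (simp_all add: small_subset)
  then show ?thesis by (rule small_inj_on)
next
  case False
  then have "hom (presheaves X) p q = {}" by (auto dest: hom_presheavesD)
  then show ?thesis
    using finite_ordLess_infinite[of "|{} :: 'u psh_arrow set|" "|UNIV :: 'u set|"] infinite_universe[where 'a='u]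
    by (simp add: small_def card_of_well_order_on Field_card_of)
qed

lemma locally_small_presheaves:
  "small_category TYPE('u) X \<Longrightarrow> locally_small_category TYPE('u) (presheaves (X :: ('u::universe, 'u) cat))"
  by (simp add: locally_small_category_def small_hom_presheaves)

section \<open>Representable presheaves and the Yoneda embedding\<close>

lemma yoneda_obj_eq: "yoneda_obj X x = make_presheaf X (\<lambda>w. hom X w x) (\<lambda>f g. g \<cdot>\<^bsub>X\<^esub> f)"
  by (simp add: yoneda_obj_def make_presheaf_def)

lemma fobj_yoneda_obj[simp]: "w \<in> objs X \<Longrightarrow> fobj (yoneda_obj X x) w = hom X w x"
  by (simp add: yoneda_obj_eq)

lemma act_yoneda_obj[simp]:
  "f \<in> arrs X \<Longrightarrow> g \<in> hom X (tgt X f) x \<Longrightarrow> act X (yoneda_obj X x) f g = g \<cdot>\<^bsub>X\<^esub> f"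
  by (simp add: yoneda_obj_eq)

lemma presheaf_yoneda_obj[simp]:
  fixes X :: "('u, 'u) cat"
  assumes X: "small_category TYPE('u) X"
  shows "presheaf X (yoneda_obj X x)"
  unfolding yoneda_obj_eq
proof (rule presheaf_make_presheaf)
  show "small TYPE('u) (hom X w x)" for w
    by (rule small_subset[of _ "arrs X"]) (use X in \<open>auto simp: small_category_def hom_def\<close>)
qed (use small_category_category[OF X] in \<open>auto simp: hom_def cmp_assoc\<close>)

lemma farr_yoneda:
  "f \<in> arrs X \<Longrightarrow> category X \<Longrightarrow> farr (yoneda X) f =
    make_arrow X (yoneda_obj X (src X f)) (yoneda_obj X (tgt X f)) (\<lambda>w g. f \<cdot>\<^bsub>X\<^esub> g)"
  by (auto simp: yoneda_def make_arrow_def)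

lemma fobj_yoneda[simp]: "x \<in> objs X \<Longrightarrow> fobj (yoneda X) x = yoneda_obj X x"
  by (simp add: yoneda_def)

lemma ap_farr_yoneda[simp]:
  "f \<in> arrs X \<Longrightarrow> category X \<Longrightarrow> w \<in> objs X \<Longrightarrow> g \<in> hom X w (src X f) \<Longrightarrow>
    ap X (farr (yoneda X) f) w g = f \<cdot>\<^bsub>X\<^esub> g"
  by (simp add: farr_yoneda)

lemma is_functor_yoneda:
  fixes X :: "('u, 'u) cat"
  assumes X: "small_category TYPE('u) X"
  shows "is_functor X (presheaves X) (yoneda X)"
proof -
  note C = small_category_category[OF X]
  let ?h = "\<lambda>f. make_arrow X (yoneda_obj X (src X f)) (yoneda_obj X (tgt X f)) (\<lambda>w g. f \<cdot>\<^bsub>X\<^esub> g)"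
  have hom: "?h f \<in> hom (presheaves X) (yoneda_obj X (src X f)) (yoneda_obj X (tgt X f))"
    if "f \<in> arrs X" for f
    using X C that by (intro make_arrow_hom) (auto simp: hom_def cmp_assoc)
  have "is_functor X (presheaves X) (make_functor X (yoneda_obj X) ?h)"
  proof (rule is_functor_make_functor[OF C])
    show "?h (ident X x) = ident (presheaves X) (yoneda_obj X x)" if "x \<in> objs X" for x
      using hom[of "ident X x"] that C X
      by (intro presheaf_arrow_eqI[where X=X and p="yoneda_obj X x" and q="yoneda_obj X x"])
         (auto simp: hom_def)
    show "?h (g \<cdot>\<^bsub>X\<^esub> f) = ?h g \<cdot>\<^bsub>presheaves X\<^esub> ?h f"
      if "f \<in> arrs X" "g \<in> arrs X" "tgt X f = src X g" for f g
      using hom[of "g \<cdot>\<^bsub>X\<^esub> f"] hom[of g] hom[of f] that C X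
      by (intro presheaf_arrow_eqI[where X=X and p="yoneda_obj X (src X f)" and q="yoneda_obj X (tgt X g)"])
         (auto simp: hom_def cmp_assoc)
  qed (use X hom in auto)
  moreover have "yoneda X = make_functor X (yoneda_obj X) ?h"
    by (auto simp: yoneda_def make_functor_def farr_yoneda C make_arrow_def cong: restrict_cong)
  ultimately show ?thesis by simp
qed

text \<open>One half of the Yoneda lemma: this is the arrow that names the element \<open>t\<close>,
  since its value at the identity of \<open>x\<close> is \<open>t\<close>. It serves to transport
  facts from representables to arbitrary presheaves.\<close>

lemma yoneda_arrow:
  fixes X :: "('u, 'u) cat"
  assumes "small_category TYPE('u) X" and "presheaf X p" "x \<in> objs X" "t \<in> fobj p x"
  shows "make_arrow X (yoneda_obj X x) p (\<lambda>w g. act X p g t) \<in> hom (presheaves X) (yoneda_obj X x) p"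
  using assms small_category_category[OF assms(1)]
  by (intro make_arrow_hom) (auto simp: hom_def act_cmp)

section \<open>Quotients by generated equivalence relations\<close>

text \<open>Linked points reach the same points in the generated equivalence, so \<open>SOME\<close>
  is applied to one and the same predicate on both sides. This gives the relations that hold in the
  quotient.\<close>

lemma some_rep_eq:
  assumes "(v, w) \<in> R"
  shows "(SOME u. (v, u) \<in> (R \<union> R\<inverse>)\<^sup>*) = (SOME u. (w, u) \<in> (R \<union> R\<inverse>)\<^sup>*)"
proof -
  have "(v, w) \<in> (R \<union> R\<inverse>)\<^sup>*" "(w, v) \<in> (R \<union> R\<inverse>)\<^sup>*" using assms by auto
  then have "(v, u) \<in> (R \<union> R\<inverse>)\<^sup>* \<longleftrightarrow> (w, u) \<in> (R \<union> R\<inverse>)\<^sup>*" for u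
    by (meson rtrancl_trans)
  then show ?thesis by simp
qed

text \<open>The chosen representative is joined to \<open>w\<close> by a zigzag of the relation, and
  \<open>h\<close> is constant along it. This lets maps descend to the quotient.\<close>

lemma some_rep_invariant:
  assumes "\<And>v w. (v, w) \<in> R \<Longrightarrow> h v = h w"
  shows "h (SOME u. (w, u) \<in> (R \<union> R\<inverse>)\<^sup>*) = h w"
proof -
  have "(w, SOME u. (w, u) \<in> (R \<union> R\<inverse>)\<^sup>*) \<in> (R \<union> R\<inverse>)\<^sup>*" by (rule someI[of _ w]) simp
  then show ?thesis
    by (induction rule: rtrancl_induct) (auto dest: assms)
qed


section \<open>The Kan extension by generators and relations\<close>

lemma inj_triple_code: "inj (triple_code :: 'u::universe \<times> 'u \<times> 'u \<Rightarrow> 'u)"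
  unfolding triple_code_def by (rule someI_ex[OF inj_tripling])

definition kel :: "('u, 'u) cat \<Rightarrow> 'u pdiagram \<Rightarrow> 'u psh \<Rightarrow> 'u \<Rightarrow> 'u \<Rightarrow> 'u \<Rightarrow> 'u \<Rightarrow> 'u" where
  "kel X F p y x s t = coend_class X F p y (x, s, t)"

text \<open>Decodes the representative stored in a class and applies \<open>H\<close> to it. The
  result is independent of the choice of representative only when \<open>H\<close> respects the
  coend relation, which is the hypothesis of \<open>klift_kel\<close>.\<close>

definition klift :: "('u \<Rightarrow> 'u \<Rightarrow> 'u \<Rightarrow> 'b) \<Rightarrow> 'u::universe \<Rightarrow> 'b" where
  "klift H c = (case inv triple_code c of (x, s, t) \<Rightarrow> H x s t)"

lemma klift_kel:
  assumes "\<And>f s t. f \<in> arrs X \<Longrightarrow> s \<in> fobj (fobj F (src X f)) y \<Longrightarrow> t \<in> fobj p (tgt X f) \<Longrightarrow>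
    H (src X f) s (act X p f t) = H (tgt X f) (ap Y (farr F f) y s) t"
  shows "klift H (kel X F p y x s t) = H x s t"
proof -
  have "(case SOME v. ((x, s, t), v) \<in> (coend_rel X F p y \<union> (coend_rel X F p y)\<inverse>)\<^sup>* of (x, s, t) \<Rightarrow> H x s t) =
    (case (x, s, t) of (x, s, t) \<Rightarrow> H x s t)"
    by (rule some_rep_invariant) (auto simp: coend_rel_def assms[unfolded act_def ap_def])
  then show ?thesis
    by (simp add: klift_def kel_def coend_class_def inv_f_f[OF inj_triple_code])
qed

lemma kel_dinatural:
  "f \<in> arrs X \<Longrightarrow> s \<in> fobj (fobj F (src X f)) y \<Longrightarrow> t \<in> fobj p (tgt X f) \<Longrightarrow>
    kel X F p y (src X f) s (act X p f t) = kel X F p y (tgt X f) (ap Y (farr F f) y s) t"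
  unfolding kel_def coend_class_def
  by (rule arg_cong[where f=triple_code], rule some_rep_eq) (auto simp: coend_rel_def act_def ap_def)

definition diagram :: "('u::universe, 'u) cat \<Rightarrow> ('u, 'u) cat \<Rightarrow> 'u pdiagram \<Rightarrow> bool" where
  "diagram X Y F \<longleftrightarrow> small_category TYPE('u) X \<and> small_category TYPE('u) Y \<and>
     is_functor X (presheaves Y) F"

lemma
  assumes "diagram (X :: ('u::universe, 'u) cat) Y F"
  shows diagram_small_dom: "small_category TYPE('u) X"
    and diagram_small_cod: "small_category TYPE('u) Y"
    and diagram_dom: "category X"
    and diagram_cod: "category Y"
    and diagram_functor: "is_functor X (presheaves Y) F"
    and diagram_presheaf[simp]: "x \<in> objs X \<Longrightarrow> presheaf Y (fobj F x)"
    and diagram_arr[simp]: "f \<in> arrs X \<Longrightarrow> farr F f \<in> arrs (presheaves Y)"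
    and diagram_src[simp]: "f \<in> arrs X \<Longrightarrow> src (presheaves Y) (farr F f) = fobj F (src X f)"
    and diagram_tgt[simp]: "f \<in> arrs X \<Longrightarrow> tgt (presheaves Y) (farr F f) = fobj F (tgt X f)"
    and diagram_cmp[simp]: "f \<in> arrs X \<Longrightarrow> g \<in> arrs X \<Longrightarrow> tgt X f = src X g \<Longrightarrow>
      farr F (g \<cdot>\<^bsub>X\<^esub> f) = farr F g \<cdot>\<^bsub>presheaves Y\<^esub> farr F f"
    and diagram_ident[simp]: "x \<in> objs X \<Longrightarrow> farr F (ident X x) = ident (presheaves Y) (fobj F x)"
  using assms functor_simps[of X "presheaves Y" F] unfolding diagram_def by auto

lemmas diagram_cats = diagram_small_dom diagram_small_cod diagram_dom diagram_cod

lemma diagram_yoneda: "small_category TYPE('u) X \<Longrightarrow> diagram (X :: ('u::universe, 'u) cat) X (yoneda X)"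
  by (simp add: diagram_def is_functor_yoneda)

lemma kan_obj_eq:
  fixes X :: "('u::universe, 'u) cat"
  shows "kan_obj X Y F p = make_presheaf Y (coend X F p)
    (\<lambda>g. klift (\<lambda>x s t. kel X F p (src Y g) x (act Y (fobj F x) g s) t))"
  by (simp add: kan_obj_def make_presheaf_def coend_map_def klift_def kel_def act_def split_beta)

lemma fobj_kan_obj: "y \<in> objs Y \<Longrightarrow> fobj (kan_obj X Y F p) y = coend X F p y"
  by (simp add: kan_obj_def)

lemma kan_obj_cases:
  fixes X :: "('u::universe, 'u) cat"
  assumes "c \<in> fobj (kan_obj X Y F p) y" "y \<in> objs Y"
  obtains x s t where "x \<in> objs X" "s \<in> fobj (fobj F x) y" "t \<in> fobj p x" "c = kel X F p y x s t"
  using assms by (auto simp: kan_obj_eq coend_def coend_triples_def kel_def)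

lemma kel_mem[simp]:
  fixes X :: "('u::universe, 'u) cat"
  shows "y \<in> objs Y \<Longrightarrow> x \<in> objs X \<Longrightarrow> s \<in> fobj (fobj F x) y \<Longrightarrow> t \<in> fobj p x \<Longrightarrow>
    kel X F p y x s t \<in> fobj (kan_obj X Y F p) y"
  by (simp add: kan_obj_eq coend_def coend_triples_def kel_def)

text \<open>Restriction along \<open>g\<close> respects the coend relation because each
  \<open>F(f)\<close> is an arrow of presheaves and so commutes with it; hence the action may be
  computed on any representative.\<close>

lemma act_kel[simp]:
  assumes F: "diagram (X :: ('u::universe, 'u) cat) Y F" and p: "presheaf X p"
    and "g \<in> arrs Y" "x \<in> objs X" "s \<in> fobj (fobj F x) (tgt Y g)" "t \<in> fobj p x" "tgt Y g = y"
  shows "act Y (kan_obj X Y F p) g (kel X F p y x s t) =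
    kel X F p (src Y g) x (act Y (fobj F x) g s) t"
proof -
  note [simp] = diagram_cats[OF F]
  have "kel X F p (src Y g) (src X f) (act Y (fobj F (src X f)) g s) (act X p f t) =
      kel X F p (src Y g) (tgt X f) (act Y (fobj F (tgt X f)) g (ap Y (farr F f) (tgt Y g) s)) t"
    if "f \<in> arrs X" "s \<in> fobj (fobj F (src X f)) (tgt Y g)" "t \<in> fobj p (tgt X f)" for f s t
    using that F assms(3) by (simp add: kel_dinatural[where Y=Y])
  moreover have "kel X F p (tgt Y g) x s t \<in> coend X F p (tgt Y g)"
    using assms by (simp add: kel_def coend_def coend_triples_def)
  ultimately show ?thesis
    using assms by (auto simp: kan_obj_eq intro!: klift_kel)
qed

lemma presheaf_kan_obj[simp]:
  fixes X :: "('u::universe, 'u) cat"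
  assumes F: "diagram X Y F" and p: "presheaf X p"
  shows "presheaf Y (kan_obj X Y F p)"
proof -
  note [simp] = diagram_cats[OF F]
  let ?K = "\<lambda>g. klift (\<lambda>x s t. kel X F p (src Y g) x (act Y (fobj F x) g s) t)"
  have K: "?K g (kel X F p (tgt Y g) x s t) = kel X F p (src Y g) x (act Y (fobj F x) g s) t"
    if "g \<in> arrs Y" "x \<in> objs X" "s \<in> fobj (fobj F x) (tgt Y g)" "t \<in> fobj p x" for g x s t
    using act_kel[OF F p that refl] that kel_mem[of "tgt Y g" Y x X s F t p]
    by (simp add: kan_obj_eq)
  have cases: "\<exists>x\<in>objs X. \<exists>s\<in>fobj (fobj F x) y. \<exists>t\<in>fobj p x. c = kel X F p y x s t"
    if "c \<in> coend X F p y" for c y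
    using that by (auto simp: coend_def coend_triples_def kel_def)
  have mem: "kel X F p y x s t \<in> coend X F p y"
    if "x \<in> objs X" "s \<in> fobj (fobj F x) y" "t \<in> fobj p x" for y x s t
    using that by (auto simp: coend_def coend_triples_def kel_def)
  have "presheaf Y (make_presheaf Y (coend X F p) ?K)"
  proof (rule presheaf_make_presheaf)
    fix y assume y: "y \<in> objs Y"
    have "coend_triples X F p y \<subseteq> (SIGMA x:objs X. fobj (fobj F x) y \<times> fobj p x)"
      by (auto simp: coend_triples_def)
    moreover have "small TYPE('u) (SIGMA x:objs X. fobj (fobj F x) y \<times> fobj p x)"
      using F p y diagram_small_dom[OF F] presheaf_small[of Y, OF diagram_presheaf[OF F]]
      by (intro small_Sigma small_Times) (auto simp: small_category_def)
    ultimately have "small TYPE('u) (coend_triples X F p y)" by (rule small_subset[rotated])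
    then show "small TYPE('u) (coend X F p y)"
      unfolding coend_def by (rule small_image)
  next
    fix g c assume "g \<in> arrs Y" "c \<in> coend X F p (tgt Y g)"
    then show "?K g c \<in> coend X F p (src Y g)"
      using F p cases[of c "tgt Y g"] by (auto simp: K intro!: mem)
  next
    fix y c assume "y \<in> objs Y" "c \<in> coend X F p y"
    then show "?K (ident Y y) c = c"
      using F p cases[of c y] K[of "ident Y y"] by auto
  next
    fix f g c assume "f \<in> arrs Y" "g \<in> arrs Y" "tgt Y f = src Y g" "c \<in> coend X F p (tgt Y g)"
    then show "?K (g \<cdot>\<^bsub>Y\<^esub> f) c = ?K f (?K g c)"
      using F p cases[of c "tgt Y g"] K[of "g \<cdot>\<^bsub>Y\<^esub> f"] K[of g] K[of f]
      by (auto simp: act_cmp)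
  qed simp
  then show ?thesis by (simp add: kan_obj_eq)
qed

text \<open>The universal property of the coends, for all \<open>y\<close> at once:
  \<open>dinat\<close> lets the formula \<open>H\<close> descend to classes, and \<open>nat\<close>
  makes the descended maps commute with restriction.\<close>

lemma kan_arrow_exists:
  assumes F: "diagram X Y F" and p: "presheaf X p" and q: "presheaf Y q"
    and mem: "\<And>y x s t. y \<in> objs Y \<Longrightarrow> x \<in> objs X \<Longrightarrow> s \<in> fobj (fobj F x) y \<Longrightarrow> t \<in> fobj p x \<Longrightarrow>
      H y x s t \<in> fobj q y"
    and nat: "\<And>g x s t. g \<in> arrs Y \<Longrightarrow> x \<in> objs X \<Longrightarrow> s \<in> fobj (fobj F x) (tgt Y g) \<Longrightarrow> t \<in> fobj p x \<Longrightarrow>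
      H (src Y g) x (act Y (fobj F x) g s) t = act Y q g (H (tgt Y g) x s t)"
    and dinat: "\<And>f y s t. f \<in> arrs X \<Longrightarrow> y \<in> objs Y \<Longrightarrow> s \<in> fobj (fobj F (src X f)) y \<Longrightarrow> t \<in> fobj p (tgt X f) \<Longrightarrow>
      H y (src X f) s (act X p f t) = H y (tgt X f) (ap Y (farr F f) y s) t"
  shows "\<exists>m\<in>hom (presheaves Y) (kan_obj X Y F p) q. \<forall>y\<in>objs Y. \<forall>x\<in>objs X.
    \<forall>s\<in>fobj (fobj F x) y. \<forall>t\<in>fobj p x. ap Y m y (kel X F p y x s t) = H y x s t"
proof -
  note [simp] = diagram_cats[OF F]
  have H: "klift (H y) (kel X F p y x s t) = H y x s t" if "y \<in> objs Y" for y x s t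
    by (rule klift_kel) (rule dinat[OF _ that])
  let ?m = "make_arrow Y (kan_obj X Y F p) q (\<lambda>y. klift (H y))"
  have "?m \<in> hom (presheaves Y) (kan_obj X Y F p) q"
  proof (rule make_arrow_hom)
    fix y c assume "y \<in> objs Y" "c \<in> fobj (kan_obj X Y F p) y"
    then show "klift (H y) c \<in> fobj q y" by (auto elim!: kan_obj_cases simp: H mem)
  next
    fix g c assume g: "g \<in> arrs Y" and "c \<in> fobj (kan_obj X Y F p) (tgt Y g)"
    then show "klift (H (src Y g)) (act Y (kan_obj X Y F p) g c) = act Y q g (klift (H (tgt Y g)) c)"
      using F p by (auto elim!: kan_obj_cases simp: H nat)
  qed (use F p q in simp_all)
  then show ?thesis by (intro bexI[of _ ?m]) (auto simp: H)
qed

lemma kan_arrow_eqI: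
  fixes X :: "('u::universe, 'u) cat"
  assumes "m \<in> hom (presheaves Y) (kan_obj X Y F p) q" "m' \<in> hom (presheaves Y) (kan_obj X Y F p) q"
    and "\<And>y x s t. y \<in> objs Y \<Longrightarrow> x \<in> objs X \<Longrightarrow> s \<in> fobj (fobj F x) y \<Longrightarrow> t \<in> fobj p x \<Longrightarrow>
      ap Y m y (kel X F p y x s t) = ap Y m' y (kel X F p y x s t)"
  shows "m = m'"
  using assms(3) by (auto elim!: kan_obj_cases intro!: presheaf_arrow_eqI[OF assms(1,2)])

lemma fobj_kan[simp]: "presheaf X p \<Longrightarrow> fobj (kan X Y F) p = kan_obj X Y F p"
  by (simp add: kan_def)

lemma farr_kan_eq:
  fixes X :: "('u::universe, 'u) cat"
  shows "a \<in> hom (presheaves X) p q \<Longrightarrow> farr (kan X Y F) a = make_arrow Y (kan_obj X Y F p) (kan_obj X Y F q)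
    (\<lambda>y. klift (\<lambda>x s t. kel X F q y x s (ap X a x t)))"
proof -
  assume a: "a \<in> hom (presheaves X) p q"
  obtain c where c: "a = (p, q, c)" using a by (cases a) (auto simp: hom_presheaves_iff)
  have "coend_map X F p q y y (\<lambda>(x, s, t). (x, s, app (c x) t)) =
      (coend X F p y, coend X F q y, \<lambda>t\<in>coend X F p y. klift (\<lambda>x s t. kel X F q y x s (ap X a x t)) t)" for y
    by (simp add: coend_map_def klift_def kel_def ap_def component_def c split_beta)
  then show ?thesis
    using hom_arr[OF a] by (auto simp: kan_def make_arrow_def fobj_kan_obj c)
qed

lemma
  assumes F: "diagram X Y F" and a: "a \<in> hom (presheaves X) p q"
  shows farr_kan_hom: "farr (kan X Y F) a \<in> hom (presheaves Y) (kan_obj X Y F p) (kan_obj X Y F q)"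
    and ap_farr_kan': "y \<in> objs Y \<Longrightarrow> x \<in> objs X \<Longrightarrow> s \<in> fobj (fobj F x) y \<Longrightarrow> t \<in> fobj p x \<Longrightarrow>
      ap Y (farr (kan X Y F) a) y (kel X F p y x s t) = kel X F q y x s (ap X a x t)"
proof -
  note [simp] = diagram_cats[OF F]
  have pq: "presheaf X p" "presheaf X q" using a by (auto dest: hom_presheavesD)
  have a': "a \<in> arrs (presheaves X)" "src (presheaves X) a = p" "tgt (presheaves X) a = q"
    using a by (auto simp: hom_def)
  have L: "klift (\<lambda>x s t. kel X F q y x s (ap X a x t)) (kel X F p y x s t) = kel X F q y x s (ap X a x t)"
    if "y \<in> objs Y" for y x s t
    using a' F that by (intro klift_kel) (simp add: kel_dinatural[where Y=Y])
  show "ap Y (farr (kan X Y F) a) y (kel X F p y x s t) = kel X F q y x s (ap X a x t)"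
    if "y \<in> objs Y" "x \<in> objs X" "s \<in> fobj (fobj F x) y" "t \<in> fobj p x"
    using that by (simp add: farr_kan_eq[OF a] L)
  show "farr (kan X Y F) a \<in> hom (presheaves Y) (kan_obj X Y F p) (kan_obj X Y F q)"
    unfolding farr_kan_eq[OF a]
  proof (rule make_arrow_hom)
    fix y c assume "y \<in> objs Y" "c \<in> fobj (kan_obj X Y F p) y"
    then show "klift (\<lambda>x s t. kel X F q y x s (ap X a x t)) c \<in> fobj (kan_obj X Y F q) y"
      by (elim kan_obj_cases) (use a' in \<open>simp_all add: L\<close>)
  next
    fix g c assume "g \<in> arrs Y" "c \<in> fobj (kan_obj X Y F p) (tgt Y g)"
    then show "klift (\<lambda>x s t. kel X F q (src Y g) x s (ap X a x t)) (act Y (kan_obj X Y F p) g c) =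
        act Y (kan_obj X Y F q) g (klift (\<lambda>x s t. kel X F q (tgt Y g) x s (ap X a x t)) c)"
      by (elim kan_obj_cases) (use a' F pq in \<open>simp_all add: L\<close>)
  qed (use F pq in simp_all)
qed

lemma
  assumes F: "diagram X Y F" and a: "a \<in> arrs (presheaves X)"
  shows farr_kan_arr[simp]: "farr (kan X Y F) a \<in> arrs (presheaves Y)"
    and farr_kan_src[simp]: "src (presheaves Y) (farr (kan X Y F) a) = kan_obj X Y F (src (presheaves X) a)"
    and farr_kan_tgt[simp]: "tgt (presheaves Y) (farr (kan X Y F) a) = kan_obj X Y F (tgt (presheaves X) a)"
    and ap_farr_kan[simp]: "y \<in> objs Y \<Longrightarrow> x \<in> objs X \<Longrightarrow> s \<in> fobj (fobj F x) y \<Longrightarrow>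
      t \<in> fobj p x \<Longrightarrow> src (presheaves X) a = p \<Longrightarrow> ap Y (farr (kan X Y F) a) y (kel X F p y x s t) =
        kel X F (tgt (presheaves X) a) y x s (ap X a x t)"
  using farr_kan_hom[OF F, of a "src (presheaves X) a" "tgt (presheaves X) a"]
    ap_farr_kan'[OF F, of a "src (presheaves X) a" "tgt (presheaves X) a"] a
  by (auto simp: hom_def)

lemma is_functor_kan:
  assumes F: "diagram X Y F"
  shows "is_functor (presheaves X) (presheaves Y) (kan X Y F)"
proof -
  note [simp] = diagram_cats[OF F]
  have "is_functor (presheaves X) (presheaves Y)
    (make_functor (presheaves X) (kan_obj X Y F) (farr (kan X Y F)))"
  proof (rule is_functor_make_functor)
    fix p assume "p \<in> objs (presheaves X)"
    then show "farr (kan X Y F) (ident (presheaves X) p) = ident (presheaves Y) (kan_obj X Y F p)"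
      using F by (intro kan_arrow_eqI[of _ Y X F p "kan_obj X Y F p"]) (auto simp: hom_def)
  next
    fix a b assume "a \<in> arrs (presheaves X)" "b \<in> arrs (presheaves X)"
      "tgt (presheaves X) a = src (presheaves X) b"
    then show "farr (kan X Y F) (b \<cdot>\<^bsub>presheaves X\<^esub> a) =
        farr (kan X Y F) b \<cdot>\<^bsub>presheaves Y\<^esub> farr (kan X Y F) a"
      using F
      by (intro kan_arrow_eqI[of _ Y X F "src (presheaves X) a" "kan_obj X Y F (tgt (presheaves X) b)"])
        (auto simp: hom_def)
  qed (use F in \<open>auto simp: hom_def\<close>)
  moreover have "make_functor (presheaves X) (kan_obj X Y F) (farr (kan X Y F)) = kan X Y F"
    by (simp add: kan_def make_functor_def)
  ultimately show ?thesis by simp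
qed

lemma diagram_comp_kan:
  assumes F: "diagram X Y F" and G: "diagram Y Z G"
  shows "diagram X Z (comp_functor X (kan Y Z G) F)"
  using is_functor_comp_functor[OF diagram_dom[OF F] diagram_functor[OF F] is_functor_kan[OF G]]
    diagram_small_dom[OF F] diagram_small_cod[OF G]
  by (simp add: diagram_def)


text \<open>Invertibility is the co-Yoneda argument: the inverse sends \<open>[s, g]\<close> to
  \<open>F(g)(s)\<close>, because the coend relation along \<open>g\<close> brings every generator
  to the form \<open>[F(g)(s), id]\<close>.\<close>

lemma
  assumes F: "diagram X Y F" and x: "x \<in> objs X"
  shows eta_hom: "eta X Y F x \<in> hom (presheaves Y) (fobj F x) (kan_obj X Y F (yoneda_obj X x))"
    and ap_eta[simp]: "y \<in> objs Y \<Longrightarrow> s \<in> fobj (fobj F x) y \<Longrightarrow>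
      ap Y (eta X Y F x) y s = kel X F (yoneda_obj X x) y x s (ident X x)"
    and iso_in_eta: "iso_in (presheaves Y) (eta X Y F x)"
proof -
  note [simp] = diagram_cats[OF F]
  have eq: "eta X Y F x = make_arrow Y (fobj F x) (kan_obj X Y F (yoneda_obj X x))
      (\<lambda>y s. kel X F (yoneda_obj X x) y x s (ident X x))"
    using x by (auto simp: eta_def make_arrow_def fobj_kan_obj kel_def fun_eq_iff)
  have "ident X x \<in> hom X x x" using x by (simp add: hom_def)
  then show hom: "eta X Y F x \<in> hom (presheaves Y) (fobj F x) (kan_obj X Y F (yoneda_obj X x))"
    unfolding eq using F x by (intro make_arrow_hom) simp_all
  show ap: "ap Y (eta X Y F x) y s = kel X F (yoneda_obj X x) y x s (ident X x)"
    if "y \<in> objs Y" "s \<in> fobj (fobj F x) y" for y s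
    using that by (simp add: eq)
  obtain m where m: "m \<in> hom (presheaves Y) (kan_obj X Y F (yoneda_obj X x)) (fobj F x)"
    and mk: "\<forall>y\<in>objs Y. \<forall>z\<in>objs X. \<forall>s\<in>fobj (fobj F z) y. \<forall>g\<in>fobj (yoneda_obj X x) z.
      ap Y m y (kel X F (yoneda_obj X x) y z s g) = ap Y (farr F g) y s"
    using kan_arrow_exists[OF F, of "yoneda_obj X x" "fobj F x" "\<lambda>y z s g. ap Y (farr F g) y s"] F x
    by (force simp: hom_def)
  show "iso_in (presheaves Y) (eta X Y F x)"
  proof (rule iso_in_presheavesI[OF _ hom m])
    fix y s assume "y \<in> objs Y" "s \<in> fobj (fobj F x) y"
    then show "ap Y m y (ap Y (eta X Y F x) y s) = s"
      using F x mk by (simp add: ap hom_def)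
  next
    fix y c assume y: "y \<in> objs Y" and "c \<in> fobj (kan_obj X Y F (yoneda_obj X x)) y"
    then show "ap Y (eta X Y F x) y (ap Y m y c) = c"
    proof (elim kan_obj_cases)
      fix z s g assume z: "z \<in> objs X" "s \<in> fobj (fobj F z) y" "g \<in> fobj (yoneda_obj X x) z"
        and c: "c = kel X F (yoneda_obj X x) y z s g"
      have g: "g \<in> arrs X" "src X g = z" "tgt X g = x" using z by (auto simp: hom_def)
      have "kel X F (yoneda_obj X x) y x (ap Y (farr F g) y s) (ident X x) = c"
        using kel_dinatural[of g X s F y "ident X x" "yoneda_obj X x" Y] g z x
        by (simp add: c hom_def)
      then show ?thesis using F y z g mk unfolding c by (simp add: ap)
    qed (use y in simp)
  qed simp
qed

lemma
  assumes F: "diagram (X :: ('u::universe, 'u) cat) Y F" and x: "x \<in> objs X"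
  shows eta_arr[simp]: "eta X Y F x \<in> arrs (presheaves Y)"
    and eta_src[simp]: "src (presheaves Y) (eta X Y F x) = fobj F x"
    and eta_tgt[simp]: "tgt (presheaves Y) (eta X Y F x) = kan_obj X Y F (yoneda_obj X x)"
  using eta_hom[OF assms] by (auto simp: hom_def)

text \<open>Every element of \<open>p(x)\<close> is the image of the identity under an arrow from a representable,
  so a transformation out of \<open>F\<^sup>*\<close> is determined by its restriction along \<open>eta\<close>.\<close>

lemma kan_nat_trans_eqI:
  assumes F: "diagram X Y F"
    and m: "nat_trans (presheaves X) (presheaves Y) (kan X Y F) H m"
    and m': "nat_trans (presheaves X) (presheaves Y) (kan X Y F) H m'"
    and eq: "\<And>x. x \<in> objs X \<Longrightarrow>
      m (yoneda_obj X x) \<cdot>\<^bsub>presheaves Y\<^esub> eta X Y F x = m' (yoneda_obj X x) \<cdot>\<^bsub>presheaves Y\<^esub> eta X Y F x"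
  shows "m = m'"
proof (rule extensionalityI[of _ "objs (presheaves X)"])
  note [simp] = diagram_cats[OF F]
  note X = diagram_small_dom[OF F]
  fix p assume "p \<in> objs (presheaves X)"
  then have p: "presheaf X p" by simp
  have H: "is_functor (presheaves X) (presheaves Y) H" using m by (simp add: nat_trans_def)
  have gen: "ap Y (n p) y (kel X F p y x s t) =
      ap Y (farr H (make_arrow X (yoneda_obj X x) p (\<lambda>w g. act X p g t))) y
        (ap Y (n (yoneda_obj X x) \<cdot>\<^bsub>presheaves Y\<^esub> eta X Y F x) y s)"
    if n: "nat_trans (presheaves X) (presheaves Y) (kan X Y F) H n"
      and y: "y \<in> objs Y" and x: "x \<in> objs X" and s: "s \<in> fobj (fobj F x) y" and t: "t \<in> fobj p x"
    for n y x s t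
  proof -
    let ?l = "make_arrow X (yoneda_obj X x) p (\<lambda>w g. act X p g t)"
    have l: "?l \<in> hom (presheaves X) (yoneda_obj X x) p" by (rule yoneda_arrow[OF X p x t])
    note l' = hom_arr[OF l] hom_src[OF l] hom_tgt[OF l]
    have id: "ident X x \<in> hom X x x" using x by (simp add: hom_def)
    have ny: "n q \<in> arrs (presheaves Y) \<and> src (presheaves Y) (n q) = kan_obj X Y F q \<and>
        tgt (presheaves Y) (n q) = fobj H q" if "presheaf X q" for q
      using nat_transD(1)[OF n, of q] that by (simp add: hom_def)
    note ny = ny[OF p] ny[OF presheaf_yoneda_obj[OF X]]
    note Hl = functor_simps(2-4)[OF H l'(1)]
    \<comment> \<open>Naturality of \<open>n\<close> at \<open>?l\<close>, evaluated at
      \<open>[s, id]\<close>: the Kan extension of \<open>?l\<close> sends this generator to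
      \<open>[s, t]\<close>, since \<open>?l\<close> sends the identity to \<open>t\<close>.\<close>
    have "ap Y (farr H ?l \<cdot>\<^bsub>presheaves Y\<^esub> n (yoneda_obj X x)) y (kel X F (yoneda_obj X x) y x s (ident X x)) =
      ap Y (n p \<cdot>\<^bsub>presheaves Y\<^esub> farr (kan X Y F) ?l) y (kel X F (yoneda_obj X x) y x s (ident X x))"
      using nat_transD(2)[OF n l'(1)] by (simp add: l')
    then show ?thesis
      using F X x y s t id ny l' Hl p by simp
  qed
  show "m p = m' p"
    using nat_transD(1)[OF m, of p] nat_transD(1)[OF m', of p] p eq
    by (intro kan_arrow_eqI[of _ Y X F p "fobj H p"]) (simp_all add: gen m m')
qed (use m m' in \<open>auto simp: nat_trans_def\<close>)


section \<open>The cells \<open>theta\<close> and \<open>mu\<close>\<close>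

definition theta_cell :: "('u::universe, 'u) cat \<Rightarrow> 'u psh \<Rightarrow> 'u psh_arrow" where
  "theta_cell X p = make_arrow X (kan_obj X X (yoneda X) p) p (\<lambda>y. klift (\<lambda>x g t. act X p g t))"

text \<open>Density of the representables: the inverse sends \<open>t\<close> to
  \<open>[id, t]\<close>, and the coend relation along \<open>g\<close> identifies
  \<open>[g, t]\<close> with \<open>[id, p(g)(t)]\<close>.\<close>

lemma
  fixes X :: "('u::universe, 'u) cat"
  assumes X: "small_category TYPE('u) X" and p: "presheaf X p"
  shows theta_cell_hom: "theta_cell X p \<in> hom (presheaves X) (kan_obj X X (yoneda X) p) p"
    and ap_theta_cell: "y \<in> objs X \<Longrightarrow> x \<in> objs X \<Longrightarrow> g \<in> hom X y x \<Longrightarrow> t \<in> fobj p x \<Longrightarrow>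
      ap X (theta_cell X p) y (kel X (yoneda X) p y x g t) = act X p g t"
    and iso_in_theta_cell: "iso_in (presheaves X) (theta_cell X p)"
proof -
  note [simp] = small_category_category[OF X] X
  note Y = diagram_yoneda[OF X]
  have L: "klift (\<lambda>x g t. act X p g t) (kel X (yoneda X) p y x g t) = act X p g t"
    if "y \<in> objs X" for y x g t
    using p that by (intro klift_kel[where Y=X]) (auto simp: hom_def act_cmp)
  show hom: "theta_cell X p \<in> hom (presheaves X) (kan_obj X X (yoneda X) p) p"
    unfolding theta_cell_def
  proof (rule make_arrow_hom)
    fix y c assume "y \<in> objs X" "c \<in> fobj (kan_obj X X (yoneda X) p) y"
    then show "klift (\<lambda>x g t. act X p g t) c \<in> fobj p y"
      using p by (auto elim!: kan_obj_cases simp: L hom_def)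
  next
    fix g c assume "g \<in> arrs X" "c \<in> fobj (kan_obj X X (yoneda X) p) (tgt X g)"
    then show "klift (\<lambda>x g t. act X p g t) (act X (kan_obj X X (yoneda X) p) g c) =
        act X p g (klift (\<lambda>x g t. act X p g t) c)"
      using p Y by (auto elim!: kan_obj_cases simp: L hom_def act_cmp)
  qed (use p Y in simp_all)
  show ap: "ap X (theta_cell X p) y (kel X (yoneda X) p y x g t) = act X p g t"
    if "y \<in> objs X" "x \<in> objs X" "g \<in> hom X y x" "t \<in> fobj p x" for y x g t
    using that by (simp add: theta_cell_def L)
  have id: "ident X x \<in> hom X x x" if "x \<in> objs X" for x using that by (simp add: hom_def)
  have inv: "make_arrow X p (kan_obj X X (yoneda X) p) (\<lambda>y t. kel X (yoneda X) p y y (ident X y) t)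
      \<in> hom (presheaves X) p (kan_obj X X (yoneda X) p)"
  proof (rule make_arrow_hom)
    fix g t assume "g \<in> arrs X" "t \<in> fobj p (tgt X g)"
    then show "kel X (yoneda X) p (src X g) (src X g) (ident X (src X g)) (act X p g t) =
        act X (kan_obj X X (yoneda X) p) g (kel X (yoneda X) p (tgt X g) (tgt X g) (ident X (tgt X g)) t)"
      using p Y kel_dinatural[of g X "ident X (src X g)" "yoneda X" "src X g" t p X]
      by (simp add: id)
  qed (use p Y id in simp_all)
  show "iso_in (presheaves X) (theta_cell X p)"
  proof (rule iso_in_presheavesI[OF _ hom inv])
    fix y t assume "y \<in> objs X" "t \<in> fobj p y"
    then show "ap X (theta_cell X p) y (ap X (make_arrow X p (kan_obj X X (yoneda X) p)
        (\<lambda>y t. kel X (yoneda X) p y y (ident X y) t)) y t) = t"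
      using p by (simp add: ap id)
  next
    fix y c assume y: "y \<in> objs X" and "c \<in> fobj (kan_obj X X (yoneda X) p) y"
    then show "ap X (make_arrow X p (kan_obj X X (yoneda X) p)
        (\<lambda>y t. kel X (yoneda X) p y y (ident X y) t)) y (ap X (theta_cell X p) y c) = c"
    proof (elim kan_obj_cases)
      fix x g t assume x: "x \<in> objs X" "g \<in> fobj (fobj (yoneda X) x) y" "t \<in> fobj p x"
        and c: "c = kel X (yoneda X) p y x g t"
      then have g: "g \<in> arrs X" "src X g = y" "tgt X g = x" using y by (auto simp: hom_def)
      have "kel X (yoneda X) p y y (ident X y) (act X p g t) = c"
        using kel_dinatural[of g X "ident X y" "yoneda X" y t p X] g x y
        by (simp add: id c)
      then show ?thesis using g x y p unfolding c by (simp add: ap)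
    qed (use y in simp)
  qed simp
qed

text \<open>\<open>theta\<close> is a definite description, so its values can be computed only after
  the explicit cell is shown to satisfy the description and \<open>kan_nat_trans_eqI\<close> shows
  that no other family does.\<close>

lemma
  fixes X :: "('u::universe, 'u) cat"
  assumes X: "small_category TYPE('u) X"
  shows theta_nat_iso: "nat_iso (presheaves X) (presheaves X) (kan X X (yoneda X)) (id_functor (presheaves X)) (theta X)"
    and theta_eta: "x \<in> objs X \<Longrightarrow> theta X (yoneda_obj X x) \<cdot>\<^bsub>presheaves X\<^esub> eta X X (yoneda X) x =
      ident (presheaves X) (yoneda_obj X x)"
    and theta_eq_cell: "presheaf X p \<Longrightarrow> theta X p = theta_cell X p"
proof -
  note [simp] = small_category_category[OF X] X ap_theta_cell[OF X]
  note Y = diagram_yoneda[OF X]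
  \<comment> \<open>The restriction to presheaves makes the family extensional, as
    \<open>nat_trans\<close> demands; only then can it equal \<open>theta\<close> as a
    function.\<close>
  let ?t = "\<lambda>p\<in>objs (presheaves X). theta_cell X p"
  let ?P = "\<lambda>t. nat_iso (presheaves X) (presheaves X) (kan X X (yoneda X)) (id_functor (presheaves X)) t \<and>
     (\<forall>x\<in>objs X. t (yoneda_obj X x) \<cdot>\<^bsub>presheaves X\<^esub> eta X X (yoneda X) x =
        ident (presheaves X) (yoneda_obj X x))"
  have hom: "theta_cell X p \<in> arrs (presheaves X)" "src (presheaves X) (theta_cell X p) = kan_obj X X (yoneda X) p"
    "tgt (presheaves X) (theta_cell X p) = p" if "presheaf X p" for p
    using theta_cell_hom[OF X that] by (auto simp: hom_def)
  have id: "ident X x \<in> hom X x x" if "x \<in> objs X" for x using that by (simp add: hom_def)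
  have nat: "f \<cdot>\<^bsub>presheaves X\<^esub> theta_cell X (src (presheaves X) f) =
      theta_cell X (tgt (presheaves X) f) \<cdot>\<^bsub>presheaves X\<^esub> farr (kan X X (yoneda X)) f"
    if f: "f \<in> arrs (presheaves X)" for f
    using f Y hom
    by (intro kan_arrow_eqI[of _ X X "yoneda X" "src (presheaves X) f" "tgt (presheaves X) f"])
      (simp_all add: hom_def)
  have "?P ?t"
    unfolding nat_iso_def nat_trans_def
  proof (intro conjI ballI)
    fix x assume x: "x \<in> objs X"
    show "?t (yoneda_obj X x) \<cdot>\<^bsub>presheaves X\<^esub> eta X X (yoneda X) x = ident (presheaves X) (yoneda_obj X x)"
      using Y x hom
      by (intro presheaf_arrow_eqI[of _ X "yoneda_obj X x" "yoneda_obj X x"])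
        (simp_all add: hom_def)
  qed (use Y is_functor_kan[OF Y] is_functor_id_functor[OF category_presheaves, of X] theta_cell_hom[OF X] iso_in_theta_cell[OF X] nat
       in auto)
  moreover have "t = ?t" if "?P t" for t
    using that \<open>?P ?t\<close>
    by (intro kan_nat_trans_eqI[OF Y]) (auto simp: nat_iso_def)
  ultimately have "theta X = ?t" unfolding theta_def by (intro the_equality) blast+
  with \<open>?P ?t\<close>
  show "nat_iso (presheaves X) (presheaves X) (kan X X (yoneda X)) (id_functor (presheaves X)) (theta X)"
    "x \<in> objs X \<Longrightarrow> theta X (yoneda_obj X x) \<cdot>\<^bsub>presheaves X\<^esub> eta X X (yoneda X) x =
      ident (presheaves X) (yoneda_obj X x)"
    "presheaf X p \<Longrightarrow> theta X p = theta_cell X p" by simp_all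
qed


text \<open>Both iterated coends are generated by triples \<open>(r, s, t)\<close>;
  \<open>dinat\<close> takes care of the relations over \<open>Y\<close> and \<open>dinat'\<close>
  of those over \<open>X\<close>. One family \<open>T\<close> therefore induces an arrow out of
  either bracketing.\<close>

lemma kan_comp_arrow_exists:
  assumes F: "diagram X Y F" and G: "diagram Y Z G" and p: "presheaf X p" and q: "presheaf Z q"
    and mem: "\<And>z y x r s t. z \<in> objs Z \<Longrightarrow> y \<in> objs Y \<Longrightarrow> x \<in> objs X \<Longrightarrow> r \<in> fobj (fobj G y) z \<Longrightarrow>
      s \<in> fobj (fobj F x) y \<Longrightarrow> t \<in> fobj p x \<Longrightarrow> T z y x r s t \<in> fobj q z"
    and nat: "\<And>g y x r s t. g \<in> arrs Z \<Longrightarrow> y \<in> objs Y \<Longrightarrow> x \<in> objs X \<Longrightarrow> r \<in> fobj (fobj G y) (tgt Z g) \<Longrightarrow>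
      s \<in> fobj (fobj F x) y \<Longrightarrow> t \<in> fobj p x \<Longrightarrow>
      T (src Z g) y x (act Z (fobj G y) g r) s t = act Z q g (T (tgt Z g) y x r s t)"
    and dinat: "\<And>z h x r s t. z \<in> objs Z \<Longrightarrow> h \<in> arrs Y \<Longrightarrow> x \<in> objs X \<Longrightarrow> r \<in> fobj (fobj G (src Y h)) z \<Longrightarrow>
      s \<in> fobj (fobj F x) (tgt Y h) \<Longrightarrow> t \<in> fobj p x \<Longrightarrow>
      T z (src Y h) x r (act Y (fobj F x) h s) t = T z (tgt Y h) x (ap Z (farr G h) z r) s t"
    and dinat': "\<And>z y f r s t. z \<in> objs Z \<Longrightarrow> y \<in> objs Y \<Longrightarrow> f \<in> arrs X \<Longrightarrow> r \<in> fobj (fobj G y) z \<Longrightarrow>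
      s \<in> fobj (fobj F (src X f)) y \<Longrightarrow> t \<in> fobj p (tgt X f) \<Longrightarrow>
      T z y (src X f) r s (act X p f t) = T z y (tgt X f) r (ap Y (farr F f) y s) t"
  shows "\<exists>m\<in>hom (presheaves Z) (kan_obj X Z (comp_functor X (kan Y Z G) F) p) q.
      \<forall>z\<in>objs Z. \<forall>y\<in>objs Y. \<forall>x\<in>objs X. \<forall>r\<in>fobj (fobj G y) z. \<forall>s\<in>fobj (fobj F x) y. \<forall>t\<in>fobj p x.
        ap Z m z (kel X (comp_functor X (kan Y Z G) F) p z x (kel Y G (fobj F x) z y r s) t) = T z y x r s t"
    and "\<exists>m\<in>hom (presheaves Z) (kan_obj Y Z G (kan_obj X Y F p)) q.
      \<forall>z\<in>objs Z. \<forall>y\<in>objs Y. \<forall>x\<in>objs X. \<forall>r\<in>fobj (fobj G y) z. \<forall>s\<in>fobj (fobj F x) y. \<forall>t\<in>fobj p x.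
        ap Z m z (kel Y G (kan_obj X Y F p) z y r (kel X F p y x s t)) = T z y x r s t"
proof -
  note [simp] = diagram_cats[OF F] diagram_cats[OF G]
  let ?GF = "comp_functor X (kan Y Z G) F"
  note GF = diagram_comp_kan[OF F G]
  \<comment> \<open>In this bracketing the inner coend runs over \<open>Y\<close>: it is lifted with
    \<open>x\<close> and \<open>t\<close> fixed, using \<open>dinat\<close>, and
    \<open>dinat'\<close> is left for the outer coend over \<open>X\<close>.\<close>
  have L: "klift (\<lambda>y r s. T z y x r s t) (kel Y G (fobj F x) z y r s) = T z y x r s t"
    if "z \<in> objs Z" "x \<in> objs X" "t \<in> fobj p x" for z y x r s t
    using that by (intro klift_kel[where Y=Z]) (simp add: dinat)
  let ?H = "\<lambda>z x v t. klift (\<lambda>y r s. T z y x r s t) v"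
  have "\<exists>m\<in>hom (presheaves Z) (kan_obj X Z ?GF p) q. \<forall>z\<in>objs Z. \<forall>x\<in>objs X.
    \<forall>v\<in>fobj (fobj ?GF x) z. \<forall>t\<in>fobj p x. ap Z m z (kel X ?GF p z x v t) = ?H z x v t"
  proof (rule kan_arrow_exists[OF GF p q])
    fix z x v t assume "z \<in> objs Z" "x \<in> objs X" "v \<in> fobj (fobj ?GF x) z" "t \<in> fobj p x"
    then show "?H z x v t \<in> fobj q z" using F by (auto elim!: kan_obj_cases simp: L mem)
  next
    fix g x v t assume "g \<in> arrs Z" "x \<in> objs X" "v \<in> fobj (fobj ?GF x) (tgt Z g)" "t \<in> fobj p x"
    then show "?H (src Z g) x (act Z (fobj ?GF x) g v) t = act Z q g (?H (tgt Z g) x v t)"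
      using F G by (auto elim!: kan_obj_cases simp: L nat)
  next
    fix f z v t assume "f \<in> arrs X" "z \<in> objs Z" "v \<in> fobj (fobj ?GF (src X f)) z" "t \<in> fobj p (tgt X f)"
    then show "?H z (src X f) v (act X p f t) = ?H z (tgt X f) (ap Z (farr ?GF f) z v) t"
      using F G p by (auto elim!: kan_obj_cases simp: L dinat')
  qed
  then show "\<exists>m\<in>hom (presheaves Z) (kan_obj X Z ?GF p) q.
      \<forall>z\<in>objs Z. \<forall>y\<in>objs Y. \<forall>x\<in>objs X. \<forall>r\<in>fobj (fobj G y) z. \<forall>s\<in>fobj (fobj F x) y. \<forall>t\<in>fobj p x.
        ap Z m z (kel X ?GF p z x (kel Y G (fobj F x) z y r s) t) = T z y x r s t"
    using F by (elim bexE, intro bexI) (simp_all add: L)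
  \<comment> \<open>In the other bracketing the roles are exchanged: the inner coend runs over
    \<open>X\<close> and uses \<open>dinat'\<close>.\<close>
  have L': "klift (\<lambda>x s t. T z y x r s t) (kel X F p y x s t) = T z y x r s t"
    if "z \<in> objs Z" "y \<in> objs Y" "r \<in> fobj (fobj G y) z" for z y x r s t
    using that by (intro klift_kel[where Y=Y]) (simp add: dinat')
  let ?H = "\<lambda>z y r w. klift (\<lambda>x s t. T z y x r s t) w"
  have "\<exists>m\<in>hom (presheaves Z) (kan_obj Y Z G (kan_obj X Y F p)) q. \<forall>z\<in>objs Z. \<forall>y\<in>objs Y.
    \<forall>r\<in>fobj (fobj G y) z. \<forall>w\<in>fobj (kan_obj X Y F p) y.
      ap Z m z (kel Y G (kan_obj X Y F p) z y r w) = ?H z y r w"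
  proof (rule kan_arrow_exists[OF G _ q])
    show "presheaf Y (kan_obj X Y F p)" using F p by simp
  next
    fix z y r w assume "z \<in> objs Z" "y \<in> objs Y" "r \<in> fobj (fobj G y) z" "w \<in> fobj (kan_obj X Y F p) y"
    then show "?H z y r w \<in> fobj q z" by (auto elim!: kan_obj_cases simp: L' mem)
  next
    fix g y r w assume "g \<in> arrs Z" "y \<in> objs Y" "r \<in> fobj (fobj G y) (tgt Z g)" "w \<in> fobj (kan_obj X Y F p) y"
    then show "?H (src Z g) y (act Z (fobj G y) g r) w = act Z q g (?H (tgt Z g) y r w)"
      using F G by (auto elim!: kan_obj_cases simp: L' nat)
  next
    fix h z r w assume "h \<in> arrs Y" "z \<in> objs Z" "r \<in> fobj (fobj G (src Y h)) z" "w \<in> fobj (kan_obj X Y F p) (tgt Y h)"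
    then show "?H z (src Y h) r (act Y (kan_obj X Y F p) h w) = ?H z (tgt Y h) (ap Z (farr G h) z r) w"
      using F G p by (auto elim!: kan_obj_cases simp: L' dinat)
  qed
  then show "\<exists>m\<in>hom (presheaves Z) (kan_obj Y Z G (kan_obj X Y F p)) q.
      \<forall>z\<in>objs Z. \<forall>y\<in>objs Y. \<forall>x\<in>objs X. \<forall>r\<in>fobj (fobj G y) z. \<forall>s\<in>fobj (fobj F x) y. \<forall>t\<in>fobj p x.
        ap Z m z (kel Y G (kan_obj X Y F p) z y r (kel X F p y x s t)) = T z y x r s t"
    by (elim bexE, intro bexI) (simp_all add: L')
qed

lemma kan_comp_cases:
  assumes "c \<in> fobj (kan_obj X Z (comp_functor X (kan Y Z G) F) p) z" "z \<in> objs Z" "diagram X Y F"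
  obtains y x r s t where "y \<in> objs Y" "x \<in> objs X" "r \<in> fobj (fobj G y) z" "s \<in> fobj (fobj F x) y"
    "t \<in> fobj p x" "c = kel X (comp_functor X (kan Y Z G) F) p z x (kel Y G (fobj F x) z y r s) t"
  using assms by (auto elim!: kan_obj_cases)

lemma comp_kan_cases:
  fixes X :: "('u::universe, 'u) cat"
  assumes "c \<in> fobj (kan_obj Y Z G (kan_obj X Y F p)) z" "z \<in> objs Z"
  obtains y x r s t where "y \<in> objs Y" "x \<in> objs X" "r \<in> fobj (fobj G y) z" "s \<in> fobj (fobj F x) y"
    "t \<in> fobj p x" "c = kel Y G (kan_obj X Y F p) z y r (kel X F p y x s t)"
  using assms by (auto elim!: kan_obj_cases)

text \<open>This is Fubini for coends. Rebracketing generators is well defined in both directions by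
  the two parts of \<open>kan_comp_arrow_exists\<close>, and the two arrows are visibly inverse on
  generators.\<close>

lemma mu_cell_exists:
  assumes F: "diagram X Y F" and G: "diagram Y Z G" and p: "presheaf X p"
  defines "GF \<equiv> comp_functor X (kan Y Z G) F"
  shows "\<exists>m\<in>hom (presheaves Z) (kan_obj X Z GF p) (kan_obj Y Z G (kan_obj X Y F p)).
    iso_in (presheaves Z) m \<and>
    (\<forall>z\<in>objs Z. \<forall>y\<in>objs Y. \<forall>x\<in>objs X. \<forall>r\<in>fobj (fobj G y) z. \<forall>s\<in>fobj (fobj F x) y. \<forall>t\<in>fobj p x.
      ap Z m z (kel X GF p z x (kel Y G (fobj F x) z y r s) t) =
      kel Y G (kan_obj X Y F p) z y r (kel X F p y x s t))"
proof -
  note [simp] = diagram_cats[OF F] diagram_cats[OF G]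
  note GF = diagram_comp_kan[OF F G, folded GF_def]
  have fobj_GF[simp]: "fobj GF x = kan_obj Y Z G (fobj F x)" if "x \<in> objs X" for x
    using that F by (simp add: GF_def)
  have farr_GF[simp]: "farr GF f = farr (kan Y Z G) (farr F f)" if "f \<in> arrs X" for f
    using that by (simp add: GF_def)
  let ?T = "\<lambda>z y x r s t. kel Y G (kan_obj X Y F p) z y r (kel X F p y x s t)"
  let ?T' = "\<lambda>z y x r s t. kel X GF p z x (kel Y G (fobj F x) z y r s) t"
  have "\<exists>m\<in>hom (presheaves Z) (kan_obj X Z GF p) (kan_obj Y Z G (kan_obj X Y F p)).
    \<forall>z\<in>objs Z. \<forall>y\<in>objs Y. \<forall>x\<in>objs X. \<forall>r\<in>fobj (fobj G y) z. \<forall>s\<in>fobj (fobj F x) y. \<forall>t\<in>fobj p x.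
      ap Z m z (?T' z y x r s t) = ?T z y x r s t"
    unfolding GF_def
  proof (rule kan_comp_arrow_exists(1)[OF F G p])
    fix z h x r s t assume "z \<in> objs Z" "h \<in> arrs Y" "x \<in> objs X" "r \<in> fobj (fobj G (src Y h)) z"
      "s \<in> fobj (fobj F x) (tgt Y h)" "t \<in> fobj p x"
    then show "?T z (src Y h) x r (act Y (fobj F x) h s) t = ?T z (tgt Y h) x (ap Z (farr G h) z r) s t"
      using F G p kel_dinatural[of h Y r G z "kel X F p (tgt Y h) x s t" "kan_obj X Y F p" Z] by simp
  next
    fix z y f r s t assume "z \<in> objs Z" "y \<in> objs Y" "f \<in> arrs X" "r \<in> fobj (fobj G y) z"
      "s \<in> fobj (fobj F (src X f)) y" "t \<in> fobj p (tgt X f)"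
    then show "?T z y (src X f) r s (act X p f t) = ?T z y (tgt X f) r (ap Y (farr F f) y s) t"
      using F G p kel_dinatural[of f X s F y t p Y] by simp
  qed (use F G p in simp_all)
  then obtain m where m: "m \<in> hom (presheaves Z) (kan_obj X Z GF p) (kan_obj Y Z G (kan_obj X Y F p))"
    and ap_m: "\<And>z y x r s t. z \<in> objs Z \<Longrightarrow> y \<in> objs Y \<Longrightarrow> x \<in> objs X \<Longrightarrow> r \<in> fobj (fobj G y) z \<Longrightarrow>
      s \<in> fobj (fobj F x) y \<Longrightarrow> t \<in> fobj p x \<Longrightarrow> ap Z m z (?T' z y x r s t) = ?T z y x r s t"
    by blast
  have "\<exists>m\<in>hom (presheaves Z) (kan_obj Y Z G (kan_obj X Y F p)) (kan_obj X Z GF p).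
    \<forall>z\<in>objs Z. \<forall>y\<in>objs Y. \<forall>x\<in>objs X. \<forall>r\<in>fobj (fobj G y) z. \<forall>s\<in>fobj (fobj F x) y. \<forall>t\<in>fobj p x.
      ap Z m z (?T z y x r s t) = ?T' z y x r s t"
  proof (rule kan_comp_arrow_exists(2)[OF F G p])
    fix z h x r s t assume "z \<in> objs Z" "h \<in> arrs Y" "x \<in> objs X" "r \<in> fobj (fobj G (src Y h)) z"
      "s \<in> fobj (fobj F x) (tgt Y h)" "t \<in> fobj p x"
    then show "?T' z (src Y h) x r (act Y (fobj F x) h s) t = ?T' z (tgt Y h) x (ap Z (farr G h) z r) s t"
      using F G p kel_dinatural[of h Y r G z s "fobj F x" Z] by simp
  next
    fix z y f r s t assume "z \<in> objs Z" "y \<in> objs Y" "f \<in> arrs X" "r \<in> fobj (fobj G y) z"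
      "s \<in> fobj (fobj F (src X f)) y" "t \<in> fobj p (tgt X f)"
    then show "?T' z y (src X f) r s (act X p f t) = ?T' z y (tgt X f) r (ap Y (farr F f) y s) t"
      using F G GF p kel_dinatural[of f X "kel Y G (fobj F (src X f)) z y r s" GF z t p Z] by simp
  qed (use F G GF p in simp_all)
  then obtain m' where m': "m' \<in> hom (presheaves Z) (kan_obj Y Z G (kan_obj X Y F p)) (kan_obj X Z GF p)"
    and ap_m': "\<And>z y x r s t. z \<in> objs Z \<Longrightarrow> y \<in> objs Y \<Longrightarrow> x \<in> objs X \<Longrightarrow> r \<in> fobj (fobj G y) z \<Longrightarrow>
      s \<in> fobj (fobj F x) y \<Longrightarrow> t \<in> fobj p x \<Longrightarrow> ap Z m' z (?T z y x r s t) = ?T' z y x r s t"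
    by blast
  have "iso_in (presheaves Z) m"
  proof (rule iso_in_presheavesI[OF _ m m'])
    fix z c assume "z \<in> objs Z" "c \<in> fobj (kan_obj X Z GF p) z"
    then show "ap Z m' z (ap Z m z c) = c"
      using F unfolding GF_def
      by (auto elim!: kan_comp_cases simp: ap_m[unfolded GF_def] ap_m'[unfolded GF_def])
  next
    fix z c assume "z \<in> objs Z" "c \<in> fobj (kan_obj Y Z G (kan_obj X Y F p)) z"
    then show "ap Z m z (ap Z m' z c) = c"
      by (auto elim!: comp_kan_cases simp: ap_m ap_m')
  qed simp
  with m ap_m show ?thesis by blast
qed

text \<open>As with \<open>theta\<close>, the definite description is resolved by exhibiting one
  solution, chosen separately for each presheaf by \<open>mu_cell_exists\<close>, and by the
  uniqueness of transformations out of a Kan extension. The formula on generators is what later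
  computations use.\<close>

lemma
  assumes F: "diagram X Y F" and G: "diagram Y Z G"
  defines "GF \<equiv> comp_functor X (kan Y Z G) F"
  shows mu_nat_iso: "nat_iso (presheaves X) (presheaves Z) (kan X Z GF)
      (comp_functor (presheaves X) (kan Y Z G) (kan X Y F)) (mu X Y Z G F)"
    and mu_eta: "x \<in> objs X \<Longrightarrow> mu X Y Z G F (yoneda_obj X x) \<cdot>\<^bsub>presheaves Z\<^esub> eta X Z GF x =
      farr (kan Y Z G) (eta X Y F x)"
    and ap_mu: "presheaf X p \<Longrightarrow> z \<in> objs Z \<Longrightarrow> y \<in> objs Y \<Longrightarrow> x \<in> objs X \<Longrightarrow> r \<in> fobj (fobj G y) z \<Longrightarrow>
      s \<in> fobj (fobj F x) y \<Longrightarrow> t \<in> fobj p x \<Longrightarrow>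
      ap Z (mu X Y Z G F p) z (kel X GF p z x (kel Y G (fobj F x) z y r s) t) =
      kel Y G (kan_obj X Y F p) z y r (kel X F p y x s t)"
proof -
  note [simp] = diagram_cats[OF F] diagram_cats[OF G]
  note GF = diagram_comp_kan[OF F G, folded GF_def]
  have fobj_GF[simp]: "fobj GF x = kan_obj Y Z G (fobj F x)" if "x \<in> objs X" for x
    using that F by (simp add: GF_def)
  let ?T = "\<lambda>p z y x r s t. kel Y G (kan_obj X Y F p) z y r (kel X F p y x s t)"
  let ?T' = "\<lambda>p z y x r s t. kel X GF p z x (kel Y G (fobj F x) z y r s) t"
  define M where "M = (\<lambda>p\<in>objs (presheaves X). SOME m.
    m \<in> hom (presheaves Z) (kan_obj X Z GF p) (kan_obj Y Z G (kan_obj X Y F p)) \<and>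
    iso_in (presheaves Z) m \<and>
    (\<forall>z\<in>objs Z. \<forall>y\<in>objs Y. \<forall>x\<in>objs X. \<forall>r\<in>fobj (fobj G y) z. \<forall>s\<in>fobj (fobj F x) y. \<forall>t\<in>fobj p x.
      ap Z m z (?T' p z y x r s t) = ?T p z y x r s t))"
  have M: "M p \<in> hom (presheaves Z) (kan_obj X Z GF p) (kan_obj Y Z G (kan_obj X Y F p)) \<and>
    iso_in (presheaves Z) (M p) \<and>
    (\<forall>z\<in>objs Z. \<forall>y\<in>objs Y. \<forall>x\<in>objs X. \<forall>r\<in>fobj (fobj G y) z. \<forall>s\<in>fobj (fobj F x) y. \<forall>t\<in>fobj p x.
      ap Z (M p) z (?T' p z y x r s t) = ?T p z y x r s t)" if p: "presheaf X p" for p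
  proof -
    have "\<exists>m. m \<in> hom (presheaves Z) (kan_obj X Z GF p) (kan_obj Y Z G (kan_obj X Y F p)) \<and>
      iso_in (presheaves Z) m \<and>
      (\<forall>z\<in>objs Z. \<forall>y\<in>objs Y. \<forall>x\<in>objs X. \<forall>r\<in>fobj (fobj G y) z. \<forall>s\<in>fobj (fobj F x) y. \<forall>t\<in>fobj p x.
        ap Z m z (?T' p z y x r s t) = ?T p z y x r s t)"
      using mu_cell_exists[OF F G p, folded GF_def] by (auto simp only: Bex_def)
    from someI_ex[OF this] show ?thesis using p by (simp add: M_def)
  qed
  have hom: "M p \<in> arrs (presheaves Z)" "src (presheaves Z) (M p) = kan_obj X Z GF p"
    "tgt (presheaves Z) (M p) = kan_obj Y Z G (kan_obj X Y F p)" if "presheaf X p" for p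
    using M[OF that] by (auto simp: hom_def)
  have ap: "ap Z (M p) z (?T' p z y x r s t) = ?T p z y x r s t"
    if "presheaf X p" "z \<in> objs Z" "y \<in> objs Y" "x \<in> objs X" "r \<in> fobj (fobj G y) z"
      "s \<in> fobj (fobj F x) y" "t \<in> fobj p x" for p z y x r s t
    using M[OF that(1)] that(2-) by blast
  let ?P = "\<lambda>m. nat_iso (presheaves X) (presheaves Z) (kan X Z GF)
      (comp_functor (presheaves X) (kan Y Z G) (kan X Y F)) m \<and>
     (\<forall>x\<in>objs X. m (yoneda_obj X x) \<cdot>\<^bsub>presheaves Z\<^esub> eta X Z GF x = farr (kan Y Z G) (eta X Y F x))"
  have id: "ident X x \<in> hom X x x" if "x \<in> objs X" for x using that by (simp add: hom_def)
  have nat: "farr (kan Y Z G) (farr (kan X Y F) f) \<cdot>\<^bsub>presheaves Z\<^esub> M (src (presheaves X) f) =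
      M (tgt (presheaves X) f) \<cdot>\<^bsub>presheaves Z\<^esub> farr (kan X Z GF) f"
    if f: "f \<in> arrs (presheaves X)" for f
  proof (rule kan_arrow_eqI)
    fix z x v t assume "z \<in> objs Z" "x \<in> objs X" "v \<in> fobj (fobj GF x) z"
      "t \<in> fobj (src (presheaves X) f) x"
    then show "ap Z (farr (kan Y Z G) (farr (kan X Y F) f) \<cdot>\<^bsub>presheaves Z\<^esub> M (src (presheaves X) f)) z
        (kel X GF (src (presheaves X) f) z x v t) =
      ap Z (M (tgt (presheaves X) f) \<cdot>\<^bsub>presheaves Z\<^esub> farr (kan X Z GF) f) z
        (kel X GF (src (presheaves X) f) z x v t)"
      using f F G GF by (auto elim!: kan_obj_cases simp: hom ap)
  qed (use f F G GF hom in \<open>simp_all add: hom_def\<close>)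
  have "?P M"
    unfolding nat_iso_def nat_trans_def
  proof (intro conjI ballI)
    fix x assume x: "x \<in> objs X"
    \<comment> \<open>Both sides send \<open>[r, s]\<close> to \<open>[r, [s, id]]\<close>.\<close>
    show "M (yoneda_obj X x) \<cdot>\<^bsub>presheaves Z\<^esub> eta X Z GF x = farr (kan Y Z G) (eta X Y F x)"
      using F G GF x hom
      by (intro kan_arrow_eqI[of _ Z Y G "fobj F x" "kan_obj Y Z G (kan_obj X Y F (yoneda_obj X x))"])
        (simp_all add: hom_def[of "presheaves Z"] ap id)
  next
    fix p assume "p \<in> objs (presheaves X)"
    then show "M p \<in> hom (presheaves Z) (fobj (kan X Z GF) p)
        (fobj (comp_functor (presheaves X) (kan Y Z G) (kan X Y F)) p)"
      using M[of p] F G GF by simp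
  qed (use GF F G is_functor_kan[OF GF] M nat is_functor_comp_functor[OF _ is_functor_kan[OF F] is_functor_kan[OF G]]
       in \<open>simp_all add: M_def\<close>)
  moreover have "t = M" if "?P t" for t
    using that \<open>?P M\<close>
    by (intro kan_nat_trans_eqI[OF GF]) (auto simp: nat_iso_def)
  ultimately have "mu X Y Z G F = M" unfolding mu_def GF_def[symmetric] by (intro the_equality) blast+
  with \<open>?P M\<close> ap
  show "nat_iso (presheaves X) (presheaves Z) (kan X Z GF)
      (comp_functor (presheaves X) (kan Y Z G) (kan X Y F)) (mu X Y Z G F)"
    "x \<in> objs X \<Longrightarrow> mu X Y Z G F (yoneda_obj X x) \<cdot>\<^bsub>presheaves Z\<^esub> eta X Z GF x =
      farr (kan Y Z G) (eta X Y F x)"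
    "presheaf X p \<Longrightarrow> z \<in> objs Z \<Longrightarrow> y \<in> objs Y \<Longrightarrow> x \<in> objs X \<Longrightarrow> r \<in> fobj (fobj G y) z \<Longrightarrow>
      s \<in> fobj (fobj F x) y \<Longrightarrow> t \<in> fobj p x \<Longrightarrow>
      ap Z (mu X Y Z G F p) z (kel X GF p z x (kel Y G (fobj F x) z y r s) t) =
      kel Y G (kan_obj X Y F p) z y r (kel X F p y x s t)" by simp_all
qed

section \<open>Small monoidal categories\<close>

text \<open>What the four doctrines have in common. Day convolution and its associator and unitors
  are built from this alone; symmetry and terminality of the unit are treated as additions.\<close>

definition small_monoidal :: "('u::universe, 'u) algebra \<Rightarrow> bool" where
  "small_monoidal A \<longleftrightarrow> small_category TYPE('u) (fst A) \<and> monoidal_category A"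

abbreviation ten :: "('o, 'a) algebra \<Rightarrow> 'o \<Rightarrow> 'o \<Rightarrow> 'o" where
  "ten A x y \<equiv> tensor_obj (snd A) x y"

abbreviation tar :: "('o, 'a) algebra \<Rightarrow> 'a \<Rightarrow> 'a \<Rightarrow> 'a" where
  "tar A f g \<equiv> tensor_arr (snd A) f g"

abbreviation asc :: "('o, 'a) algebra \<Rightarrow> 'o \<Rightarrow> 'o \<Rightarrow> 'o \<Rightarrow> 'a" where
  "asc A x y z \<equiv> associator (snd A) (x, y, z)"

lemma
  assumes A: "small_monoidal (A :: ('u::universe, 'u) algebra)"
  defines "C \<equiv> fst A"
  shows small_fst[simp]: "small_category TYPE('u) C"
    and category_fst[simp]: "category C"
    and tensor_functor: "is_functor (prod_cat C C) C (tensor (snd A))"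
    and ten_obj[simp]: "x \<in> objs C \<Longrightarrow> y \<in> objs C \<Longrightarrow> ten A x y \<in> objs C"
    and tar_arr[simp]: "f \<in> arrs C \<Longrightarrow> g \<in> arrs C \<Longrightarrow> tar A f g \<in> arrs C"
    and src_tar[simp]: "f \<in> arrs C \<Longrightarrow> g \<in> arrs C \<Longrightarrow> src C (tar A f g) = ten A (src C f) (src C g)"
    and tgt_tar[simp]: "f \<in> arrs C \<Longrightarrow> g \<in> arrs C \<Longrightarrow> tgt C (tar A f g) = ten A (tgt C f) (tgt C g)"
    and tar_ident[simp]: "x \<in> objs C \<Longrightarrow> y \<in> objs C \<Longrightarrow>
      tar A (ident C x) (ident C y) = ident C (ten A x y)"
    and tar_cmp: "f \<in> arrs C \<Longrightarrow> g \<in> arrs C \<Longrightarrow> f' \<in> arrs C \<Longrightarrow> g' \<in> arrs C \<Longrightarrow>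
      tgt C f = src C g \<Longrightarrow> tgt C f' = src C g' \<Longrightarrow>
      tar A (g \<cdot>\<^bsub>C\<^esub> f) (g' \<cdot>\<^bsub>C\<^esub> f') = tar A g g' \<cdot>\<^bsub>C\<^esub> tar A f f'"
    and munit_obj[simp]: "munit (snd A) \<in> objs C"
    and asc_hom: "x \<in> objs C \<Longrightarrow> y \<in> objs C \<Longrightarrow> z \<in> objs C \<Longrightarrow>
      asc A x y z \<in> hom C (ten A (ten A x y) z) (ten A x (ten A y z))"
    and asc_iso: "x \<in> objs C \<Longrightarrow> y \<in> objs C \<Longrightarrow> z \<in> objs C \<Longrightarrow> iso_in C (asc A x y z)"
    and asc_natural: "f \<in> arrs C \<Longrightarrow> g \<in> arrs C \<Longrightarrow> h \<in> arrs C \<Longrightarrow>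
      tar A f (tar A g h) \<cdot>\<^bsub>C\<^esub> asc A (src C f) (src C g) (src C h) =
      asc A (tgt C f) (tgt C g) (tgt C h) \<cdot>\<^bsub>C\<^esub> tar A (tar A f g) h"
    and lunitor_hom: "x \<in> objs C \<Longrightarrow> lunitor (snd A) x \<in> hom C (ten A (munit (snd A)) x) x"
    and lunitor_iso: "x \<in> objs C \<Longrightarrow> iso_in C (lunitor (snd A) x)"
    and lunitor_natural: "f \<in> arrs C \<Longrightarrow> f \<cdot>\<^bsub>C\<^esub> lunitor (snd A) (src C f) =
      lunitor (snd A) (tgt C f) \<cdot>\<^bsub>C\<^esub> tar A (ident C (munit (snd A))) f"
    and runitor_hom: "x \<in> objs C \<Longrightarrow> runitor (snd A) x \<in> hom C (ten A x (munit (snd A))) x"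
    and runitor_iso: "x \<in> objs C \<Longrightarrow> iso_in C (runitor (snd A) x)"
    and runitor_natural: "f \<in> arrs C \<Longrightarrow> f \<cdot>\<^bsub>C\<^esub> runitor (snd A) (src C f) =
      runitor (snd A) (tgt C f) \<cdot>\<^bsub>C\<^esub> tar A f (ident C (munit (snd A)))"
    and pentagon: "w \<in> objs C \<Longrightarrow> x \<in> objs C \<Longrightarrow> y \<in> objs C \<Longrightarrow> z \<in> objs C \<Longrightarrow>
      asc A w x (ten A y z) \<cdot>\<^bsub>C\<^esub> asc A (ten A w x) y z =
      tar A (ident C w) (asc A x y z) \<cdot>\<^bsub>C\<^esub> asc A w (ten A x y) z \<cdot>\<^bsub>C\<^esub> tar A (asc A w x y) (ident C z)"
    and triangle: "x \<in> objs C \<Longrightarrow> y \<in> objs C \<Longrightarrow>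
      tar A (ident C x) (lunitor (snd A) y) \<cdot>\<^bsub>C\<^esub> asc A x (munit (snd A)) y =
      tar A (runitor (snd A) x) (ident C y)"
proof -
  obtain M where AM: "A = (C, M)" by (cases A) (simp add: C_def)
  have m: "monoidal_category (C, M)" using A AM by (simp add: small_monoidal_def)
  show s: "small_category TYPE('u) C" using A by (simp add: small_monoidal_def C_def)
  then show C: "category C" by simp
  have T: "is_functor (prod_cat C C) C (tensor M)" and I: "munit M \<in> objs C"
    and a: "nat_iso (prod_cat C (prod_cat C C)) C
          (make_functor (prod_cat C (prod_cat C C))
             (\<lambda>(x, y, z). tensor_obj M (tensor_obj M x y) z) (\<lambda>(f, g, h). tensor_arr M (tensor_arr M f g) h))
          (make_functor (prod_cat C (prod_cat C C))
             (\<lambda>(x, y, z). tensor_obj M x (tensor_obj M y z)) (\<lambda>(f, g, h). tensor_arr M f (tensor_arr M g h)))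
          (associator M)"
    and l: "nat_iso C C (make_functor C (\<lambda>x. tensor_obj M (munit M) x)
        (\<lambda>f. tensor_arr M (ident C (munit M)) f)) (id_functor C) (lunitor M)"
    and r: "nat_iso C C (make_functor C (\<lambda>x. tensor_obj M x (munit M))
        (\<lambda>f. tensor_arr M f (ident C (munit M)))) (id_functor C) (runitor M)"
    using m by (simp_all add: monoidal_category_def Let_def)
  show "is_functor (prod_cat C C) C (tensor (snd A))" "munit (snd A) \<in> objs C"
    using T I by (simp_all add: AM)
  show "x \<in> objs C \<Longrightarrow> y \<in> objs C \<Longrightarrow> ten A x y \<in> objs C"
    using fobj_mem[OF T, of "(x, y)"] by (simp add: AM)
  show "f \<in> arrs C \<Longrightarrow> g \<in> arrs C \<Longrightarrow> tar A f g \<in> arrs C"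
    "f \<in> arrs C \<Longrightarrow> g \<in> arrs C \<Longrightarrow> src C (tar A f g) = ten A (src C f) (src C g)"
    "f \<in> arrs C \<Longrightarrow> g \<in> arrs C \<Longrightarrow> tgt C (tar A f g) = ten A (tgt C f) (tgt C g)"
    using functor_simps(2-4)[OF T, of "(f, g)"] by (simp_all add: AM)
  show "x \<in> objs C \<Longrightarrow> y \<in> objs C \<Longrightarrow> tar A (ident C x) (ident C y) = ident C (ten A x y)"
    using farr_ident[OF T, of "(x, y)"] by (simp add: AM)
  show "f \<in> arrs C \<Longrightarrow> g \<in> arrs C \<Longrightarrow> f' \<in> arrs C \<Longrightarrow> g' \<in> arrs C \<Longrightarrow>
      tgt C f = src C g \<Longrightarrow> tgt C f' = src C g' \<Longrightarrow>
      tar A (g \<cdot>\<^bsub>C\<^esub> f) (g' \<cdot>\<^bsub>C\<^esub> f') = tar A g g' \<cdot>\<^bsub>C\<^esub> tar A f f'"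
    using farr_cmp[OF T, of "(f, f')" "(g, g')"] by (simp add: AM)
  show "x \<in> objs C \<Longrightarrow> y \<in> objs C \<Longrightarrow> z \<in> objs C \<Longrightarrow>
      asc A x y z \<in> hom C (ten A (ten A x y) z) (ten A x (ten A y z))"
    "x \<in> objs C \<Longrightarrow> y \<in> objs C \<Longrightarrow> z \<in> objs C \<Longrightarrow> iso_in C (asc A x y z)"
    using nat_isoD(1,3)[OF a, of "(x, y, z)"] by (simp_all add: AM)
  show "f \<in> arrs C \<Longrightarrow> g \<in> arrs C \<Longrightarrow> h \<in> arrs C \<Longrightarrow>
      tar A f (tar A g h) \<cdot>\<^bsub>C\<^esub> asc A (src C f) (src C g) (src C h) =
      asc A (tgt C f) (tgt C g) (tgt C h) \<cdot>\<^bsub>C\<^esub> tar A (tar A f g) h"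
    using nat_isoD(2)[OF a, of "(f, g, h)"] by (simp add: AM)
  show "x \<in> objs C \<Longrightarrow> lunitor (snd A) x \<in> hom C (ten A (munit (snd A)) x) x"
    "x \<in> objs C \<Longrightarrow> iso_in C (lunitor (snd A) x)"
    "f \<in> arrs C \<Longrightarrow> f \<cdot>\<^bsub>C\<^esub> lunitor (snd A) (src C f) =
      lunitor (snd A) (tgt C f) \<cdot>\<^bsub>C\<^esub> tar A (ident C (munit (snd A))) f"
    using nat_isoD(1,3)[OF l, of x] nat_isoD(2)[OF l, of f] by (simp_all add: AM)
  show "x \<in> objs C \<Longrightarrow> runitor (snd A) x \<in> hom C (ten A x (munit (snd A))) x"
    "x \<in> objs C \<Longrightarrow> iso_in C (runitor (snd A) x)"
    "f \<in> arrs C \<Longrightarrow> f \<cdot>\<^bsub>C\<^esub> runitor (snd A) (src C f) =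
      runitor (snd A) (tgt C f) \<cdot>\<^bsub>C\<^esub> tar A f (ident C (munit (snd A)))"
    using nat_isoD(1,3)[OF r, of x] nat_isoD(2)[OF r, of f] by (simp_all add: AM)
  show "w \<in> objs C \<Longrightarrow> x \<in> objs C \<Longrightarrow> y \<in> objs C \<Longrightarrow> z \<in> objs C \<Longrightarrow>
      asc A w x (ten A y z) \<cdot>\<^bsub>C\<^esub> asc A (ten A w x) y z =
      tar A (ident C w) (asc A x y z) \<cdot>\<^bsub>C\<^esub> asc A w (ten A x y) z \<cdot>\<^bsub>C\<^esub> tar A (asc A w x y) (ident C z)"
    using m by (simp add: AM monoidal_category_def Let_def)
  show "x \<in> objs C \<Longrightarrow> y \<in> objs C \<Longrightarrow>
      tar A (ident C x) (lunitor (snd A) y) \<cdot>\<^bsub>C\<^esub> asc A x (munit (snd A)) y =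
      tar A (runitor (snd A) x) (ident C y)"
    using m by (simp add: AM monoidal_category_def Let_def)
qed

lemma
  assumes A: "small_monoidal (A :: ('u::universe, 'u) algebra)"
  defines "C \<equiv> fst A"
  shows asc_arr[simp]: "x \<in> objs C \<Longrightarrow> y \<in> objs C \<Longrightarrow> z \<in> objs C \<Longrightarrow> asc A x y z \<in> arrs C"
    and src_asc[simp]: "x \<in> objs C \<Longrightarrow> y \<in> objs C \<Longrightarrow> z \<in> objs C \<Longrightarrow>
      src C (asc A x y z) = ten A (ten A x y) z"
    and tgt_asc[simp]: "x \<in> objs C \<Longrightarrow> y \<in> objs C \<Longrightarrow> z \<in> objs C \<Longrightarrow>
      tgt C (asc A x y z) = ten A x (ten A y z)"
    and lunitor_arr[simp]: "x \<in> objs C \<Longrightarrow> lunitor (snd A) x \<in> arrs C"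
    and src_lunitor[simp]: "x \<in> objs C \<Longrightarrow> src C (lunitor (snd A) x) = ten A (munit (snd A)) x"
    and tgt_lunitor[simp]: "x \<in> objs C \<Longrightarrow> tgt C (lunitor (snd A) x) = x"
    and runitor_arr[simp]: "x \<in> objs C \<Longrightarrow> runitor (snd A) x \<in> arrs C"
    and src_runitor[simp]: "x \<in> objs C \<Longrightarrow> src C (runitor (snd A) x) = ten A x (munit (snd A))"
    and tgt_runitor[simp]: "x \<in> objs C \<Longrightarrow> tgt C (runitor (snd A) x) = x"
  using asc_hom[OF A] lunitor_hom[OF A] runitor_hom[OF A] unfolding C_def by (auto simp: hom_def)


section \<open>Day convolution by generators and relations\<close>

definition quintuple_code :: "'u \<times> 'u \<times> 'u \<times> 'u \<times> 'u \<Rightarrow> 'u" where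
  "quintuple_code = (SOME e. inj e)"

lemma inj_quintuple_code: "inj (quintuple_code :: 'u::universe \<times> 'u \<times> 'u \<times> 'u \<times> 'u \<Rightarrow> 'u)"
  unfolding quintuple_code_def by (rule someI_ex[OF inj_quintupling])

text \<open>
  The value at \<open>a\<close> of the Day convolution, the coend of \<open>A(a, x \<otimes> y) \<times> p(x) \<times> q(y)\<close> over \<open>x\<close> and
  \<open>y\<close>, is presented by tuples \<open>(x, y, f, s, t)\<close> with \<open>f : a \<rightarrow> x \<otimes> y\<close>, \<open>s \<in> p(x)\<close>, \<open>t \<in> q(y)\<close>.
\<close>

definition day_tuples ::
    "('u, 'u) algebra \<Rightarrow> 'u psh \<Rightarrow> 'u psh \<Rightarrow> 'u \<Rightarrow> ('u \<times> 'u \<times> 'u \<times> 'u \<times> 'u) set" where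
  "day_tuples A p q a = {(x, y, f, s, t). x \<in> objs (fst A) \<and> y \<in> objs (fst A) \<and>
     f \<in> hom (fst A) a (ten A x y) \<and> s \<in> fobj p x \<and> t \<in> fobj q y}"

text \<open>Both variables of the coend are moved at once, along \<open>g\<close> and
  \<open>h\<close>; an identity in one place gives the relation in the other variable.\<close>

definition day_rel :: "('u, 'u) algebra \<Rightarrow> 'u psh \<Rightarrow> 'u psh \<Rightarrow> 'u \<Rightarrow>
    (('u \<times> 'u \<times> 'u \<times> 'u \<times> 'u) \<times> ('u \<times> 'u \<times> 'u \<times> 'u \<times> 'u)) set" where
  "day_rel A p q a = (let C = fst A in
     {((src C g, src C h, f, act C p g s, act C q h t), (tgt C g, tgt C h, tar A g h \<cdot>\<^bsub>C\<^esub> f, s, t)) |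
        f g h s t. g \<in> arrs C \<and> h \<in> arrs C \<and> f \<in> hom C a (ten A (src C g) (src C h)) \<and>
          s \<in> fobj p (tgt C g) \<and> t \<in> fobj q (tgt C h)})"

definition day_class ::
    "('u, 'u) algebra \<Rightarrow> 'u psh \<Rightarrow> 'u psh \<Rightarrow> 'u \<Rightarrow> 'u \<times> 'u \<times> 'u \<times> 'u \<times> 'u \<Rightarrow> 'u" where
  "day_class A p q a w =
     quintuple_code (SOME v. (w, v) \<in> (day_rel A p q a \<union> (day_rel A p q a)\<inverse>)\<^sup>*)"

definition day_lift :: "('u \<Rightarrow> 'u \<Rightarrow> 'u \<Rightarrow> 'u \<Rightarrow> 'u \<Rightarrow> 'b) \<Rightarrow> 'u::universe \<Rightarrow> 'b" where
  "day_lift H c = (case inv quintuple_code c of (x, y, f, s, t) \<Rightarrow> H x y f s t)"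

definition day :: "('u::universe, 'u) algebra \<Rightarrow> 'u psh \<Rightarrow> 'u psh \<Rightarrow> 'u psh" where
  "day A p q = make_presheaf (fst A) (\<lambda>a. day_class A p q a ` day_tuples A p q a)
     (\<lambda>k. day_lift (\<lambda>x y f s t. day_class A p q (src (fst A) k) (x, y, f \<cdot>\<^bsub>fst A\<^esub> k, s, t)))"

text \<open>The generator \<open>s\<close> tensor \<open>t\<close>, living at the object
  \<open>ten A x y\<close> itself. The class of a tuple \<open>(x, y, f, s, t)\<close> at another
  object is its restriction along \<open>f\<close>, by \<open>act_gen_class\<close>; this is why
  bilinear families need values only at tensor products of objects.\<close>

definition gen :: "('u::universe, 'u) algebra \<Rightarrow> 'u psh \<Rightarrow> 'u psh \<Rightarrow> 'u \<Rightarrow> 'u \<Rightarrow> 'u \<Rightarrow> 'u \<Rightarrow> 'u" where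
  "gen A p q x y s t = day_class A p q (ten A x y) (x, y, ident (fst A) (ten A x y), s, t)"

lemma day_lift_class:
  assumes "\<And>f g h s t. g \<in> arrs (fst A) \<Longrightarrow> h \<in> arrs (fst A) \<Longrightarrow>
    f \<in> hom (fst A) a (ten A (src (fst A) g) (src (fst A) h)) \<Longrightarrow>
    s \<in> fobj p (tgt (fst A) g) \<Longrightarrow> t \<in> fobj q (tgt (fst A) h) \<Longrightarrow>
    H (src (fst A) g) (src (fst A) h) f (act (fst A) p g s) (act (fst A) q h t) =
    H (tgt (fst A) g) (tgt (fst A) h) (tar A g h \<cdot>\<^bsub>fst A\<^esub> f) s t"
  shows "day_lift H (day_class A p q a (x, y, f, s, t)) = H x y f s t"
proof -
  have "(case SOME v. ((x, y, f, s, t), v) \<in> (day_rel A p q a \<union> (day_rel A p q a)\<inverse>)\<^sup>* of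
      (x, y, f, s, t) \<Rightarrow> H x y f s t) =
    (case (x, y, f, s, t) of (x, y, f, s, t) \<Rightarrow> H x y f s t)"
    by (rule some_rep_invariant) (auto simp: day_rel_def Let_def assms)
  then show ?thesis
    by (simp add: day_lift_def day_class_def inv_f_f[OF inj_quintuple_code])
qed

lemma day_class_dinatural:
  "g \<in> arrs (fst A) \<Longrightarrow> h \<in> arrs (fst A) \<Longrightarrow> f \<in> hom (fst A) a (ten A (src (fst A) g) (src (fst A) h)) \<Longrightarrow>
    s \<in> fobj p (tgt (fst A) g) \<Longrightarrow> t \<in> fobj q (tgt (fst A) h) \<Longrightarrow>
    day_class A p q a (src (fst A) g, src (fst A) h, f, act (fst A) p g s, act (fst A) q h t) =
    day_class A p q a (tgt (fst A) g, tgt (fst A) h, tar A g h \<cdot>\<^bsub>fst A\<^esub> f, s, t)"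
  unfolding day_class_def
  by (rule arg_cong[where f=quintuple_code], rule some_rep_eq) (auto simp: day_rel_def Let_def)

context
  fixes A :: "('u::universe, 'u) algebra" and C p q
  assumes A: "small_monoidal A" and p: "presheaf (fst A) p" and q: "presheaf (fst A) q"
  defines "C \<equiv> fst A"
begin

lemma small_monoidal_simps:
  "small_category TYPE('u) C" "category C" "presheaf C p" "presheaf C q" "small_monoidal A"
  using A p q by (simp_all add: C_def)

lemmas tensor_simps =
  A[THEN tar_arr, folded C_def] A[THEN src_tar, folded C_def] A[THEN tgt_tar, folded C_def]
  A[THEN ten_obj, folded C_def]

text \<open>Precomposition with \<open>k\<close> commutes with postcomposition by
  \<open>tar A g h\<close>, by associativity, and so respects the relation
  \<open>day_rel\<close>.\<close>

lemma day_lift_restrict: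
  assumes "k \<in> arrs C"
  shows "day_lift (\<lambda>x y f s t. day_class A p q (src C k) (x, y, f \<cdot>\<^bsub>C\<^esub> k, s, t))
      (day_class A p q (tgt C k) (x, y, f, s, t)) = day_class A p q (src C k) (x, y, f \<cdot>\<^bsub>C\<^esub> k, s, t)"
proof (rule day_lift_class)
  fix f g h s t
  assume gh: "g \<in> arrs (fst A)" "h \<in> arrs (fst A)" and
    f: "f \<in> hom (fst A) (tgt C k) (ten A (src (fst A) g) (src (fst A) h))" and
    st: "s \<in> fobj p (tgt (fst A) g)" "t \<in> fobj q (tgt (fst A) h)"
  have "f \<cdot>\<^bsub>C\<^esub> k \<in> hom (fst A) (src C k) (ten A (src (fst A) g) (src (fst A) h))"
    using f assms A unfolding C_def by (auto simp: hom_def)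
  from day_class_dinatural[OF gh this st] f
  show "day_class A p q (src C k) (src (fst A) g, src (fst A) h, f \<cdot>\<^bsub>C\<^esub> k, act (fst A) p g s, act (fst A) q h t) =
    day_class A p q (src C k) (tgt (fst A) g, tgt (fst A) h, (tar A g h \<cdot>\<^bsub>fst A\<^esub> f) \<cdot>\<^bsub>C\<^esub> k, s, t)"
    using A gh assms unfolding C_def by (simp add: hom_def cmp_assoc)
qed

lemma presheaf_day: "presheaf C (day A p q)"
  unfolding day_def C_def[symmetric]
proof (rule presheaf_make_presheaf)
  note [simp] = small_monoidal_simps
  fix a assume a: "a \<in> objs C"
  have "day_tuples A p q a \<subseteq> objs C \<times> objs C \<times> arrs C \<times> (\<Union>x\<in>objs C. fobj p x) \<times> (\<Union>y\<in>objs C. fobj q y)"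
    by (auto simp: day_tuples_def C_def hom_def)
  moreover have "small TYPE('u) (\<Union>x\<in>objs C. fobj r x)" if "presheaf C r" for r
  proof -
    have "small TYPE('u) (snd ` (SIGMA x:objs C. fobj r x))"
      using that small_monoidal_simps(1)
      by (intro small_image small_Sigma) (auto simp: small_category_def)
    moreover have "snd ` (SIGMA x:objs C. fobj r x) = (\<Union>x\<in>objs C. fobj r x)" by force
    ultimately show ?thesis by simp
  qed
  then have "small TYPE('u) (objs C \<times> objs C \<times> arrs C \<times> (\<Union>x\<in>objs C. fobj p x) \<times> (\<Union>y\<in>objs C. fobj q y))"
    using small_monoidal_simps(1) by (intro small_Times) (auto simp: small_category_def)
  ultimately have "small TYPE('u) (day_tuples A p q a)" by (rule small_subset[rotated])
  then show "small TYPE('u) (day_class A p q a ` day_tuples A p q a)" by (rule small_image)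
next
  note [simp] = small_monoidal_simps day_lift_restrict
  show "category C" by simp
  fix k c assume k: "k \<in> arrs C" and c: "c \<in> day_class A p q (tgt C k) ` day_tuples A p q (tgt C k)"
  show "day_lift (\<lambda>x y f s t. day_class A p q (src C k) (x, y, f \<cdot>\<^bsub>C\<^esub> k, s, t)) c
      \<in> day_class A p q (src C k) ` day_tuples A p q (src C k)"
    using k c by (auto simp: day_tuples_def C_def[symmetric] hom_def intro!: imageI)
next
  note [simp] = small_monoidal_simps
  fix a c assume a: "a \<in> objs C" and c: "c \<in> day_class A p q a ` day_tuples A p q a"
  then show "day_lift (\<lambda>x y f s t. day_class A p q (src C (ident C a)) (x, y, f \<cdot>\<^bsub>C\<^esub> ident C a, s, t)) c = c"
    using day_lift_restrict[of "ident C a"]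
    by (auto simp: day_tuples_def C_def[symmetric] hom_def)
next
  note [simp] = small_monoidal_simps
  fix k l c assume k: "k \<in> arrs C" "l \<in> arrs C" "tgt C k = src C l"
    and c: "c \<in> day_class A p q (tgt C l) ` day_tuples A p q (tgt C l)"
  then show "day_lift (\<lambda>x y f s t. day_class A p q (src C (l \<cdot>\<^bsub>C\<^esub> k)) (x, y, f \<cdot>\<^bsub>C\<^esub> (l \<cdot>\<^bsub>C\<^esub> k), s, t)) c =
    day_lift (\<lambda>x y f s t. day_class A p q (src C k) (x, y, f \<cdot>\<^bsub>C\<^esub> k, s, t))
      (day_lift (\<lambda>x y f s t. day_class A p q (src C l) (x, y, f \<cdot>\<^bsub>C\<^esub> l, s, t)) c)"
    using day_lift_restrict[of k] day_lift_restrict[of l] day_lift_restrict[of "l \<cdot>\<^bsub>C\<^esub> k"]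
    by (auto simp: day_tuples_def C_def[symmetric] hom_def cmp_assoc)
qed

lemma act_gen_class:
  assumes "f \<in> hom C a (ten A x y)" "x \<in> objs C" "y \<in> objs C" "s \<in> fobj p x" "t \<in> fobj q y"
  shows "act C (day A p q) f (gen A p q x y s t) = day_class A p q a (x, y, f, s, t)"
proof -
  note [simp] = small_monoidal_simps tensor_simps
  have "gen A p q x y s t \<in> day_class A p q (ten A x y) ` day_tuples A p q (ten A x y)"
    unfolding gen_def C_def[symmetric] using assms
    by (intro imageI) (auto simp: day_tuples_def C_def[symmetric] hom_def tensor_simps)
  then show ?thesis
    using assms day_lift_restrict[of f x y "ident C (ten A x y)" s t] A
    unfolding day_def C_def[symmetric] gen_def
    by (simp add: hom_def) 
qed

lemma gen_mem: "x \<in> objs C \<Longrightarrow> y \<in> objs C \<Longrightarrow> s \<in> fobj p x \<Longrightarrow> t \<in> fobj q y \<Longrightarrow>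
    gen A p q x y s t \<in> fobj (day A p q) (ten A x y)"
  using small_monoidal_simps tensor_simps
  by (auto simp: day_def gen_def day_tuples_def C_def[symmetric] hom_def intro!: imageI)

lemma day_cases:
  assumes "c \<in> fobj (day A p q) a" "a \<in> objs C"
  obtains x y f s t where "x \<in> objs C" "y \<in> objs C" "f \<in> arrs C" "src C f = a" "tgt C f = ten A x y"
    "s \<in> fobj p x" "t \<in> fobj q y" "c = act C (day A p q) f (gen A p q x y s t)"
proof -
  have "c \<in> day_class A p q a ` day_tuples A p q a" using assms by (simp add: day_def C_def)
  then show ?thesis
    using that act_gen_class by (auto simp: day_tuples_def C_def[symmetric] hom_def)
qed

text \<open>The generating relation with \<open>f\<close> an identity. It says that generators form
  a bilinear family, and it is the only relation among generators used by later
  computations.\<close>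

lemma gen_natural:
  assumes "g \<in> arrs C" "h \<in> arrs C" "s \<in> fobj p (tgt C g)" "t \<in> fobj q (tgt C h)"
    "src C g = x" "src C h = y"
  shows "gen A p q x y (act C p g s) (act C q h t) =
    act C (day A p q) (tar A g h) (gen A p q (tgt C g) (tgt C h) s t)"
proof -
  note [simp] = small_monoidal_simps tensor_simps
  have "day_class A p q (ten A x y) (src C g, src C h, ident C (ten A x y), act C p g s, act C q h t) =
     day_class A p q (ten A x y) (tgt C g, tgt C h, tar A g h \<cdot>\<^bsub>C\<^esub> ident C (ten A x y), s, t)"
    using assms
    by (intro day_class_dinatural[of _ A, folded C_def]) (auto simp: hom_def)
  moreover have "act C (day A p q) (tar A g h) (gen A p q (tgt C g) (tgt C h) s t) =
      day_class A p q (ten A x y) (tgt C g, tgt C h, tar A g h, s, t)"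
    using assms by (intro act_gen_class) (auto simp: hom_def)
  ultimately show ?thesis using assms by (auto simp: gen_def C_def[symmetric])
qed

lemma day_lift_gen:
  assumes "\<And>f g h s t. g \<in> arrs C \<Longrightarrow> h \<in> arrs C \<Longrightarrow> f \<in> arrs C \<Longrightarrow> src C f = a \<Longrightarrow>
      tgt C f = ten A (src C g) (src C h) \<Longrightarrow> s \<in> fobj p (tgt C g) \<Longrightarrow> t \<in> fobj q (tgt C h) \<Longrightarrow>
      H (src C g) (src C h) f (act C p g s) (act C q h t) =
      H (tgt C g) (tgt C h) (tar A g h \<cdot>\<^bsub>C\<^esub> f) s t"
    and "f \<in> arrs C" "src C f = a" "tgt C f = ten A x y" "x \<in> objs C" "y \<in> objs C" "s \<in> fobj p x" "t \<in> fobj q y"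
  shows "day_lift H (act C (day A p q) f (gen A p q x y s t)) = H x y f s t"
proof -
  have "f \<in> hom C a (ten A x y)" using assms by (simp add: hom_def)
  then show ?thesis
    using assms(5-) by (simp add: act_gen_class)
      (rule day_lift_class, rule assms(1)[unfolded C_def], auto simp: hom_def)
qed

end

declare gen_mem[simp] presheaf_day[simp]

lemma act_act:
  "presheaf X p \<Longrightarrow> f \<in> arrs X \<Longrightarrow> g \<in> arrs X \<Longrightarrow> tgt X f = src X g \<Longrightarrow> t \<in> fobj p (tgt X g) \<Longrightarrow>
    act X p f (act X p g t) = act X p (g \<cdot>\<^bsub>X\<^esub> f) t"
  by (simp add: act_cmp)

lemma
  assumes A: "small_monoidal (A :: ('u::universe, 'u) algebra)"
    and "presheaf (fst A) p" "presheaf (fst A) q"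
  shows gen_act_left: "g \<in> arrs (fst A) \<Longrightarrow> y \<in> objs (fst A) \<Longrightarrow> s \<in> fobj p (tgt (fst A) g) \<Longrightarrow> t \<in> fobj q y \<Longrightarrow>
      src (fst A) g = x \<Longrightarrow> gen A p q x y (act (fst A) p g s) t =
      act (fst A) (day A p q) (tar A g (ident (fst A) y)) (gen A p q (tgt (fst A) g) y s t)"
    and gen_act_right: "h \<in> arrs (fst A) \<Longrightarrow> x \<in> objs (fst A) \<Longrightarrow> s \<in> fobj p x \<Longrightarrow> t \<in> fobj q (tgt (fst A) h) \<Longrightarrow>
      src (fst A) h = y \<Longrightarrow> gen A p q x y s (act (fst A) q h t) =
      act (fst A) (day A p q) (tar A (ident (fst A) x) h) (gen A p q x (tgt (fst A) h) s t)"
  using gen_natural[OF assms, of g "ident (fst A) y" s t x y] gen_natural[OF assms, of "ident (fst A) x" h s t x y] assms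
  by simp_all

section \<open>Universal properties of twofold and threefold Day convolution\<close>

lemma day_arrow_exists:
  assumes A: "small_monoidal A" and p: "presheaf (fst A) p" and q: "presheaf (fst A) q"
    and k: "presheaf (fst A) k"
  defines "C \<equiv> fst A"
  assumes mem: "\<And>x y s t. x \<in> objs C \<Longrightarrow> y \<in> objs C \<Longrightarrow> s \<in> fobj p x \<Longrightarrow> t \<in> fobj q y \<Longrightarrow>
      B x y s t \<in> fobj k (ten A x y)"
    and nat: "\<And>g h s t. g \<in> arrs C \<Longrightarrow> h \<in> arrs C \<Longrightarrow> s \<in> fobj p (tgt C g) \<Longrightarrow> t \<in> fobj q (tgt C h) \<Longrightarrow>
      B (src C g) (src C h) (act C p g s) (act C q h t) = act C k (tar A g h) (B (tgt C g) (tgt C h) s t)"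
  shows "\<exists>m. m \<in> hom (presheaves C) (day A p q) k \<and> (\<forall>x\<in>objs C. \<forall>y\<in>objs C. \<forall>s\<in>fobj p x. \<forall>t\<in>fobj q y.
    ap C m (ten A x y) (gen A p q x y s t) = B x y s t)"
proof -
  note [simp] = small_monoidal_simps[OF A p q, folded C_def] tensor_simps[OF A p q, folded C_def]
    presheaf_day[OF A p q, folded C_def] k[folded C_def] gen_mem[OF A p q, folded C_def]
  \<comment> \<open>The value on a restricted generator is forced, since an arrow has to commute
    with restriction along \<open>f\<close>. The hypothesis \<open>nat\<close> is what makes this
    formula compatible with \<open>day_rel\<close>.\<close>
  let ?H = "\<lambda>x y f s t. act C k f (B x y s t)"
  have L: "day_lift ?H (act C (day A p q) f (gen A p q x y s t)) = ?H x y f s t"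
    if "f \<in> arrs C" "tgt C f = ten A x y" "x \<in> objs C" "y \<in> objs C" "s \<in> fobj p x" "t \<in> fobj q y" for x y f s t
    using that
    by (intro day_lift_gen[OF A p q, folded C_def, of "src C f"]) (simp_all add: nat mem act_act)
  have L': "day_lift ?H (gen A p q x y s t) = B x y s t"
    if "x \<in> objs C" "y \<in> objs C" "s \<in> fobj p x" "t \<in> fobj q y" for x y s t
    using L[of "ident C (ten A x y)" x y s t] that by (simp add: mem)
  let ?m = "make_arrow C (day A p q) k (\<lambda>_. day_lift ?H)"
  have "?m \<in> hom (presheaves C) (day A p q) k"
  proof (rule make_arrow_hom)
    fix a c assume "a \<in> objs C" "c \<in> fobj (day A p q) a"
    then show "day_lift ?H c \<in> fobj k a"
      by (auto elim!: day_cases[OF A p q, folded C_def] simp: L mem)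
  next
    fix g c assume g: "g \<in> arrs C" and c: "c \<in> fobj (day A p q) (tgt C g)"
    obtain x y f s t where "x \<in> objs C" "y \<in> objs C" "f \<in> arrs C" "src C f = tgt C g" "tgt C f = ten A x y"
      "s \<in> fobj p x" "t \<in> fobj q y" "c = act C (day A p q) f (gen A p q x y s t)"
      by (rule day_cases[OF A p q, folded C_def, OF c cat_tgt[OF category_fst[OF A, folded C_def] g]])
    then show "day_lift ?H (act C (day A p q) g c) = act C k g (day_lift ?H c)"
      using g by (simp add: act_act L mem)
  qed simp_all
  then show ?thesis using L' by (intro exI[of _ ?m]) simp
qed

lemma day_arrow_eqI:
  assumes A: "small_monoidal A" and p: "presheaf (fst A) p" and q: "presheaf (fst A) q"
  defines "C \<equiv> fst A"
  assumes m: "m \<in> hom (presheaves C) (day A p q) k" and m': "m' \<in> hom (presheaves C) (day A p q) k"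
    and eq: "\<And>x y s t. x \<in> objs C \<Longrightarrow> y \<in> objs C \<Longrightarrow> s \<in> fobj p x \<Longrightarrow> t \<in> fobj q y \<Longrightarrow>
      ap C m (ten A x y) (gen A p q x y s t) = ap C m' (ten A x y) (gen A p q x y s t)"
  shows "m = m'"
proof (rule presheaf_arrow_eqI[OF m m'])
  note [simp] = small_monoidal_simps[OF A p q, folded C_def] gen_mem[OF A p q, folded C_def]
  fix a c assume a: "a \<in> objs C" and c: "c \<in> fobj (day A p q) a"
  obtain x y f s t where "x \<in> objs C" "y \<in> objs C" "f \<in> arrs C" "src C f = a" "tgt C f = ten A x y"
    "s \<in> fobj p x" "t \<in> fobj q y" "c = act C (day A p q) f (gen A p q x y s t)"
    by (rule day_cases[OF A p q, folded C_def, OF c a])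
  then show "ap C m a c = ap C m' a c"
    using hom_arr[OF m] hom_src[OF m] hom_tgt[OF m] hom_arr[OF m'] hom_src[OF m'] hom_tgt[OF m']
    by (simp add: eq)
qed

text \<open>The left factor of an outer generator is an arbitrary element of
  \<open>day A p q\<close>, so a trilinear family on generators has to be extended to it before the
  binary universal property can be applied.\<close>

lemma day_day_arrow_exists:
  assumes A: "small_monoidal A" and p: "presheaf (fst A) p" and q: "presheaf (fst A) q"
    and r: "presheaf (fst A) r" and k: "presheaf (fst A) k"
  defines "C \<equiv> fst A"
  assumes mem: "\<And>x y z s t w. x \<in> objs C \<Longrightarrow> y \<in> objs C \<Longrightarrow> z \<in> objs C \<Longrightarrow> s \<in> fobj p x \<Longrightarrow>
      t \<in> fobj q y \<Longrightarrow> w \<in> fobj r z \<Longrightarrow> T x y z s t w \<in> fobj k (ten A (ten A x y) z)"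
    and nat: "\<And>f g h s t w. f \<in> arrs C \<Longrightarrow> g \<in> arrs C \<Longrightarrow> h \<in> arrs C \<Longrightarrow> s \<in> fobj p (tgt C f) \<Longrightarrow>
      t \<in> fobj q (tgt C g) \<Longrightarrow> w \<in> fobj r (tgt C h) \<Longrightarrow>
      T (src C f) (src C g) (src C h) (act C p f s) (act C q g t) (act C r h w) =
      act C k (tar A (tar A f g) h) (T (tgt C f) (tgt C g) (tgt C h) s t w)"
  shows "\<exists>m. m \<in> hom (presheaves C) (day A (day A p q) r) k \<and>
    (\<forall>x\<in>objs C. \<forall>y\<in>objs C. \<forall>z\<in>objs C. \<forall>s\<in>fobj p x. \<forall>t\<in>fobj q y. \<forall>w\<in>fobj r z.
      ap C m (ten A (ten A x y) z) (gen A (day A p q) r (ten A x y) z (gen A p q x y s t) w) = T x y z s t w)"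
proof -
  note [simp] = small_monoidal_simps[OF A p q, folded C_def] tensor_simps[OF A p q, folded C_def]
    presheaf_day[OF A p q, folded C_def] r[folded C_def] k[folded C_def] gen_mem[OF A p q, folded C_def]
    tar_ident[OF A, folded C_def]
  note pq = presheaf_day[OF A p q]
  \<comment> \<open>For fixed \<open>w\<close> the family is lifted over the inner factor: if that
    factor is restricted along \<open>f\<close>, the value is restricted along \<open>f\<close>
    tensor the identity of \<open>z\<close>.\<close>
  let ?H = "\<lambda>z w x y f s t. act C k (tar A f (ident C z)) (T x y z s t w)"
  \<comment> \<open>Naturality is split in two: \<open>T1\<close>, in the inner pair, makes each
    lift well defined, while \<open>T2\<close>, in the remaining variable, is used for the
    bilinearity of the lifted family.\<close>
  have T1: "T (src C f) (src C g) z (act C p f s) (act C q g t) w =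
      act C k (tar A (tar A f g) (ident C z)) (T (tgt C f) (tgt C g) z s t w)"
    if "f \<in> arrs C" "g \<in> arrs C" "z \<in> objs C" "s \<in> fobj p (tgt C f)" "t \<in> fobj q (tgt C g)" "w \<in> fobj r z"
    for f g z s t w
    using nat[of f g "ident C z" s t w] that by simp
  have T2: "T x y (src C h) s t (act C r h w) =
      act C k (tar A (ident C (ten A x y)) h) (T x y (tgt C h) s t w)"
    if "h \<in> arrs C" "x \<in> objs C" "y \<in> objs C" "s \<in> fobj p x" "t \<in> fobj q y" "w \<in> fobj r (tgt C h)"
    for h x y s t w
    using nat[of "ident C x" "ident C y" h s t w] that by simp
  have L: "day_lift (?H z w) (act C (day A p q) f (gen A p q x y s t)) = ?H z w x y f s t"
    if "f \<in> arrs C" "tgt C f = ten A x y" "x \<in> objs C" "y \<in> objs C" "s \<in> fobj p x" "t \<in> fobj q y"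
      "z \<in> objs C" "w \<in> fobj r z" for x y f s t z w
    using that
    by (intro day_lift_gen[OF A p q, folded C_def, of "src C f"])
      (simp_all add: T1 mem act_act flip: tar_cmp[OF A, folded C_def])
  have L': "day_lift (?H z w) (gen A p q x y s t) = T x y z s t w"
    if "x \<in> objs C" "y \<in> objs C" "s \<in> fobj p x" "t \<in> fobj q y" "z \<in> objs C" "w \<in> fobj r z" for x y s t z w
    using L[of "ident C (ten A x y)" x y s t z w] that by (simp add: mem)
  have "\<exists>m. m \<in> hom (presheaves C) (day A (day A p q) r) k \<and>
    (\<forall>a\<in>objs C. \<forall>z\<in>objs C. \<forall>v\<in>fobj (day A p q) a. \<forall>w\<in>fobj r z.
      ap C m (ten A a z) (gen A (day A p q) r a z v w) = day_lift (?H z w) v)"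
    unfolding C_def
  proof (rule day_arrow_exists[OF A pq r k], fold C_def)
    fix a z v w assume "a \<in> objs C" "z \<in> objs C" and v: "v \<in> fobj (day A p q) a" and "w \<in> fobj r z"
    then show "day_lift (?H z w) v \<in> fobj k (ten A a z)"
      by (auto elim!: day_cases[OF A p q, folded C_def] simp: L mem)
  next
    fix g h v w assume g: "g \<in> arrs C" "h \<in> arrs C" and v: "v \<in> fobj (day A p q) (tgt C g)"
      and w: "w \<in> fobj r (tgt C h)"
    obtain x y f s t where "x \<in> objs C" "y \<in> objs C" "f \<in> arrs C" "src C f = tgt C g" "tgt C f = ten A x y"
      "s \<in> fobj p x" "t \<in> fobj q y" "v = act C (day A p q) f (gen A p q x y s t)"
      by (rule day_cases[OF A p q, folded C_def, OF v cat_tgt[OF category_fst[OF A, folded C_def] g(1)]])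
    then show "day_lift (?H (src C h) (act C r h w)) (act C (day A p q) g v) =
        act C k (tar A g h) (day_lift (?H (tgt C h) w) v)"
      using g w by (simp add: act_act L T2 mem flip: tar_cmp[OF A, folded C_def])
  qed
  then show ?thesis by (elim ex_forward) (simp add: L')
qed

text \<open>The mirror image of \<open>day_day_arrow_exists\<close>, for the other bracketing; it
  provides the inverse of the associator.\<close>

lemma day_day_arrow_exists':
  assumes A: "small_monoidal A" and p: "presheaf (fst A) p" and q: "presheaf (fst A) q"
    and r: "presheaf (fst A) r" and k: "presheaf (fst A) k"
  defines "C \<equiv> fst A"
  assumes mem: "\<And>x y z s t w. x \<in> objs C \<Longrightarrow> y \<in> objs C \<Longrightarrow> z \<in> objs C \<Longrightarrow> s \<in> fobj p x \<Longrightarrow>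
      t \<in> fobj q y \<Longrightarrow> w \<in> fobj r z \<Longrightarrow> T x y z s t w \<in> fobj k (ten A x (ten A y z))"
    and nat: "\<And>f g h s t w. f \<in> arrs C \<Longrightarrow> g \<in> arrs C \<Longrightarrow> h \<in> arrs C \<Longrightarrow> s \<in> fobj p (tgt C f) \<Longrightarrow>
      t \<in> fobj q (tgt C g) \<Longrightarrow> w \<in> fobj r (tgt C h) \<Longrightarrow>
      T (src C f) (src C g) (src C h) (act C p f s) (act C q g t) (act C r h w) =
      act C k (tar A f (tar A g h)) (T (tgt C f) (tgt C g) (tgt C h) s t w)"
  shows "\<exists>m. m \<in> hom (presheaves C) (day A p (day A q r)) k \<and>
    (\<forall>x\<in>objs C. \<forall>y\<in>objs C. \<forall>z\<in>objs C. \<forall>s\<in>fobj p x. \<forall>t\<in>fobj q y. \<forall>w\<in>fobj r z.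
      ap C m (ten A x (ten A y z)) (gen A p (day A q r) x (ten A y z) s (gen A q r y z t w)) = T x y z s t w)"
proof -
  note [simp] = small_monoidal_simps[OF A q r, folded C_def] tensor_simps[OF A q r, folded C_def]
    presheaf_day[OF A q r, folded C_def] p[folded C_def] k[folded C_def] gen_mem[OF A q r, folded C_def]
    tar_ident[OF A, folded C_def]
  note qr = presheaf_day[OF A q r]
  let ?H = "\<lambda>x s y z f t w. act C k (tar A (ident C x) f) (T x y z s t w)"
  have T1: "T x (src C g) (src C h) s (act C q g t) (act C r h w) =
      act C k (tar A (ident C x) (tar A g h)) (T x (tgt C g) (tgt C h) s t w)"
    if "g \<in> arrs C" "h \<in> arrs C" "x \<in> objs C" "s \<in> fobj p x" "t \<in> fobj q (tgt C g)" "w \<in> fobj r (tgt C h)"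
    for g h x s t w
    using nat[of "ident C x" g h s t w] that by simp
  have T2: "T (src C f) y z (act C p f s) t w =
      act C k (tar A f (ident C (ten A y z))) (T (tgt C f) y z s t w)"
    if "f \<in> arrs C" "y \<in> objs C" "z \<in> objs C" "s \<in> fobj p (tgt C f)" "t \<in> fobj q y" "w \<in> fobj r z"
    for f y z s t w
    using nat[of f "ident C y" "ident C z" s t w] that by simp
  have L: "day_lift (?H x s) (act C (day A q r) f (gen A q r y z t w)) = ?H x s y z f t w"
    if "f \<in> arrs C" "tgt C f = ten A y z" "y \<in> objs C" "z \<in> objs C" "t \<in> fobj q y" "w \<in> fobj r z"
      "x \<in> objs C" "s \<in> fobj p x" for x y f s t z w
    using that
    by (intro day_lift_gen[OF A q r, folded C_def, of "src C f"])
      (simp_all add: T1 mem act_act flip: tar_cmp[OF A, folded C_def])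
  have L': "day_lift (?H x s) (gen A q r y z t w) = T x y z s t w"
    if "x \<in> objs C" "y \<in> objs C" "s \<in> fobj p x" "t \<in> fobj q y" "z \<in> objs C" "w \<in> fobj r z" for x y s t z w
    using L[of "ident C (ten A y z)" y z t w x s] that by (simp add: mem)
  have "\<exists>m. m \<in> hom (presheaves C) (day A p (day A q r)) k \<and>
    (\<forall>x\<in>objs C. \<forall>a\<in>objs C. \<forall>s\<in>fobj p x. \<forall>v\<in>fobj (day A q r) a.
      ap C m (ten A x a) (gen A p (day A q r) x a s v) = day_lift (?H x s) v)"
    unfolding C_def
  proof (rule day_arrow_exists[OF A p qr k], fold C_def)
    fix x a s v assume "x \<in> objs C" "a \<in> objs C" "s \<in> fobj p x" and v: "v \<in> fobj (day A q r) a"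
    then show "day_lift (?H x s) v \<in> fobj k (ten A x a)"
      by (auto elim!: day_cases[OF A q r, folded C_def] simp: L mem)
  next
    fix g h s v assume g: "g \<in> arrs C" "h \<in> arrs C" and s: "s \<in> fobj p (tgt C g)"
      and v: "v \<in> fobj (day A q r) (tgt C h)"
    obtain y z f t w where "y \<in> objs C" "z \<in> objs C" "f \<in> arrs C" "src C f = tgt C h" "tgt C f = ten A y z"
      "t \<in> fobj q y" "w \<in> fobj r z" "v = act C (day A q r) f (gen A q r y z t w)"
      by (rule day_cases[OF A q r, folded C_def, OF v cat_tgt[OF category_fst[OF A, folded C_def] g(2)]])
    then show "day_lift (?H (src C g) (act C p g s)) (act C (day A q r) h v) =
        act C k (tar A g h) (day_lift (?H (tgt C g) s) v)"
      using g s by (simp add: act_act L T2 mem flip: tar_cmp[OF A, folded C_def])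
  qed
  then show ?thesis by (elim ex_forward) (simp add: L')
qed

text \<open>An element of the inner tensor product is a restriction of a generator along some
  \<open>f\<close>. By \<open>gen_act_left\<close> this becomes a restriction of the outer generator
  along \<open>f\<close> tensor an identity, and naturality of \<open>m\<close> and
  \<open>m'\<close> strips it off.\<close>

lemma day_day_arrow_eqI:
  assumes A: "small_monoidal A" and p: "presheaf (fst A) p" and q: "presheaf (fst A) q"
    and r: "presheaf (fst A) r"
  defines "C \<equiv> fst A"
  assumes m: "m \<in> hom (presheaves C) (day A (day A p q) r) k"
    and m': "m' \<in> hom (presheaves C) (day A (day A p q) r) k"
    and eq: "\<And>x y z s t w. x \<in> objs C \<Longrightarrow> y \<in> objs C \<Longrightarrow> z \<in> objs C \<Longrightarrow> s \<in> fobj p x \<Longrightarrow> t \<in> fobj q y \<Longrightarrow>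
      w \<in> fobj r z \<Longrightarrow>
      ap C m (ten A (ten A x y) z) (gen A (day A p q) r (ten A x y) z (gen A p q x y s t) w) =
      ap C m' (ten A (ten A x y) z) (gen A (day A p q) r (ten A x y) z (gen A p q x y s t) w)"
  shows "m = m'"
  using m m' unfolding C_def
proof (rule day_arrow_eqI[OF A presheaf_day[OF A p q] r], fold C_def)
  note [simp] = small_monoidal_simps[OF A p q, folded C_def] presheaf_day[OF A p q, folded C_def]
    presheaf_day[OF A presheaf_day[OF A p q] r, folded C_def]  gen_mem[OF A p q, folded C_def]
    gen_mem[OF A presheaf_day[OF A p q] r, folded C_def] tensor_simps[OF A p q, folded C_def]
  fix a z v w assume a: "a \<in> objs C" and z: "z \<in> objs C" "w \<in> fobj r z" and v: "v \<in> fobj (day A p q) a"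
  obtain x y f s t where "x \<in> objs C" "y \<in> objs C" "f \<in> arrs C" "src C f = a" "tgt C f = ten A x y"
    "s \<in> fobj p x" "t \<in> fobj q y" "v = act C (day A p q) f (gen A p q x y s t)"
    by (rule day_cases[OF A p q, folded C_def, OF v a])
  then show "ap C m (ten A a z) (gen A (day A p q) r a z v w) = ap C m' (ten A a z) (gen A (day A p q) r a z v w)"
    using z hom_arr[OF m] hom_src[OF m] hom_tgt[OF m] hom_arr[OF m'] hom_src[OF m'] hom_tgt[OF m']
    by (simp add: gen_act_left[OF A presheaf_day[OF A p q] r, folded C_def] eq)
qed

lemma day_day_arrow_eqI':
  assumes A: "small_monoidal A" and p: "presheaf (fst A) p" and q: "presheaf (fst A) q"
    and r: "presheaf (fst A) r"
  defines "C \<equiv> fst A"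
  assumes m: "m \<in> hom (presheaves C) (day A p (day A q r)) k"
    and m': "m' \<in> hom (presheaves C) (day A p (day A q r)) k"
    and eq: "\<And>x y z s t w. x \<in> objs C \<Longrightarrow> y \<in> objs C \<Longrightarrow> z \<in> objs C \<Longrightarrow> s \<in> fobj p x \<Longrightarrow> t \<in> fobj q y \<Longrightarrow>
      w \<in> fobj r z \<Longrightarrow>
      ap C m (ten A x (ten A y z)) (gen A p (day A q r) x (ten A y z) s (gen A q r y z t w)) =
      ap C m' (ten A x (ten A y z)) (gen A p (day A q r) x (ten A y z) s (gen A q r y z t w))"
  shows "m = m'"
  using m m' unfolding C_def
proof (rule day_arrow_eqI[OF A p presheaf_day[OF A q r]], fold C_def)
  note [simp] = small_monoidal_simps[OF A q r, folded C_def] presheaf_day[OF A q r, folded C_def]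
    presheaf_day[OF A p presheaf_day[OF A q r], folded C_def]  gen_mem[OF A q r, folded C_def]
    gen_mem[OF A p presheaf_day[OF A q r], folded C_def] tensor_simps[OF A q r, folded C_def]
  fix x a s v assume a: "a \<in> objs C" and x: "x \<in> objs C" "s \<in> fobj p x" and v: "v \<in> fobj (day A q r) a"
  obtain y z f t w where "y \<in> objs C" "z \<in> objs C" "f \<in> arrs C" "src C f = a" "tgt C f = ten A y z"
    "t \<in> fobj q y" "w \<in> fobj r z" "v = act C (day A q r) f (gen A q r y z t w)"
    by (rule day_cases[OF A q r, folded C_def, OF v a])
  then show "ap C m (ten A x a) (gen A p (day A q r) x a s v) = ap C m' (ten A x a) (gen A p (day A q r) x a s v)"
    using x hom_arr[OF m] hom_src[OF m] hom_tgt[OF m] hom_arr[OF m'] hom_src[OF m'] hom_tgt[OF m']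
    by (simp add: gen_act_right[OF A p presheaf_day[OF A q r], folded C_def] eq)
qed

abbreviation PSh :: "('u, 'u) algebra \<Rightarrow> ('u psh, 'u psh_arrow) cat" where
  "PSh A \<equiv> presheaves (fst A)"

text \<open>Turns naturality of an invertible cell into naturality of its inverse; it is applied to
  the associator, to both unitors and to the tensor cell of \<open>F\<close>.\<close>

lemma inverse_square:
  assumes C: "category C"
    and a: "a \<in> hom C x y" "a' \<in> hom C y x" "a \<cdot>\<^bsub>C\<^esub> a' = ident C y"
    and b: "b \<in> hom C z w" "b' \<in> hom C w z" "b' \<cdot>\<^bsub>C\<^esub> b = ident C z"
    and f: "f \<in> hom C y w" and g: "g \<in> hom C x z" and eq: "f \<cdot>\<^bsub>C\<^esub> a = b \<cdot>\<^bsub>C\<^esub> g"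
  shows "b' \<cdot>\<^bsub>C\<^esub> f = g \<cdot>\<^bsub>C\<^esub> a'"
proof -
  note h = a(1,2) b(1,2) f g
  note h' = h[THEN hom_arr] h[THEN hom_src] h[THEN hom_tgt]
  have "b' \<cdot>\<^bsub>C\<^esub> f = b' \<cdot>\<^bsub>C\<^esub> (f \<cdot>\<^bsub>C\<^esub> (a \<cdot>\<^bsub>C\<^esub> a'))" using C h' by (simp add: a)
  also have "\<dots> = b' \<cdot>\<^bsub>C\<^esub> ((f \<cdot>\<^bsub>C\<^esub> a) \<cdot>\<^bsub>C\<^esub> a')" using C h' by (simp add: cmp_assoc)
  also have "\<dots> = (b' \<cdot>\<^bsub>C\<^esub> b) \<cdot>\<^bsub>C\<^esub> (g \<cdot>\<^bsub>C\<^esub> a')" unfolding eq using C h' by (simp add: cmp_assoc)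
  also have "\<dots> = g \<cdot>\<^bsub>C\<^esub> a'" using C h' by (simp add: b)
  finally show ?thesis .
qed

lemma iso_in_presheavesI':
  assumes "m \<in> hom (presheaves X) p q" "m' \<in> hom (presheaves X) q p"
    and "m' \<cdot>\<^bsub>presheaves X\<^esub> m = ident (presheaves X) p" "m \<cdot>\<^bsub>presheaves X\<^esub> m' = ident (presheaves X) q"
  shows "iso_in (presheaves X) m"
  using assms unfolding iso_in_def by (intro conjI bexI[of _ m']) (auto simp: hom_def)

lemma ident_hom[simp]: "category C \<Longrightarrow> x \<in> objs C \<Longrightarrow> ident C x \<in> hom C x x"
  by (simp add: hom_def)

section \<open>The coherence cells of Day convolution\<close>

text \<open>Chosen by its values on generators, which determine it; existence is
  \<open>day_arrow_exists\<close>. The structure cells below are introduced in the same way, each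
  followed by a lemma that frees it from the choice.\<close>

definition day_map :: "('u::universe, 'u) algebra \<Rightarrow> 'u psh_arrow \<Rightarrow> 'u psh_arrow \<Rightarrow> 'u psh_arrow" where
  "day_map A m n = (SOME k.
     k \<in> hom (PSh A) (day A (src (PSh A) m) (src (PSh A) n)) (day A (tgt (PSh A) m) (tgt (PSh A) n)) \<and>
     (\<forall>x\<in>objs (fst A). \<forall>y\<in>objs (fst A). \<forall>s\<in>fobj (src (PSh A) m) x. \<forall>t\<in>fobj (src (PSh A) n) y.
       ap (fst A) k (ten A x y) (gen A (src (PSh A) m) (src (PSh A) n) x y s t) =
       gen A (tgt (PSh A) m) (tgt (PSh A) n) x y (ap (fst A) m x s) (ap (fst A) n y t)))"

lemma
  assumes A: "small_monoidal A" and m: "m \<in> arrs (PSh A)" and n: "n \<in> arrs (PSh A)"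
  shows day_map_hom: "day_map A m n \<in>
      hom (PSh A) (day A (src (PSh A) m) (src (PSh A) n)) (day A (tgt (PSh A) m) (tgt (PSh A) n))"
    and ap_day_map[simp]: "x \<in> objs (fst A) \<Longrightarrow> y \<in> objs (fst A) \<Longrightarrow> src (PSh A) m = p \<Longrightarrow>
      src (PSh A) n = q \<Longrightarrow> s \<in> fobj p x \<Longrightarrow> t \<in> fobj q y \<Longrightarrow>
      ap (fst A) (day_map A m n) (ten A x y) (gen A p q x y s t) =
      gen A (tgt (PSh A) m) (tgt (PSh A) n) x y (ap (fst A) m x s) (ap (fst A) n y t)"
proof -
  let ?P = "\<lambda>k. k \<in> hom (PSh A) (day A (src (PSh A) m) (src (PSh A) n)) (day A (tgt (PSh A) m) (tgt (PSh A) n)) \<and>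
     (\<forall>x\<in>objs (fst A). \<forall>y\<in>objs (fst A). \<forall>s\<in>fobj (src (PSh A) m) x. \<forall>t\<in>fobj (src (PSh A) n) y.
       ap (fst A) k (ten A x y) (gen A (src (PSh A) m) (src (PSh A) n) x y s t) =
       gen A (tgt (PSh A) m) (tgt (PSh A) n) x y (ap (fst A) m x s) (ap (fst A) n y t))"
  have "\<exists>k. ?P k"
    using A m n by (intro day_arrow_exists) (simp_all add: gen_natural)
  then have "?P (day_map A m n)" unfolding day_map_def by (rule someI_ex)
  then show "day_map A m n \<in>
      hom (PSh A) (day A (src (PSh A) m) (src (PSh A) n)) (day A (tgt (PSh A) m) (tgt (PSh A) n))"
    "x \<in> objs (fst A) \<Longrightarrow> y \<in> objs (fst A) \<Longrightarrow> src (PSh A) m = p \<Longrightarrow>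
      src (PSh A) n = q \<Longrightarrow> s \<in> fobj p x \<Longrightarrow> t \<in> fobj q y \<Longrightarrow>
      ap (fst A) (day_map A m n) (ten A x y) (gen A p q x y s t) =
      gen A (tgt (PSh A) m) (tgt (PSh A) n) x y (ap (fst A) m x s) (ap (fst A) n y t)" by auto
qed

lemma
  assumes A: "small_monoidal A" and m: "m \<in> arrs (PSh A)" and n: "n \<in> arrs (PSh A)"
  shows day_map_arr[simp]: "day_map A m n \<in> arrs (PSh A)"
    and src_day_map[simp]: "src (PSh A) (day_map A m n) = day A (src (PSh A) m) (src (PSh A) n)"
    and tgt_day_map[simp]: "tgt (PSh A) (day_map A m n) = day A (tgt (PSh A) m) (tgt (PSh A) n)"
  using day_map_hom[OF assms] by (auto simp: hom_def)

definition day_tensor ::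
    "('u::universe, 'u) algebra \<Rightarrow> ('u psh \<times> 'u psh, 'u psh_arrow \<times> 'u psh_arrow, 'u psh, 'u psh_arrow) ftor" where
  "day_tensor A = make_functor (prod_cat (PSh A) (PSh A)) (\<lambda>(p, q). day A p q) (\<lambda>(m, n). day_map A m n)"

lemma is_functor_day_tensor:
  assumes A: "small_monoidal A"
  shows "is_functor (prod_cat (PSh A) (PSh A)) (PSh A) (day_tensor A)"
  unfolding day_tensor_def
proof (rule is_functor_make_functor)
  note [simp] = A
  fix pq assume "pq \<in> objs (prod_cat (PSh A) (PSh A))"
  then obtain p q where pq: "pq = (p, q)" "presheaf (fst A) p" "presheaf (fst A) q" by auto
  then show "(case ident (prod_cat (PSh A) (PSh A)) pq of (m, n) \<Rightarrow> day_map A m n) =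
      ident (PSh A) (case pq of (p, q) \<Rightarrow> day A p q)"
    by (simp, intro day_arrow_eqI[of A p q _ "day A p q"]) (simp_all add: hom_def)
next
  note [simp] = A
  fix f g assume "f \<in> arrs (prod_cat (PSh A) (PSh A))" "g \<in> arrs (prod_cat (PSh A) (PSh A))"
    "tgt (prod_cat (PSh A) (PSh A)) f = src (prod_cat (PSh A) (PSh A)) g"
  then obtain m n m' n' where "f = (m, n)" "g = (m', n')" "m \<in> arrs (PSh A)" "n \<in> arrs (PSh A)"
    "m' \<in> arrs (PSh A)" "n' \<in> arrs (PSh A)" "tgt (PSh A) m = src (PSh A) m'" "tgt (PSh A) n = src (PSh A) n'"
    by (cases f, cases g) auto
  then show "(case g \<cdot>\<^bsub>prod_cat (PSh A) (PSh A)\<^esub> f of (m, n) \<Rightarrow> day_map A m n) =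
      (case g of (m, n) \<Rightarrow> day_map A m n) \<cdot>\<^bsub>PSh A\<^esub> (case f of (m, n) \<Rightarrow> day_map A m n)"
    by (simp, intro day_arrow_eqI[of A "src (PSh A) m" "src (PSh A) n" _ "day A (tgt (PSh A) m') (tgt (PSh A) n')"])
       (simp_all add: hom_def)
qed (use A in \<open>auto simp: hom_def\<close>)


section \<open>The associator of Day convolution and the pentagon\<close>

definition inverse_in :: "('o, 'a) cat \<Rightarrow> 'a \<Rightarrow> 'a" where
  "inverse_in C f = (SOME g. g \<in> hom C (tgt C f) (src C f) \<and>
     g \<cdot>\<^bsub>C\<^esub> f = ident C (src C f) \<and> f \<cdot>\<^bsub>C\<^esub> g = ident C (tgt C f))"

lemma
  assumes "iso_in C f"
  shows inverse_in_hom: "inverse_in C f \<in> hom C (tgt C f) (src C f)"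
    and inverse_in_left: "inverse_in C f \<cdot>\<^bsub>C\<^esub> f = ident C (src C f)"
    and inverse_in_right: "f \<cdot>\<^bsub>C\<^esub> inverse_in C f = ident C (tgt C f)"
proof -
  have "\<exists>g. g \<in> hom C (tgt C f) (src C f) \<and> g \<cdot>\<^bsub>C\<^esub> f = ident C (src C f) \<and> f \<cdot>\<^bsub>C\<^esub> g = ident C (tgt C f)"
    using assms by (auto simp: iso_in_def)
  from someI_ex[OF this, folded inverse_in_def]
  show "inverse_in C f \<in> hom C (tgt C f) (src C f)" "inverse_in C f \<cdot>\<^bsub>C\<^esub> f = ident C (src C f)"
    "f \<cdot>\<^bsub>C\<^esub> inverse_in C f = ident C (tgt C f)" by blast+
qed

abbreviation asc_inv :: "('o, 'a) algebra \<Rightarrow> 'o \<Rightarrow> 'o \<Rightarrow> 'o \<Rightarrow> 'a" where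
  "asc_inv A x y z \<equiv> inverse_in (fst A) (asc A x y z)"

lemma
  assumes A: "small_monoidal A" and x: "x \<in> objs (fst A)" "y \<in> objs (fst A)" "z \<in> objs (fst A)"
  shows asc_inv_arr[simp]: "asc_inv A x y z \<in> arrs (fst A)"
    and src_asc_inv[simp]: "src (fst A) (asc_inv A x y z) = ten A x (ten A y z)"
    and tgt_asc_inv[simp]: "tgt (fst A) (asc_inv A x y z) = ten A (ten A x y) z"
    and asc_inv_asc[simp]: "asc_inv A x y z \<cdot>\<^bsub>fst A\<^esub> asc A x y z = ident (fst A) (ten A (ten A x y) z)"
    and asc_asc_inv[simp]: "asc A x y z \<cdot>\<^bsub>fst A\<^esub> asc_inv A x y z = ident (fst A) (ten A x (ten A y z))"
  using inverse_in_hom[OF asc_iso[OF A x]] inverse_in_left[OF asc_iso[OF A x]]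
    inverse_in_right[OF asc_iso[OF A x]] A x by (auto simp: hom_def)

lemma asc_inv_natural:
  assumes "small_monoidal A" "f \<in> arrs (fst A)" "g \<in> arrs (fst A)" "h \<in> arrs (fst A)"
  shows "asc_inv A (tgt (fst A) f) (tgt (fst A) g) (tgt (fst A) h) \<cdot>\<^bsub>fst A\<^esub> tar A f (tar A g h) =
    tar A (tar A f g) h \<cdot>\<^bsub>fst A\<^esub> asc_inv A (src (fst A) f) (src (fst A) g) (src (fst A) h)"
  by (rule inverse_square[OF category_fst[OF assms(1)] _ _ _ _ _ _ _ _ asc_natural[OF assms]])
    (use assms in \<open>simp_all add: hom_def\<close>)

definition day_assoc :: "('u::universe, 'u) algebra \<Rightarrow> 'u psh \<Rightarrow> 'u psh \<Rightarrow> 'u psh \<Rightarrow> 'u psh_arrow" where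
  "day_assoc A p q r = (SOME m. m \<in> hom (PSh A) (day A (day A p q) r) (day A p (day A q r)) \<and>
    (\<forall>x\<in>objs (fst A). \<forall>y\<in>objs (fst A). \<forall>z\<in>objs (fst A). \<forall>s\<in>fobj p x. \<forall>t\<in>fobj q y. \<forall>w\<in>fobj r z.
      ap (fst A) m (ten A (ten A x y) z) (gen A (day A p q) r (ten A x y) z (gen A p q x y s t) w) =
      act (fst A) (day A p (day A q r)) (asc A x y z)
        (gen A p (day A q r) x (ten A y z) s (gen A q r y z t w))))"

text \<open>Naturality of the associator of \<open>A\<close>, and of its inverse, is precisely
  trilinearity of the two families that define the arrows in the two directions. On generators the
  composites are restrictions along \<open>asc_inv\<close> composed with \<open>asc\<close>, which
  cancel.\<close>

lemma
  assumes A: "small_monoidal A" and p: "presheaf (fst A) p" and q: "presheaf (fst A) q" and r: "presheaf (fst A) r"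
  shows day_assoc_hom: "day_assoc A p q r \<in> hom (PSh A) (day A (day A p q) r) (day A p (day A q r))"
    and ap_day_assoc[simp]: "x \<in> objs (fst A) \<Longrightarrow> y \<in> objs (fst A) \<Longrightarrow> z \<in> objs (fst A) \<Longrightarrow>
      s \<in> fobj p x \<Longrightarrow> t \<in> fobj q y \<Longrightarrow> w \<in> fobj r z \<Longrightarrow>
      ap (fst A) (day_assoc A p q r) (ten A (ten A x y) z)
        (gen A (day A p q) r (ten A x y) z (gen A p q x y s t) w) =
      act (fst A) (day A p (day A q r)) (asc A x y z)
        (gen A p (day A q r) x (ten A y z) s (gen A q r y z t w))"
    and iso_in_day_assoc: "iso_in (PSh A) (day_assoc A p q r)"
proof -
  note [simp] = A p q r
  let ?L = "\<lambda>x y z s t w. gen A (day A p q) r (ten A x y) z (gen A p q x y s t) w"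
  let ?R = "\<lambda>x y z s t w. gen A p (day A q r) x (ten A y z) s (gen A q r y z t w)"
  let ?P = "\<lambda>m. m \<in> hom (PSh A) (day A (day A p q) r) (day A p (day A q r)) \<and>
    (\<forall>x\<in>objs (fst A). \<forall>y\<in>objs (fst A). \<forall>z\<in>objs (fst A). \<forall>s\<in>fobj p x. \<forall>t\<in>fobj q y. \<forall>w\<in>fobj r z.
      ap (fst A) m (ten A (ten A x y) z) (?L x y z s t w) =
      act (fst A) (day A p (day A q r)) (asc A x y z) (?R x y z s t w))"
  have "\<exists>m. ?P m"
  proof (rule day_day_arrow_exists)
    fix f g h s t w assume "f \<in> arrs (fst A)" "g \<in> arrs (fst A)" "h \<in> arrs (fst A)"
      "s \<in> fobj p (tgt (fst A) f)" "t \<in> fobj q (tgt (fst A) g)" "w \<in> fobj r (tgt (fst A) h)"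
    then show "act (fst A) (day A p (day A q r)) (asc A (src (fst A) f) (src (fst A) g) (src (fst A) h))
          (?R (src (fst A) f) (src (fst A) g) (src (fst A) h) (act (fst A) p f s) (act (fst A) q g t) (act (fst A) r h w)) =
      act (fst A) (day A p (day A q r)) (tar A (tar A f g) h)
        (act (fst A) (day A p (day A q r)) (asc A (tgt (fst A) f) (tgt (fst A) g) (tgt (fst A) h))
          (?R (tgt (fst A) f) (tgt (fst A) g) (tgt (fst A) h) s t w))"
      by (simp add: gen_natural act_act asc_natural)
  qed simp_all
  then have P: "?P (day_assoc A p q r)" unfolding day_assoc_def by (rule someI_ex)
  then show hom: "day_assoc A p q r \<in> hom (PSh A) (day A (day A p q) r) (day A p (day A q r))" by blast
  show ap: "x \<in> objs (fst A) \<Longrightarrow> y \<in> objs (fst A) \<Longrightarrow> z \<in> objs (fst A) \<Longrightarrow>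
      s \<in> fobj p x \<Longrightarrow> t \<in> fobj q y \<Longrightarrow> w \<in> fobj r z \<Longrightarrow>
      ap (fst A) (day_assoc A p q r) (ten A (ten A x y) z) (?L x y z s t w) =
      act (fst A) (day A p (day A q r)) (asc A x y z) (?R x y z s t w)" for x y z s t w
    using P by blast
  have "\<exists>m. m \<in> hom (PSh A) (day A p (day A q r)) (day A (day A p q) r) \<and>
    (\<forall>x\<in>objs (fst A). \<forall>y\<in>objs (fst A). \<forall>z\<in>objs (fst A). \<forall>s\<in>fobj p x. \<forall>t\<in>fobj q y. \<forall>w\<in>fobj r z.
      ap (fst A) m (ten A x (ten A y z)) (?R x y z s t w) =
      act (fst A) (day A (day A p q) r) (asc_inv A x y z) (?L x y z s t w))"
  proof (rule day_day_arrow_exists')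
    fix f g h s t w assume "f \<in> arrs (fst A)" "g \<in> arrs (fst A)" "h \<in> arrs (fst A)"
      "s \<in> fobj p (tgt (fst A) f)" "t \<in> fobj q (tgt (fst A) g)" "w \<in> fobj r (tgt (fst A) h)"
    then show "act (fst A) (day A (day A p q) r) (asc_inv A (src (fst A) f) (src (fst A) g) (src (fst A) h))
          (?L (src (fst A) f) (src (fst A) g) (src (fst A) h) (act (fst A) p f s) (act (fst A) q g t) (act (fst A) r h w)) =
      act (fst A) (day A (day A p q) r) (tar A f (tar A g h))
        (act (fst A) (day A (day A p q) r) (asc_inv A (tgt (fst A) f) (tgt (fst A) g) (tgt (fst A) h))
          (?L (tgt (fst A) f) (tgt (fst A) g) (tgt (fst A) h) s t w))"
      by (simp add: gen_natural act_act asc_inv_natural)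
  qed simp_all
  then obtain m' where m': "m' \<in> hom (PSh A) (day A p (day A q r)) (day A (day A p q) r)"
    and ap_m': "\<And>x y z s t w. x \<in> objs (fst A) \<Longrightarrow> y \<in> objs (fst A) \<Longrightarrow> z \<in> objs (fst A) \<Longrightarrow>
      s \<in> fobj p x \<Longrightarrow> t \<in> fobj q y \<Longrightarrow> w \<in> fobj r z \<Longrightarrow>
      ap (fst A) m' (ten A x (ten A y z)) (?R x y z s t w) =
      act (fst A) (day A (day A p q) r) (asc_inv A x y z) (?L x y z s t w)" by blast
  note hom' = hom_arr[OF hom] hom_src[OF hom] hom_tgt[OF hom] hom_arr[OF m'] hom_src[OF m'] hom_tgt[OF m']
  have "m' \<cdot>\<^bsub>PSh A\<^esub> day_assoc A p q r = ident (PSh A) (day A (day A p q) r)"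
    using hom' by (intro day_day_arrow_eqI[of A p q r _ "day A (day A p q) r"])
      (simp_all add: hom_def ap ap_m' act_act)
  moreover have "day_assoc A p q r \<cdot>\<^bsub>PSh A\<^esub> m' = ident (PSh A) (day A p (day A q r))"
    using hom' by (intro day_day_arrow_eqI'[of A p q r _ "day A p (day A q r)"])
      (simp_all add: hom_def ap ap_m' act_act)
  ultimately show "iso_in (PSh A) (day_assoc A p q r)" by (rule iso_in_presheavesI'[OF hom m'])
qed

lemma
  assumes A: "small_monoidal A" and p: "presheaf (fst A) p" and q: "presheaf (fst A) q" and r: "presheaf (fst A) r"
  shows day_assoc_arr[simp]: "day_assoc A p q r \<in> arrs (PSh A)"
    and src_day_assoc[simp]: "src (PSh A) (day_assoc A p q r) = day A (day A p q) r"
    and tgt_day_assoc[simp]: "tgt (PSh A) (day_assoc A p q r) = day A p (day A q r)"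
  using day_assoc_hom[OF assms] by (auto simp: hom_def)

lemma day_assoc_natural:
  assumes A: "small_monoidal A" and "f \<in> arrs (PSh A)" "g \<in> arrs (PSh A)" "h \<in> arrs (PSh A)"
  shows "day_map A f (day_map A g h) \<cdot>\<^bsub>PSh A\<^esub> day_assoc A (src (PSh A) f) (src (PSh A) g) (src (PSh A) h) =
    day_assoc A (tgt (PSh A) f) (tgt (PSh A) g) (tgt (PSh A) h) \<cdot>\<^bsub>PSh A\<^esub> day_map A (day_map A f g) h"
  using assms
  by (intro day_day_arrow_eqI[of A "src (PSh A) f" "src (PSh A) g" "src (PSh A) h" _
        "day A (tgt (PSh A) f) (day A (tgt (PSh A) g) (tgt (PSh A) h))"])
    (simp_all add: hom_def)

text \<open>Four factors are treated by the threefold principle with \<open>day A p q\<close> as one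
  factor, after which that factor is decomposed once more. On fourfold generators both sides are
  restrictions of one generator along the two sides of the pentagon of \<open>A\<close>.\<close>

lemma day_pentagon:
  assumes A: "small_monoidal A" and p: "presheaf (fst A) p" and q: "presheaf (fst A) q"
    and r: "presheaf (fst A) r" and k: "presheaf (fst A) k"
  shows "day_assoc A p q (day A r k) \<cdot>\<^bsub>PSh A\<^esub> day_assoc A (day A p q) r k =
    day_map A (ident (PSh A) p) (day_assoc A q r k) \<cdot>\<^bsub>PSh A\<^esub> day_assoc A p (day A q r) k \<cdot>\<^bsub>PSh A\<^esub>
      day_map A (day_assoc A p q r) (ident (PSh A) k)"
proof (rule day_day_arrow_eqI)
  note [simp] = assms
  fix a z u v t w assume a: "a \<in> objs (fst A)" and zu: "z \<in> objs (fst A)" "u \<in> objs (fst A)"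
    "t \<in> fobj r z" "w \<in> fobj k u" and v: "v \<in> fobj (day A p q) a"
  let ?l = "day_assoc A p q (day A r k) \<cdot>\<^bsub>PSh A\<^esub> day_assoc A (day A p q) r k"
  let ?r = "day_map A (ident (PSh A) p) (day_assoc A q r k) \<cdot>\<^bsub>PSh A\<^esub> day_assoc A p (day A q r) k \<cdot>\<^bsub>PSh A\<^esub>
      day_map A (day_assoc A p q r) (ident (PSh A) k)"
  \<comment> \<open>The threefold principle leaves \<open>v\<close> arbitrary in
    \<open>day A p q\<close>; it is a restriction along \<open>f\<close> of a generator. The
    equation is proved first for that generator, and then \<open>gen_act_left\<close> and naturality
    carry it back to \<open>v\<close>.\<close>
  obtain x y f s s' where f: "x \<in> objs (fst A)" "y \<in> objs (fst A)" "f \<in> arrs (fst A)" "src (fst A) f = a"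
    "tgt (fst A) f = ten A x y" "s \<in> fobj p x" "s' \<in> fobj q y"
    "v = act (fst A) (day A p q) f (gen A p q x y s s')"
    by (rule day_cases[OF A p q v a])
  let ?g = "gen A (day A (day A p q) r) k (ten A (ten A x y) z) u
     (gen A (day A p q) r (ten A x y) z (gen A p q x y s s') t) w"
  have "ap (fst A) ?l (ten A (ten A (ten A x y) z) u) ?g = ap (fst A) ?r (ten A (ten A (ten A x y) z) u) ?g"
    using zu f(1,2,6,7)
    by (simp add: gen_act_left gen_act_right act_act cmp_assoc pentagon)
  then show "ap (fst A) ?l (ten A (ten A a z) u) (gen A (day A (day A p q) r) k (ten A a z) u (gen A (day A p q) r a z v t) w) =
     ap (fst A) ?r (ten A (ten A a z) u) (gen A (day A (day A p q) r) k (ten A a z) u (gen A (day A p q) r a z v t) w)"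
    using zu f by (simp add: gen_act_left del: ap_cmp)
qed (use assms in \<open>simp_all add: hom_def\<close>)


section \<open>The unitors of Day convolution and the triangle\<close>

abbreviation day_unit :: "('u, 'u) algebra \<Rightarrow> 'u psh" where
  "day_unit A \<equiv> yoneda_obj (fst A) (munit (snd A))"

text \<open>An element \<open>e\<close> of the unit presheaf is an arrow from \<open>x\<close> into
  the unit object. Tensored with the identity of \<open>y\<close> and followed by the left unitor it
  becomes an arrow from \<open>ten A x y\<close> to \<open>y\<close>, along which \<open>t\<close>
  can be restricted.\<close>

definition day_lunitor :: "('u::universe, 'u) algebra \<Rightarrow> 'u psh \<Rightarrow> 'u psh_arrow" where
  "day_lunitor A p = (SOME m. m \<in> hom (PSh A) (day A (day_unit A) p) p \<and>
    (\<forall>x\<in>objs (fst A). \<forall>y\<in>objs (fst A). \<forall>e\<in>fobj (day_unit A) x. \<forall>t\<in>fobj p y.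
      ap (fst A) m (ten A x y) (gen A (day_unit A) p x y e t) =
      act (fst A) p (lunitor (snd A) y \<cdot>\<^bsub>fst A\<^esub> tar A e (ident (fst A) y)) t))"

definition day_runitor :: "('u::universe, 'u) algebra \<Rightarrow> 'u psh \<Rightarrow> 'u psh_arrow" where
  "day_runitor A p = (SOME m. m \<in> hom (PSh A) (day A p (day_unit A)) p \<and>
    (\<forall>x\<in>objs (fst A). \<forall>y\<in>objs (fst A). \<forall>t\<in>fobj p x. \<forall>e\<in>fobj (day_unit A) y.
      ap (fst A) m (ten A x y) (gen A p (day_unit A) x y t e) =
      act (fst A) p (runitor (snd A) x \<cdot>\<^bsub>fst A\<^esub> tar A (ident (fst A) x) e) t))"

text \<open>Bilinearity of the defining family is naturality of the left unitor of \<open>A\<close>.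
  The inverse sends \<open>t\<close> to the restriction of \<open>id\<close> tensor \<open>t\<close>
  along the inverse unitor.\<close>

lemma
  assumes A: "small_monoidal A" and p: "presheaf (fst A) p"
  shows day_lunitor_hom: "day_lunitor A p \<in> hom (PSh A) (day A (day_unit A) p) p"
    and ap_day_lunitor[simp]: "x \<in> objs (fst A) \<Longrightarrow> y \<in> objs (fst A) \<Longrightarrow>
      e \<in> hom (fst A) x (munit (snd A)) \<Longrightarrow> t \<in> fobj p y \<Longrightarrow>
      ap (fst A) (day_lunitor A p) (ten A x y) (gen A (day_unit A) p x y e t) =
      act (fst A) p (lunitor (snd A) y \<cdot>\<^bsub>fst A\<^esub> tar A e (ident (fst A) y)) t"
    and iso_in_day_lunitor: "iso_in (PSh A) (day_lunitor A p)"
proof -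
  note [simp] = A p
  let ?C = "fst A" and ?J = "day_unit A" and ?I = "munit (snd A)"
  let ?l = "lunitor (snd A)" and ?l' = "\<lambda>y. inverse_in (fst A) (lunitor (snd A) y)"
  have l': "?l' y \<in> arrs ?C" "src ?C (?l' y) = y" "tgt ?C (?l' y) = ten A ?I y"
    "?l' y \<cdot>\<^bsub>?C\<^esub> ?l y = ident ?C (ten A ?I y)" "?l y \<cdot>\<^bsub>?C\<^esub> ?l' y = ident ?C y" if "y \<in> objs ?C" for y
    using inverse_in_hom[OF lunitor_iso[OF A that]] inverse_in_left[OF lunitor_iso[OF A that]]
      inverse_in_right[OF lunitor_iso[OF A that]] that by (auto simp: hom_def)
  let ?P = "\<lambda>m. m \<in> hom (PSh A) (day A ?J p) p \<and>
    (\<forall>x\<in>objs ?C. \<forall>y\<in>objs ?C. \<forall>e\<in>fobj ?J x. \<forall>t\<in>fobj p y.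
      ap ?C m (ten A x y) (gen A ?J p x y e t) = act ?C p (?l y \<cdot>\<^bsub>?C\<^esub> tar A e (ident ?C y)) t)"
  have "\<exists>m. ?P m"
  proof (rule day_arrow_exists)
    fix g h e t assume gh: "g \<in> arrs ?C" "h \<in> arrs ?C" and e: "e \<in> fobj ?J (tgt ?C g)"
      and t: "t \<in> fobj p (tgt ?C h)"
    have e': "e \<in> arrs ?C" "src ?C e = tgt ?C g" "tgt ?C e = ?I" using e gh by (auto simp: hom_def)
    have "(h \<cdot>\<^bsub>?C\<^esub> ?l (src ?C h)) \<cdot>\<^bsub>?C\<^esub> tar A (e \<cdot>\<^bsub>?C\<^esub> g) (ident ?C (src ?C h)) =
        ?l (tgt ?C h) \<cdot>\<^bsub>?C\<^esub> tar A (e \<cdot>\<^bsub>?C\<^esub> g) h"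
      using gh e' by (simp add: lunitor_natural cmp_assoc flip: tar_cmp)
    then show "act ?C p (?l (src ?C h) \<cdot>\<^bsub>?C\<^esub> tar A (act ?C ?J g e) (ident ?C (src ?C h))) (act ?C p h t) =
      act ?C p (tar A g h) (act ?C p (?l (tgt ?C h) \<cdot>\<^bsub>?C\<^esub> tar A e (ident ?C (tgt ?C h))) t)"
      using gh e e' t by (simp add: act_act cmp_assoc flip: tar_cmp)
  qed (auto simp: hom_def)
  then have P: "?P (day_lunitor A p)" unfolding day_lunitor_def by (rule someI_ex)
  then show hom: "day_lunitor A p \<in> hom (PSh A) (day A ?J p) p" by blast
  show ap: "x \<in> objs ?C \<Longrightarrow> y \<in> objs ?C \<Longrightarrow> e \<in> hom ?C x ?I \<Longrightarrow> t \<in> fobj p y \<Longrightarrow>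
      ap ?C (day_lunitor A p) (ten A x y) (gen A ?J p x y e t) =
      act ?C p (?l y \<cdot>\<^bsub>?C\<^esub> tar A e (ident ?C y)) t" for x y e t
    using P by simp
  let ?m' = "make_arrow ?C p (day A ?J p) (\<lambda>y t. act ?C (day A ?J p) (?l' y) (gen A ?J p ?I y (ident ?C ?I) t))"
  have m': "?m' \<in> hom (PSh A) p (day A ?J p)"
  proof (rule make_arrow_hom)
    fix f t assume f: "f \<in> arrs ?C" and t: "t \<in> fobj p (tgt ?C f)"
    have "?l' (tgt ?C f) \<cdot>\<^bsub>?C\<^esub> f = tar A (ident ?C ?I) f \<cdot>\<^bsub>?C\<^esub> ?l' (src ?C f)"
      by (rule inverse_square[OF _ _ _ _ _ _ _ _ _ lunitor_natural[OF A f]])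
        (use f l' in \<open>simp_all add: hom_def\<close>)
    then show "act ?C (day A ?J p) (?l' (src ?C f)) (gen A ?J p ?I (src ?C f) (ident ?C ?I) (act ?C p f t)) =
      act ?C (day A ?J p) f (act ?C (day A ?J p) (?l' (tgt ?C f)) (gen A ?J p ?I (tgt ?C f) (ident ?C ?I) t))"
      using f t l' by (simp add: gen_act_right act_act)
  qed (use l' in simp_all)
  note hom' = hom_arr[OF hom] hom_src[OF hom] hom_tgt[OF hom] hom_arr[OF m'] hom_src[OF m'] hom_tgt[OF m']
  show "iso_in (PSh A) (day_lunitor A p)"
  proof (rule iso_in_presheavesI'[OF hom m'])
    show "day_lunitor A p \<cdot>\<^bsub>PSh A\<^esub> ?m' = ident (PSh A) p"
      using hom' l' by (intro presheaf_arrow_eqI[of _ ?C p p]) (simp_all add: hom_def[of "PSh A"] ap act_act)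
    show "?m' \<cdot>\<^bsub>PSh A\<^esub> day_lunitor A p = ident (PSh A) (day A ?J p)"
    proof (rule day_arrow_eqI[of A ?J p _ "day A ?J p"])
      fix x y e t assume x: "x \<in> objs ?C" "y \<in> objs ?C" and e: "e \<in> fobj ?J x" and t: "t \<in> fobj p y"
      have e': "e \<in> hom ?C x ?I" "e \<in> arrs ?C" "src ?C e = x" "tgt ?C e = ?I" using e x by (auto simp: hom_def)
      \<comment> \<open>In the representable, \<open>e\<close> is the restriction of the identity
        along \<open>e\<close> itself; so the generator at \<open>e\<close> is a restriction of the
        generator at \<open>id\<close>, which is the one that the inverse produces.\<close>
      have "act ?C (day A ?J p) (tar A e (ident ?C y)) (gen A ?J p ?I y (ident ?C ?I) t) = gen A ?J p x y e t"
        using e' x t gen_act_left[of A ?J p e y "ident ?C ?I" t x] by simp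
      moreover have "?l' y \<cdot>\<^bsub>?C\<^esub> ?l y \<cdot>\<^bsub>?C\<^esub> tar A e (ident ?C y) = tar A e (ident ?C y)"
        using l'[OF x(2)] e' x by (simp flip: cmp_assoc)
      ultimately show "ap ?C (?m' \<cdot>\<^bsub>PSh A\<^esub> day_lunitor A p) (ten A x y) (gen A ?J p x y e t) =
        ap ?C (ident (PSh A) (day A ?J p)) (ten A x y) (gen A ?J p x y e t)"
        using x e' t hom' l' by (simp add: ap act_act del: ap_make_arrow) (simp add: act_act)
    qed (use hom' in \<open>simp_all add: hom_def[of "PSh A"]\<close>)
  qed
qed

text \<open>The mirror image of the left unitor: the inverse sends \<open>t\<close> to the
  restriction of \<open>t\<close> tensor \<open>id\<close> along the inverse right unitor.\<close>

lemma
  assumes A: "small_monoidal A" and p: "presheaf (fst A) p"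
  shows day_runitor_hom: "day_runitor A p \<in> hom (PSh A) (day A p (day_unit A)) p"
    and ap_day_runitor[simp]: "x \<in> objs (fst A) \<Longrightarrow> y \<in> objs (fst A) \<Longrightarrow>
      t \<in> fobj p x \<Longrightarrow> e \<in> hom (fst A) y (munit (snd A)) \<Longrightarrow>
      ap (fst A) (day_runitor A p) (ten A x y) (gen A p (day_unit A) x y t e) =
      act (fst A) p (runitor (snd A) x \<cdot>\<^bsub>fst A\<^esub> tar A (ident (fst A) x) e) t"
    and iso_in_day_runitor: "iso_in (PSh A) (day_runitor A p)"
proof -
  note [simp] = A p
  let ?C = "fst A" and ?J = "day_unit A" and ?I = "munit (snd A)"
  let ?l = "runitor (snd A)" and ?l' = "\<lambda>y. inverse_in (fst A) (runitor (snd A) y)"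
  have l': "?l' y \<in> arrs ?C" "src ?C (?l' y) = y" "tgt ?C (?l' y) = ten A y ?I"
    "?l' y \<cdot>\<^bsub>?C\<^esub> ?l y = ident ?C (ten A y ?I)" "?l y \<cdot>\<^bsub>?C\<^esub> ?l' y = ident ?C y" if "y \<in> objs ?C" for y
    using inverse_in_hom[OF runitor_iso[OF A that]] inverse_in_left[OF runitor_iso[OF A that]]
      inverse_in_right[OF runitor_iso[OF A that]] that by (auto simp: hom_def)
  let ?P = "\<lambda>m. m \<in> hom (PSh A) (day A p ?J) p \<and>
    (\<forall>x\<in>objs ?C. \<forall>y\<in>objs ?C. \<forall>t\<in>fobj p x. \<forall>e\<in>fobj ?J y.
      ap ?C m (ten A x y) (gen A p ?J x y t e) = act ?C p (?l x \<cdot>\<^bsub>?C\<^esub> tar A (ident ?C x) e) t)"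
  have "\<exists>m. ?P m"
  proof (rule day_arrow_exists)
    fix h g t e assume gh: "h \<in> arrs ?C" "g \<in> arrs ?C" and t: "t \<in> fobj p (tgt ?C h)"
      and e: "e \<in> fobj ?J (tgt ?C g)"
    have e': "e \<in> arrs ?C" "src ?C e = tgt ?C g" "tgt ?C e = ?I" using e gh by (auto simp: hom_def)
    have "(h \<cdot>\<^bsub>?C\<^esub> ?l (src ?C h)) \<cdot>\<^bsub>?C\<^esub> tar A (ident ?C (src ?C h)) (e \<cdot>\<^bsub>?C\<^esub> g) =
        ?l (tgt ?C h) \<cdot>\<^bsub>?C\<^esub> tar A h (e \<cdot>\<^bsub>?C\<^esub> g)"
      using gh e' by (simp add: runitor_natural cmp_assoc flip: tar_cmp)
    then show "act ?C p (?l (src ?C h) \<cdot>\<^bsub>?C\<^esub> tar A (ident ?C (src ?C h)) (act ?C ?J g e)) (act ?C p h t) =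
      act ?C p (tar A h g) (act ?C p (?l (tgt ?C h) \<cdot>\<^bsub>?C\<^esub> tar A (ident ?C (tgt ?C h)) e) t)"
      using gh e e' t by (simp add: act_act cmp_assoc flip: tar_cmp)
  qed (auto simp: hom_def)
  then have P: "?P (day_runitor A p)" unfolding day_runitor_def by (rule someI_ex)
  then show hom: "day_runitor A p \<in> hom (PSh A) (day A p ?J) p" by blast
  show ap: "x \<in> objs ?C \<Longrightarrow> y \<in> objs ?C \<Longrightarrow> t \<in> fobj p x \<Longrightarrow> e \<in> hom ?C y ?I \<Longrightarrow>
      ap ?C (day_runitor A p) (ten A x y) (gen A p ?J x y t e) =
      act ?C p (?l x \<cdot>\<^bsub>?C\<^esub> tar A (ident ?C x) e) t" for x y e t
    using P by simp
  let ?m' = "make_arrow ?C p (day A p ?J) (\<lambda>y t. act ?C (day A p ?J) (?l' y) (gen A p ?J y ?I t (ident ?C ?I)))"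
  have m': "?m' \<in> hom (PSh A) p (day A p ?J)"
  proof (rule make_arrow_hom)
    fix f t assume f: "f \<in> arrs ?C" and t: "t \<in> fobj p (tgt ?C f)"
    have "?l' (tgt ?C f) \<cdot>\<^bsub>?C\<^esub> f = tar A f (ident ?C ?I) \<cdot>\<^bsub>?C\<^esub> ?l' (src ?C f)"
      by (rule inverse_square[OF _ _ _ _ _ _ _ _ _ runitor_natural[OF A f]])
        (use f l' in \<open>simp_all add: hom_def\<close>)
    then show "act ?C (day A p ?J) (?l' (src ?C f)) (gen A p ?J (src ?C f) ?I (act ?C p f t) (ident ?C ?I)) =
      act ?C (day A p ?J) f (act ?C (day A p ?J) (?l' (tgt ?C f)) (gen A p ?J (tgt ?C f) ?I t (ident ?C ?I)))"
      using f t l' by (simp add: gen_act_left act_act)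
  qed (use l' in simp_all)
  note hom' = hom_arr[OF hom] hom_src[OF hom] hom_tgt[OF hom] hom_arr[OF m'] hom_src[OF m'] hom_tgt[OF m']
  show "iso_in (PSh A) (day_runitor A p)"
  proof (rule iso_in_presheavesI'[OF hom m'])
    show "day_runitor A p \<cdot>\<^bsub>PSh A\<^esub> ?m' = ident (PSh A) p"
      using hom' l' by (intro presheaf_arrow_eqI[of _ ?C p p]) (simp_all add: hom_def[of "PSh A"] ap act_act)
    show "?m' \<cdot>\<^bsub>PSh A\<^esub> day_runitor A p = ident (PSh A) (day A p ?J)"
    proof (rule day_arrow_eqI[of A p ?J _ "day A p ?J"])
      fix x y t e assume x: "x \<in> objs ?C" "y \<in> objs ?C" and t: "t \<in> fobj p x" and e: "e \<in> fobj ?J y"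
      have e': "e \<in> hom ?C y ?I" "e \<in> arrs ?C" "src ?C e = y" "tgt ?C e = ?I" using e x by (auto simp: hom_def)
      have "act ?C (day A p ?J) (tar A (ident ?C x) e) (gen A p ?J x ?I t (ident ?C ?I)) = gen A p ?J x y t e"
        using e' x t gen_act_right[of A p ?J e x t "ident ?C ?I" y] by simp
      moreover have "?l' x \<cdot>\<^bsub>?C\<^esub> ?l x \<cdot>\<^bsub>?C\<^esub> tar A (ident ?C x) e = tar A (ident ?C x) e"
        using l'[OF x(1)] e' x by (simp flip: cmp_assoc)
      ultimately show "ap ?C (?m' \<cdot>\<^bsub>PSh A\<^esub> day_runitor A p) (ten A x y) (gen A p ?J x y t e) =
        ap ?C (ident (PSh A) (day A p ?J)) (ten A x y) (gen A p ?J x y t e)"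
        using x e' t hom' l' by (simp add: ap act_act del: ap_make_arrow) (simp add: act_act)
    qed (use hom' in \<open>simp_all add: hom_def[of "PSh A"]\<close>)
  qed
qed

lemma
  assumes A: "small_monoidal A" and p: "presheaf (fst A) p"
  shows day_lunitor_arr[simp]: "day_lunitor A p \<in> arrs (PSh A)"
    and src_day_lunitor[simp]: "src (PSh A) (day_lunitor A p) = day A (day_unit A) p"
    and tgt_day_lunitor[simp]: "tgt (PSh A) (day_lunitor A p) = p"
    and day_runitor_arr[simp]: "day_runitor A p \<in> arrs (PSh A)"
    and src_day_runitor[simp]: "src (PSh A) (day_runitor A p) = day A p (day_unit A)"
    and tgt_day_runitor[simp]: "tgt (PSh A) (day_runitor A p) = p"
  using day_lunitor_hom[OF assms] day_runitor_hom[OF assms] by (auto simp: hom_def)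

lemma day_lunitor_natural:
  assumes A: "small_monoidal A" and f: "f \<in> arrs (PSh A)"
  shows "f \<cdot>\<^bsub>PSh A\<^esub> day_lunitor A (src (PSh A) f) =
    day_lunitor A (tgt (PSh A) f) \<cdot>\<^bsub>PSh A\<^esub> day_map A (ident (PSh A) (day_unit A)) f"
  using assms
  by (intro day_arrow_eqI[of A "day_unit A" "src (PSh A) f" _ "tgt (PSh A) f"])
    (auto simp: hom_def)

lemma day_runitor_natural:
  assumes A: "small_monoidal A" and f: "f \<in> arrs (PSh A)"
  shows "f \<cdot>\<^bsub>PSh A\<^esub> day_runitor A (src (PSh A) f) =
    day_runitor A (tgt (PSh A) f) \<cdot>\<^bsub>PSh A\<^esub> day_map A f (ident (PSh A) (day_unit A))"
  using assms
  by (intro day_arrow_eqI[of A "src (PSh A) f" "day_unit A" _ "tgt (PSh A) f"])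
    (auto simp: hom_def)

text \<open>On a generator both sides restrict \<open>s\<close> tensor \<open>w\<close>. The arrows
  along which they restrict involve \<open>e\<close>, which is an arrow into the unit object rather
  than the unit itself.\<close>

lemma day_triangle:
  assumes A: "small_monoidal A" and p: "presheaf (fst A) p" and q: "presheaf (fst A) q"
  shows "day_map A (ident (PSh A) p) (day_lunitor A q) \<cdot>\<^bsub>PSh A\<^esub> day_assoc A p (day_unit A) q =
    day_map A (day_runitor A p) (ident (PSh A) q)"
proof (rule day_day_arrow_eqI[of A p "day_unit A" q _ "day A p q"])
  note [simp] = assms
  let ?C = "fst A" and ?I = "munit (snd A)"
  fix x y z s e w assume x: "x \<in> objs ?C" "y \<in> objs ?C" "z \<in> objs ?C" and s: "s \<in> fobj p x"
    and e: "e \<in> fobj (day_unit A) y" and w: "w \<in> fobj q z"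
  have e': "e \<in> hom ?C y ?I" "e \<in> arrs ?C" "src ?C e = y" "tgt ?C e = ?I" using e x by (auto simp: hom_def)
  have 1: "tar A (ident ?C x) (tar A e (ident ?C z)) \<cdot>\<^bsub>?C\<^esub> asc A x y z =
      asc A x ?I z \<cdot>\<^bsub>?C\<^esub> tar A (tar A (ident ?C x) e) (ident ?C z)"
    using asc_natural[of A "ident ?C x" e "ident ?C z"] e' x by simp
  have 2: "tar A (ident ?C x) (lunitor (snd A) z \<cdot>\<^bsub>?C\<^esub> tar A e (ident ?C z)) =
      tar A (ident ?C x) (lunitor (snd A) z) \<cdot>\<^bsub>?C\<^esub> tar A (ident ?C x) (tar A e (ident ?C z))"
    using tar_cmp[of A "ident ?C x" "ident ?C x" "tar A e (ident ?C z)" "lunitor (snd A) z"] e' x by simp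
  have 3: "tar A (runitor (snd A) x \<cdot>\<^bsub>?C\<^esub> tar A (ident ?C x) e) (ident ?C z) =
      tar A (runitor (snd A) x) (ident ?C z) \<cdot>\<^bsub>?C\<^esub> tar A (tar A (ident ?C x) e) (ident ?C z)"
    using tar_cmp[of A "tar A (ident ?C x) e" "runitor (snd A) x" "ident ?C z" "ident ?C z"] e' x by simp
  \<comment> \<open>Naturality of the associator at \<open>e\<close> moves the comparison to the
    unit object, where the triangle of \<open>A\<close> applies.\<close>
  have 4: "tar A (ident ?C x) (lunitor (snd A) z \<cdot>\<^bsub>?C\<^esub> tar A e (ident ?C z)) \<cdot>\<^bsub>?C\<^esub> asc A x y z =
      tar A (runitor (snd A) x \<cdot>\<^bsub>?C\<^esub> tar A (ident ?C x) e) (ident ?C z)"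
  proof -
    have "tar A (ident ?C x) (lunitor (snd A) z \<cdot>\<^bsub>?C\<^esub> tar A e (ident ?C z)) \<cdot>\<^bsub>?C\<^esub> asc A x y z =
      (tar A (ident ?C x) (lunitor (snd A) z) \<cdot>\<^bsub>?C\<^esub> asc A x ?I z) \<cdot>\<^bsub>?C\<^esub> tar A (tar A (ident ?C x) e) (ident ?C z)"
      using e' x by (simp add: 1 2 cmp_assoc)
    then show ?thesis using x e' by (simp add: triangle 3)
  qed
  show "ap ?C (day_map A (ident (PSh A) p) (day_lunitor A q) \<cdot>\<^bsub>PSh A\<^esub> day_assoc A p (day_unit A) q)
      (ten A (ten A x y) z)
      (gen A (day A p (day_unit A)) q (ten A x y) z (gen A p (day_unit A) x y s e) w) =
    ap ?C (day_map A (day_runitor A p) (ident (PSh A) q)) (ten A (ten A x y) z)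
      (gen A (day A p (day_unit A)) q (ten A x y) z (gen A p (day_unit A) x y s e) w)"
    using x s e' w by (simp add: gen_act_left gen_act_right act_act 4)
qed (use assms in \<open>simp_all add: hom_def[of "PSh A"]\<close>)

section \<open>The symmetry of Day convolution and the hexagon\<close>

definition small_symmetric :: "('u::universe, 'u) algebra \<Rightarrow> bool" where
  "small_symmetric A \<longleftrightarrow> small_monoidal A \<and> symmetry (snd A) \<noteq> None \<and>
     symmetric_structure A (the (symmetry (snd A)))"

abbreviation swp :: "('o, 'a) algebra \<Rightarrow> 'o \<Rightarrow> 'o \<Rightarrow> 'a" where
  "swp A x y \<equiv> the (symmetry (snd A)) (x, y)"

lemma small_symmetric_monoidal[simp]: "small_symmetric A \<Longrightarrow> small_monoidal A"
  by (simp add: small_symmetric_def)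

lemma
  assumes A: "small_symmetric (A :: ('u::universe, 'u) algebra)"
  shows swp_arr[simp]: "x \<in> objs (fst A) \<Longrightarrow> y \<in> objs (fst A) \<Longrightarrow> swp A x y \<in> arrs (fst A)"
    and src_swp[simp]: "x \<in> objs (fst A) \<Longrightarrow> y \<in> objs (fst A) \<Longrightarrow> src (fst A) (swp A x y) = ten A x y"
    and tgt_swp[simp]: "x \<in> objs (fst A) \<Longrightarrow> y \<in> objs (fst A) \<Longrightarrow> tgt (fst A) (swp A x y) = ten A y x"
    and swp_natural: "f \<in> arrs (fst A) \<Longrightarrow> g \<in> arrs (fst A) \<Longrightarrow>
      tar A g f \<cdot>\<^bsub>fst A\<^esub> swp A (src (fst A) f) (src (fst A) g) =
      swp A (tgt (fst A) f) (tgt (fst A) g) \<cdot>\<^bsub>fst A\<^esub> tar A f g"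
    and swp_swp[simp]: "x \<in> objs (fst A) \<Longrightarrow> y \<in> objs (fst A) \<Longrightarrow>
      swp A y x \<cdot>\<^bsub>fst A\<^esub> swp A x y = ident (fst A) (ten A x y)"
    and hexagon: "x \<in> objs (fst A) \<Longrightarrow> y \<in> objs (fst A) \<Longrightarrow> z \<in> objs (fst A) \<Longrightarrow>
      asc A y z x \<cdot>\<^bsub>fst A\<^esub> swp A x (ten A y z) \<cdot>\<^bsub>fst A\<^esub> asc A x y z =
      tar A (ident (fst A) y) (swp A x z) \<cdot>\<^bsub>fst A\<^esub> asc A y x z \<cdot>\<^bsub>fst A\<^esub> tar A (swp A x y) (ident (fst A) z)"
proof -
  obtain C M where AM: "A = (C, M)" by (cases A)
  have s: "symmetric_structure (C, M) (the (symmetry M))" using A AM by (simp add: small_symmetric_def)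
  have n: "nat_iso (prod_cat C C) C (tensor M)
     (make_functor (prod_cat C C) (\<lambda>(x, y). tensor_obj M y x) (\<lambda>(f, g). tensor_arr M g f)) (the (symmetry M))"
    using s by (simp add: symmetric_structure_def Let_def)
  show "x \<in> objs (fst A) \<Longrightarrow> y \<in> objs (fst A) \<Longrightarrow> swp A x y \<in> arrs (fst A)"
    "x \<in> objs (fst A) \<Longrightarrow> y \<in> objs (fst A) \<Longrightarrow> src (fst A) (swp A x y) = ten A x y"
    "x \<in> objs (fst A) \<Longrightarrow> y \<in> objs (fst A) \<Longrightarrow> tgt (fst A) (swp A x y) = ten A y x"
    using nat_isoD(1)[OF n, of "(x, y)"] by (auto simp: AM hom_def)
  show "f \<in> arrs (fst A) \<Longrightarrow> g \<in> arrs (fst A) \<Longrightarrow>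
      tar A g f \<cdot>\<^bsub>fst A\<^esub> swp A (src (fst A) f) (src (fst A) g) =
      swp A (tgt (fst A) f) (tgt (fst A) g) \<cdot>\<^bsub>fst A\<^esub> tar A f g"
    using nat_isoD(2)[OF n, of "(f, g)"] by (simp add: AM)
  show "x \<in> objs (fst A) \<Longrightarrow> y \<in> objs (fst A) \<Longrightarrow>
      swp A y x \<cdot>\<^bsub>fst A\<^esub> swp A x y = ident (fst A) (ten A x y)"
    "x \<in> objs (fst A) \<Longrightarrow> y \<in> objs (fst A) \<Longrightarrow> z \<in> objs (fst A) \<Longrightarrow>
      asc A y z x \<cdot>\<^bsub>fst A\<^esub> swp A x (ten A y z) \<cdot>\<^bsub>fst A\<^esub> asc A x y z =
      tar A (ident (fst A) y) (swp A x z) \<cdot>\<^bsub>fst A\<^esub> asc A y x z \<cdot>\<^bsub>fst A\<^esub> tar A (swp A x y) (ident (fst A) z)"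
    using s by (simp_all add: AM symmetric_structure_def Let_def)
qed

definition day_swap :: "('u::universe, 'u) algebra \<Rightarrow> 'u psh \<Rightarrow> 'u psh \<Rightarrow> 'u psh_arrow" where
  "day_swap A p q = (SOME m. m \<in> hom (PSh A) (day A p q) (day A q p) \<and>
    (\<forall>x\<in>objs (fst A). \<forall>y\<in>objs (fst A). \<forall>s\<in>fobj p x. \<forall>t\<in>fobj q y.
      ap (fst A) m (ten A x y) (gen A p q x y s t) =
      act (fst A) (day A q p) (swp A x y) (gen A q p y x t s)))"

lemma
  assumes A: "small_symmetric A" and p: "presheaf (fst A) p" and q: "presheaf (fst A) q"
  shows day_swap_hom: "day_swap A p q \<in> hom (PSh A) (day A p q) (day A q p)"
    and ap_day_swap[simp]: "x \<in> objs (fst A) \<Longrightarrow> y \<in> objs (fst A) \<Longrightarrow> s \<in> fobj p x \<Longrightarrow> t \<in> fobj q y \<Longrightarrow>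
      ap (fst A) (day_swap A p q) (ten A x y) (gen A p q x y s t) =
      act (fst A) (day A q p) (swp A x y) (gen A q p y x t s)"
proof -
  let ?P = "\<lambda>m. m \<in> hom (PSh A) (day A p q) (day A q p) \<and>
    (\<forall>x\<in>objs (fst A). \<forall>y\<in>objs (fst A). \<forall>s\<in>fobj p x. \<forall>t\<in>fobj q y.
      ap (fst A) m (ten A x y) (gen A p q x y s t) =
      act (fst A) (day A q p) (swp A x y) (gen A q p y x t s))"
  have "\<exists>m. ?P m"
    using A p q by (intro day_arrow_exists) (simp_all add: gen_natural act_act swp_natural)
  then have "?P (day_swap A p q)" unfolding day_swap_def by (rule someI_ex)
  then show "day_swap A p q \<in> hom (PSh A) (day A p q) (day A q p)"
    "x \<in> objs (fst A) \<Longrightarrow> y \<in> objs (fst A) \<Longrightarrow> s \<in> fobj p x \<Longrightarrow> t \<in> fobj q y \<Longrightarrow>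
      ap (fst A) (day_swap A p q) (ten A x y) (gen A p q x y s t) =
      act (fst A) (day A q p) (swp A x y) (gen A q p y x t s)" by blast+
qed

lemma
  assumes A: "small_symmetric A" and p: "presheaf (fst A) p" and q: "presheaf (fst A) q"
  shows day_swap_arr[simp]: "day_swap A p q \<in> arrs (PSh A)"
    and src_day_swap[simp]: "src (PSh A) (day_swap A p q) = day A p q"
    and tgt_day_swap[simp]: "tgt (PSh A) (day_swap A p q) = day A q p"
  using day_swap_hom[OF assms] by (auto simp: hom_def)

lemma day_swap_natural:
  assumes A: "small_symmetric A" and "f \<in> arrs (PSh A)" "g \<in> arrs (PSh A)"
  shows "day_map A g f \<cdot>\<^bsub>PSh A\<^esub> day_swap A (src (PSh A) f) (src (PSh A) g) =
    day_swap A (tgt (PSh A) f) (tgt (PSh A) g) \<cdot>\<^bsub>PSh A\<^esub> day_map A f g"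
  using assms
  by (intro day_arrow_eqI[of A "src (PSh A) f" "src (PSh A) g" _ "day A (tgt (PSh A) g) (tgt (PSh A) f)"])
    (simp_all add: hom_def)

lemma day_swap_swap:
  assumes A: "small_symmetric A" and p: "presheaf (fst A) p" and q: "presheaf (fst A) q"
  shows "day_swap A q p \<cdot>\<^bsub>PSh A\<^esub> day_swap A p q = ident (PSh A) (day A p q)"
  using assms
  by (intro day_arrow_eqI[of A p q _ "day A p q"]) (simp_all add: hom_def act_act)

lemma iso_in_day_swap:
  assumes A: "small_symmetric A" and p: "presheaf (fst A) p" and q: "presheaf (fst A) q"
  shows "iso_in (PSh A) (day_swap A p q)"
  by (rule iso_in_presheavesI'[OF day_swap_hom[OF assms] day_swap_hom[OF A q p]
      day_swap_swap[OF assms] day_swap_swap[OF A q p]])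

text \<open>On \<open>(s tensor t) tensor w\<close> both sides are restrictions of
  \<open>t tensor (w tensor s)\<close>, along the two sides of the hexagon of
  \<open>A\<close>.\<close>

lemma day_hexagon:
  assumes A: "small_symmetric A" and p: "presheaf (fst A) p" and q: "presheaf (fst A) q"
    and r: "presheaf (fst A) r"
  shows "day_assoc A q r p \<cdot>\<^bsub>PSh A\<^esub> day_swap A p (day A q r) \<cdot>\<^bsub>PSh A\<^esub> day_assoc A p q r =
    day_map A (ident (PSh A) q) (day_swap A p r) \<cdot>\<^bsub>PSh A\<^esub> day_assoc A q p r \<cdot>\<^bsub>PSh A\<^esub>
      day_map A (day_swap A p q) (ident (PSh A) r)"
  using assms
  by (intro day_day_arrow_eqI[of A p q r _ "day A q (day A r p)"])
    (simp_all add: hom_def gen_act_left gen_act_right act_act cmp_assoc hexagon)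

section \<open>The algebra of presheaves\<close>

text \<open>The cells are cut down to presheaves because \<open>nat_trans\<close> demands
  extensional families. The symmetry is present exactly when \<open>A\<close> has one, so that the
  doctrine of \<open>A\<close> is inherited.\<close>

definition day_structure :: "('u::universe, 'u) algebra \<Rightarrow> ('u psh, 'u psh_arrow) algebra_structure" where
  "day_structure A = (let Ob = objs (PSh A) in
     \<lparr>tensor = day_tensor A, munit = day_unit A,
      associator = (\<lambda>(p, q, r)\<in>Ob \<times> Ob \<times> Ob. day_assoc A p q r),
      lunitor = (\<lambda>p\<in>Ob. day_lunitor A p), runitor = (\<lambda>p\<in>Ob. day_runitor A p),
      symmetry = map_option (\<lambda>_. \<lambda>(p, q)\<in>Ob \<times> Ob. day_swap A p q) (symmetry (snd A))\<rparr>)"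

lemma day_structure_simps[simp]:
  "tensor (day_structure A) = day_tensor A"
  "munit (day_structure A) = day_unit A"
  "presheaf (fst A) p \<Longrightarrow> presheaf (fst A) q \<Longrightarrow> fobj (day_tensor A) (p, q) = day A p q"
  "m \<in> arrs (PSh A) \<Longrightarrow> n \<in> arrs (PSh A) \<Longrightarrow> farr (day_tensor A) (m, n) = day_map A m n"
  "presheaf (fst A) p \<Longrightarrow> presheaf (fst A) q \<Longrightarrow> presheaf (fst A) r \<Longrightarrow>
    associator (day_structure A) (p, q, r) = day_assoc A p q r"
  "presheaf (fst A) p \<Longrightarrow> lunitor (day_structure A) p = day_lunitor A p"
  "presheaf (fst A) p \<Longrightarrow> runitor (day_structure A) p = day_runitor A p"
  "symmetry (day_structure A) = None \<longleftrightarrow> symmetry (snd A) = None"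
  by (simp_all add: day_structure_def day_tensor_def Let_def)

lemma symmetry_day_structure[simp]:
  "symmetry (snd A) \<noteq> None \<Longrightarrow> presheaf (fst A) p \<Longrightarrow> presheaf (fst A) q \<Longrightarrow>
    the (symmetry (day_structure A)) (p, q) = day_swap A p q"
  by (auto simp: day_structure_def Let_def)

lemma is_functor_ternary_tensor:
  assumes C: "category C" and T: "is_functor (prod_cat C C) C T"
  shows "is_functor (prod_cat C (prod_cat C C)) C (make_functor (prod_cat C (prod_cat C C))
      (\<lambda>(x, y, z). fobj T (fobj T (x, y), z)) (\<lambda>(f, g, h). farr T (farr T (f, g), h)))"
    and "is_functor (prod_cat C (prod_cat C C)) C (make_functor (prod_cat C (prod_cat C C))
      (\<lambda>(x, y, z). fobj T (x, fobj T (y, z))) (\<lambda>(f, g, h). farr T (f, farr T (g, h))))"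
proof -
  have t: "fobj T (x, y) \<in> objs C" if "x \<in> objs C" "y \<in> objs C" for x y
    using fobj_mem[OF T, of "(x, y)"] that by simp
  have a: "farr T (f, g) \<in> arrs C" "src C (farr T (f, g)) = fobj T (src C f, src C g)"
    "tgt C (farr T (f, g)) = fobj T (tgt C f, tgt C g)" if "f \<in> arrs C" "g \<in> arrs C" for f g
    using functor_simps(2-4)[OF T, of "(f, g)"] that by simp_all
  have i: "farr T (ident C x, ident C y) = ident C (fobj T (x, y))" if "x \<in> objs C" "y \<in> objs C" for x y
    using farr_ident[OF T, of "(x, y)"] that by simp
  have c: "farr T (g \<cdot>\<^bsub>C\<^esub> f, g' \<cdot>\<^bsub>C\<^esub> f') = farr T (g, g') \<cdot>\<^bsub>C\<^esub> farr T (f, f')"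
    if "f \<in> arrs C" "g \<in> arrs C" "tgt C f = src C g" "f' \<in> arrs C" "g' \<in> arrs C" "tgt C f' = src C g'"
    for f g f' g'
    using farr_cmp[OF T, of "(f, f')" "(g, g')"] that by simp
  show "is_functor (prod_cat C (prod_cat C C)) C (make_functor (prod_cat C (prod_cat C C))
      (\<lambda>(x, y, z). fobj T (fobj T (x, y), z)) (\<lambda>(f, g, h). farr T (farr T (f, g), h)))"
    using C by (intro is_functor_make_functor) (auto simp: hom_def t a i c)
  show "is_functor (prod_cat C (prod_cat C C)) C (make_functor (prod_cat C (prod_cat C C))
      (\<lambda>(x, y, z). fobj T (x, fobj T (y, z))) (\<lambda>(f, g, h). farr T (f, farr T (g, h))))"
    using C by (intro is_functor_make_functor) (auto simp: hom_def t a i c)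
qed

lemma is_functor_unit_tensor:
  assumes C: "category C" and T: "is_functor (prod_cat C C) C T" and i: "i \<in> objs C"
  shows "is_functor C C (make_functor C (\<lambda>x. fobj T (i, x)) (\<lambda>f. farr T (ident C i, f)))"
    and "is_functor C C (make_functor C (\<lambda>x. fobj T (x, i)) (\<lambda>f. farr T (f, ident C i)))"
proof -
  have t: "fobj T (x, y) \<in> objs C" if "x \<in> objs C" "y \<in> objs C" for x y
    using fobj_mem[OF T, of "(x, y)"] that by simp
  have a: "farr T (f, g) \<in> arrs C" "src C (farr T (f, g)) = fobj T (src C f, src C g)"
    "tgt C (farr T (f, g)) = fobj T (tgt C f, tgt C g)" if "f \<in> arrs C" "g \<in> arrs C" for f g
    using functor_simps(2-4)[OF T, of "(f, g)"] that by simp_all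
  have id: "farr T (ident C x, ident C y) = ident C (fobj T (x, y))" if "x \<in> objs C" "y \<in> objs C" for x y
    using farr_ident[OF T, of "(x, y)"] that by simp
  show "is_functor C C (make_functor C (\<lambda>x. fobj T (i, x)) (\<lambda>f. farr T (ident C i, f)))"
    using C i farr_cmp[OF T, of "(ident C i, _)" "(ident C i, _)"]
    by (intro is_functor_make_functor) (auto simp: hom_def t a id)
  show "is_functor C C (make_functor C (\<lambda>x. fobj T (x, i)) (\<lambda>f. farr T (f, ident C i)))"
    using C i farr_cmp[OF T, of "(_, ident C i)" "(_, ident C i)"]
    by (intro is_functor_make_functor) (auto simp: hom_def t a id)
qed

lemma monoidal_category_day:
  assumes A: "small_monoidal A"
  shows "monoidal_category (PSh A, day_structure A)"
proof -
  note [simp] = A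
  let ?P = "PSh A"
  let ?ob = "\<lambda>p q. fobj (day_tensor A) (p, q)" and ?ar = "\<lambda>f g. farr (day_tensor A) (f, g)"
  note T = is_functor_day_tensor[OF A]
  have P: "category ?P" by simp
  have "nat_iso (prod_cat ?P (prod_cat ?P ?P)) ?P
      (make_functor (prod_cat ?P (prod_cat ?P ?P))
         (\<lambda>(x, y, z). ?ob (?ob x y) z) (\<lambda>(f, g, h). ?ar (?ar f g) h))
      (make_functor (prod_cat ?P (prod_cat ?P ?P))
         (\<lambda>(x, y, z). ?ob x (?ob y z)) (\<lambda>(f, g, h). ?ar f (?ar g h)))
      (associator (day_structure A))"
    unfolding nat_iso_def nat_trans_def
    using is_functor_ternary_tensor[OF P T]
    by (auto simp: day_assoc_hom iso_in_day_assoc day_assoc_natural)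
      (auto simp: day_structure_def Let_def)
  moreover have "nat_iso ?P ?P (make_functor ?P (\<lambda>x. ?ob (day_unit A) x) (\<lambda>f. ?ar (ident ?P (day_unit A)) f))
      (id_functor ?P) (lunitor (day_structure A))"
    unfolding nat_iso_def nat_trans_def
    using is_functor_unit_tensor(1)[OF P T, of "day_unit A"] is_functor_id_functor[OF P]
    by (auto simp: day_lunitor_hom iso_in_day_lunitor day_lunitor_natural)
      (auto simp: day_structure_def Let_def)
  moreover have "nat_iso ?P ?P (make_functor ?P (\<lambda>x. ?ob x (day_unit A)) (\<lambda>f. ?ar f (ident ?P (day_unit A))))
      (id_functor ?P) (runitor (day_structure A))"
    unfolding nat_iso_def nat_trans_def
    using is_functor_unit_tensor(2)[OF P T, of "day_unit A"] is_functor_id_functor[OF P]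
    by (auto simp: day_runitor_hom iso_in_day_runitor day_runitor_natural)
      (auto simp: day_structure_def Let_def)
  ultimately show ?thesis
    unfolding monoidal_category_def Let_def
    using T by (simp add: day_pentagon day_triangle)
qed

lemma symmetric_structure_day:
  assumes A: "small_symmetric A"
  shows "symmetric_structure (PSh A, day_structure A) (the (symmetry (day_structure A)))"
proof -
  note [simp] = A
  have s: "symmetry (snd A) \<noteq> None" using A by (simp add: small_symmetric_def)
  let ?P = "PSh A"
  note T = is_functor_day_tensor[OF small_symmetric_monoidal[OF A]]
  have "is_functor (prod_cat ?P ?P) ?P (make_functor (prod_cat ?P ?P)
      (\<lambda>(x, y). fobj (day_tensor A) (y, x)) (\<lambda>(f, g). farr (day_tensor A) (g, f)))"
    using farr_cmp[OF T] farr_ident[OF T, of "(_, _)"]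
    by (intro is_functor_make_functor) (force simp: hom_def)+
  then have "nat_iso (prod_cat ?P ?P) ?P (day_tensor A) (make_functor (prod_cat ?P ?P)
      (\<lambda>(x, y). fobj (day_tensor A) (y, x)) (\<lambda>(f, g). farr (day_tensor A) (g, f)))
      (the (symmetry (day_structure A)))"
    unfolding nat_iso_def nat_trans_def
    using T s
    by (auto simp: day_swap_hom iso_in_day_swap day_swap_natural)
      (auto simp: day_structure_def Let_def)
  then show ?thesis
    unfolding symmetric_structure_def Let_def
    using s by (simp add: day_swap_swap day_hexagon)
qed

text \<open>If the unit object is terminal, the representable at it has one element everywhere,
  namely the unique arrow \<open>e x\<close>, and a presheaf of singletons is terminal.\<close>

lemma is_terminal_day_unit:
  assumes A: "small_monoidal A" and t: "is_terminal (fst A) (munit (snd A))"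
  shows "is_terminal (PSh A) (day_unit A)"
proof -
  note [simp] = A
  define e where "e x = (THE f. f \<in> hom (fst A) x (munit (snd A)))" for x
  have e: "e x \<in> hom (fst A) x (munit (snd A))" if "x \<in> objs (fst A)" for x
    unfolding e_def by (rule theI') (use t that in \<open>simp add: is_terminal_def\<close>)
  have u: "f = g" if "f \<in> hom (fst A) x (munit (snd A))" "g \<in> hom (fst A) x (munit (snd A))" "x \<in> objs (fst A)" for f g x
    using t that by (auto simp: is_terminal_def)
  have "\<exists>!m. m \<in> hom (PSh A) p (day_unit A)" if p: "presheaf (fst A) p" for p
  proof (rule ex1I)
    show "make_arrow (fst A) p (day_unit A) (\<lambda>x _. e x) \<in> hom (PSh A) p (day_unit A)"
    proof (rule make_arrow_hom)
      fix f t assume f: "f \<in> arrs (fst A)"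
      show "e (src (fst A) f) = act (fst A) (day_unit A) f (e (tgt (fst A) f))"
        using f e[of "src (fst A) f"] e[of "tgt (fst A) f"]
        by (intro u[of _ "src (fst A) f"]) (auto simp: hom_def)
    qed (use p e in simp_all)
    then show "m = make_arrow (fst A) p (day_unit A) (\<lambda>x _. e x)" if "m \<in> hom (PSh A) p (day_unit A)" for m
      using that by (intro presheaf_arrow_eqI[OF that]) (auto intro!: u dest: hom_presheavesD(6) simp: e)
  qed
  then show ?thesis by (simp add: is_terminal_def)
qed

lemma strict_algebra_day:
  fixes A :: "('u::universe, 'u) algebra"
  assumes A: "small_strict_algebra S A"
  shows "strict_algebra TYPE('u) S (PSh A, day_structure A)"
proof -
  have sa: "strict_algebra TYPE('u) S A" and sc: "small_category TYPE('u) (fst A)"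
    using A by (auto simp: small_strict_algebra_def)
  have m: "small_monoidal A" using sa sc by (simp add: small_monoidal_def strict_algebra_def)
  have sy: "case symmetry (snd A) of None \<Rightarrow> \<not> symmetric_doctrine S
      | Some s \<Rightarrow> symmetric_doctrine S \<and> symmetric_structure A s" using sa by (simp add: strict_algebra_def)
  have "case symmetry (day_structure A) of None \<Rightarrow> \<not> symmetric_doctrine S
      | Some s \<Rightarrow> symmetric_doctrine S \<and> symmetric_structure (PSh A, day_structure A) s"
  proof (cases "symmetry (snd A)")
    case None
    then show ?thesis using sy by (simp add: day_structure_def Let_def)
  next
    case (Some s)
    then have "small_symmetric A" using sy m by (simp add: small_symmetric_def)
    then have s': "symmetric_structure (PSh A, day_structure A) (the (symmetry (day_structure A)))"
      by (rule symmetric_structure_day)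
    have "symmetry (day_structure A) \<noteq> None" using Some by simp
    then obtain s'' where "symmetry (day_structure A) = Some s''" by blast
    then show ?thesis using Some sy s' by simp
  qed
  then show ?thesis
    unfolding strict_algebra_def
    using sa sc m locally_small_presheaves[OF sc] monoidal_category_day[OF m] is_terminal_day_unit[OF m]
    by (simp add: strict_algebra_def)
qed

section \<open>Monoidal structure of Kan extensions\<close>

text \<open>For fixed \<open>t\<close> the generators \<open>[s, t]\<close> form an arrow from
  \<open>F(x)\<close> to \<open>F*(p)\<close>, the coprojection at \<open>t\<close> of the colimit
  that \<open>F*(p)\<close> is. It replaces formulas on elements where \<open>s\<close> cannot be
  written out.\<close>

definition kel_arrow :: "('u, 'u) cat \<Rightarrow> ('u, 'u) cat \<Rightarrow> 'u pdiagram \<Rightarrow> 'u psh \<Rightarrow> 'u \<Rightarrow> 'u \<Rightarrow> 'u psh_arrow" where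
  "kel_arrow X Y F p x t = make_arrow Y (fobj F x) (kan_obj X Y F p) (\<lambda>y s. kel X F p y x s t)"

lemma
  assumes F: "diagram X Y F" and p: "presheaf X p" and x: "x \<in> objs X" and t: "t \<in> fobj p x"
  shows kel_arrow_arr[simp]: "kel_arrow X Y F p x t \<in> arrs (presheaves Y)"
    and src_kel_arrow[simp]: "src (presheaves Y) (kel_arrow X Y F p x t) = fobj F x"
    and tgt_kel_arrow[simp]: "tgt (presheaves Y) (kel_arrow X Y F p x t) = kan_obj X Y F p"
    and ap_kel_arrow[simp]: "y \<in> objs Y \<Longrightarrow> s \<in> fobj (fobj F x) y \<Longrightarrow>
      ap Y (kel_arrow X Y F p x t) y s = kel X F p y x s t"
proof -
  have "kel_arrow X Y F p x t \<in> hom (presheaves Y) (fobj F x) (kan_obj X Y F p)"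
    unfolding kel_arrow_def using assms diagram_cats[OF F] by (intro make_arrow_hom) simp_all
  then show "kel_arrow X Y F p x t \<in> arrs (presheaves Y)"
    "src (presheaves Y) (kel_arrow X Y F p x t) = fobj F x"
    "tgt (presheaves Y) (kel_arrow X Y F p x t) = kan_obj X Y F p"
    "y \<in> objs Y \<Longrightarrow> s \<in> fobj (fobj F x) y \<Longrightarrow> ap Y (kel_arrow X Y F p x t) y s = kel X F p y x s t"
    by (auto simp: hom_def kel_arrow_def)
qed

text \<open>The coend relation, read as the cocone condition on the coprojections.\<close>

lemma kel_arrow_act:
  assumes F: "diagram X Y F" and p: "presheaf X p" and f: "f \<in> arrs X" and t: "t \<in> fobj p (tgt X f)"
  shows "kel_arrow X Y F p (src X f) (act X p f t) = kel_arrow X Y F p (tgt X f) t \<cdot>\<^bsub>presheaves Y\<^esub> farr F f"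
  using assms diagram_cats[OF F]
  by (intro presheaf_arrow_eqI[of _ Y "fobj F (src X f)" "kan_obj X Y F p"])
    (simp_all add: hom_def kel_dinatural[where Y=Y])

text \<open>Bilinear families on Kan extensions may be given on pairs of generators
  \<open>[s, t]\<close> and \<open>[s', t']\<close>, provided that they respect the coend relation
  in both factors; this is how the tensor cell of \<open>F*\<close> is defined.\<close>

lemma day_kan_arrow_exists:
  fixes X :: "('u::universe, 'u) cat" and B :: "('u, 'u) algebra"
  defines "Y \<equiv> fst B"
  assumes B: "small_monoidal B" and F: "diagram X Y F" and F': "diagram X' Y F'"
    and p: "presheaf X p" and q: "presheaf X' q" and k: "presheaf Y k"
    and mem: "\<And>y y' x x' s s' t t'. y \<in> objs Y \<Longrightarrow> y' \<in> objs Y \<Longrightarrow> x \<in> objs X \<Longrightarrow> x' \<in> objs X' \<Longrightarrow>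
      s \<in> fobj (fobj F x) y \<Longrightarrow> s' \<in> fobj (fobj F' x') y' \<Longrightarrow> t \<in> fobj p x \<Longrightarrow> t' \<in> fobj q x' \<Longrightarrow>
      T y y' x x' s s' t t' \<in> fobj k (ten B y y')"
    and nat: "\<And>g g' x x' s s' t t'. g \<in> arrs Y \<Longrightarrow> g' \<in> arrs Y \<Longrightarrow> x \<in> objs X \<Longrightarrow> x' \<in> objs X' \<Longrightarrow>
      s \<in> fobj (fobj F x) (tgt Y g) \<Longrightarrow> s' \<in> fobj (fobj F' x') (tgt Y g') \<Longrightarrow> t \<in> fobj p x \<Longrightarrow> t' \<in> fobj q x' \<Longrightarrow>
      T (src Y g) (src Y g') x x' (act Y (fobj F x) g s) (act Y (fobj F' x') g' s') t t' =
      act Y k (tar B g g') (T (tgt Y g) (tgt Y g') x x' s s' t t')"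
    and dinat: "\<And>y y' f f' s s' t t'. y \<in> objs Y \<Longrightarrow> y' \<in> objs Y \<Longrightarrow> f \<in> arrs X \<Longrightarrow> f' \<in> arrs X' \<Longrightarrow>
      s \<in> fobj (fobj F (src X f)) y \<Longrightarrow> s' \<in> fobj (fobj F' (src X' f')) y' \<Longrightarrow>
      t \<in> fobj p (tgt X f) \<Longrightarrow> t' \<in> fobj q (tgt X' f') \<Longrightarrow>
      T y y' (src X f) (src X' f') s s' (act X p f t) (act X' q f' t') =
      T y y' (tgt X f) (tgt X' f') (ap Y (farr F f) y s) (ap Y (farr F' f') y' s') t t'"
  shows "\<exists>m. m \<in> hom (presheaves Y) (day B (kan_obj X Y F p) (kan_obj X' Y F' q)) k \<and>
    (\<forall>y\<in>objs Y. \<forall>y'\<in>objs Y. \<forall>x\<in>objs X. \<forall>x'\<in>objs X'. \<forall>s\<in>fobj (fobj F x) y. \<forall>s'\<in>fobj (fobj F' x') y'.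
      \<forall>t\<in>fobj p x. \<forall>t'\<in>fobj q x'.
      ap Y m (ten B y y') (gen B (kan_obj X Y F p) (kan_obj X' Y F' q) y y'
        (kel X F p y x s t) (kel X' F' q y' x' s' t')) = T y y' x x' s s' t t')"
proof -
  note [simp] = diagram_cats[OF F] diagram_cats[OF F']
  let ?K = "kan_obj X Y F p" and ?K' = "kan_obj X' Y F' q"
  have K: "presheaf (fst B) ?K" "presheaf (fst B) ?K'" "presheaf (fst B) k"
    using F F' p q k by (simp_all add: Y_def)
  have L2: "klift (\<lambda>x' s' t'. T y y' x x' s s' t t') (kel X' F' q y' x' s' t') = T y y' x x' s s' t t'"
    if "y \<in> objs Y" "y' \<in> objs Y" "x \<in> objs X" "s \<in> fobj (fobj F x) y" "t \<in> fobj p x"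
    for y y' x x' s s' t t'
  proof (rule klift_kel[where Y=Y])
    fix f s' t' assume "f \<in> arrs X'" "s' \<in> fobj (fobj F' (src X' f)) y'" "t' \<in> fobj q (tgt X' f)"
    then show "T y y' x (src X' f) s s' t (act X' q f t') = T y y' x (tgt X' f) s (ap Y (farr F' f) y' s') t t'"
      using dinat[of y y' "ident X x" f s s' t t'] that F p by simp
  qed
  let ?H = "\<lambda>y y' v v'. klift (\<lambda>x s t. klift (\<lambda>x' s' t'. T y y' x x' s s' t t') v') v"
  \<comment> \<open>The second argument \<open>v'\<close> stays arbitrary while the first is lifted;
    it is decomposed only inside the check of the relation in the first factor, where
    \<open>L2\<close> evaluates the inner lift.\<close>
  have L1: "?H y y' (kel X F p y x s t) v' = klift (\<lambda>x' s' t'. T y y' x x' s s' t t') v'"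
    if y: "y \<in> objs Y" "y' \<in> objs Y" and v': "v' \<in> fobj ?K' y'" for y y' x s t v'
  proof (rule klift_kel[where Y=Y])
    fix f s t assume f: "f \<in> arrs X" "s \<in> fobj (fobj F (src X f)) y" "t \<in> fobj p (tgt X f)"
    obtain x' s' t' where x': "x' \<in> objs X'" "s' \<in> fobj (fobj F' x') y'" "t' \<in> fobj q x'"
      "v' = kel X' F' q y' x' s' t'"
      by (rule kan_obj_cases[OF v' y(2)])
    show "klift (\<lambda>x' s' t'. T y y' (src X f) x' s s' (act X p f t) t') v' =
        klift (\<lambda>x' s' t'. T y y' (tgt X f) x' (ap Y (farr F f) y s) s' t t') v'"
      using f x' y F F' p q dinat[of y y' f "ident X' x'" s s' t t'] by (simp add: L2)
  qed
  have L: "?H y y' (kel X F p y x s t) (kel X' F' q y' x' s' t') = T y y' x x' s s' t t'"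
    if "y \<in> objs Y" "y' \<in> objs Y" "x \<in> objs X" "x' \<in> objs X'" "s \<in> fobj (fobj F x) y" "s' \<in> fobj (fobj F' x') y'"
      "t \<in> fobj p x" "t' \<in> fobj q x'" for y y' x x' s s' t t'
    using that by (simp add: L1 L2)
  have "\<exists>m. m \<in> hom (presheaves (fst B)) (day B ?K ?K') k \<and>
    (\<forall>y\<in>objs (fst B). \<forall>y'\<in>objs (fst B). \<forall>v\<in>fobj ?K y. \<forall>v'\<in>fobj ?K' y'.
      ap (fst B) m (ten B y y') (gen B ?K ?K' y y' v v') = ?H y y' v v')"
  proof (rule day_arrow_exists[OF B K], fold Y_def)
    fix y y' v v' assume y: "y \<in> objs Y" "y' \<in> objs Y" and v: "v \<in> fobj ?K y" "v' \<in> fobj ?K' y'"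
    show "?H y y' v v' \<in> fobj k (ten B y y')"
      by (rule kan_obj_cases[OF v(1) y(1)], rule kan_obj_cases[OF v(2) y(2)]) (use y in \<open>simp add: L mem\<close>)
  next
    fix g g' v v' assume g: "g \<in> arrs Y" "g' \<in> arrs Y" and v: "v \<in> fobj ?K (tgt Y g)" "v' \<in> fobj ?K' (tgt Y g')"
    show "?H (src Y g) (src Y g') (act Y ?K g v) (act Y ?K' g' v') = act Y k (tar B g g') (?H (tgt Y g) (tgt Y g') v v')"
      by (rule kan_obj_cases[OF v(1)], use g in simp, rule kan_obj_cases[OF v(2)], use g in simp)
        (use g F F' p q in \<open>simp add: L nat\<close>)
  qed
  then show ?thesis unfolding Y_def[symmetric] by (elim ex_forward) (simp add: L)
qed

text \<open>Used for the inverse of the tensor cell of \<open>F*\<close>: an arrow out of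
  \<open>F*\<close> of a Day convolution is prescribed on the classes
  \<open>[s, t tensor t']\<close> only.\<close>

lemma kan_day_arrow_exists:
  fixes A :: "('u::universe, 'u) algebra" and Y :: "('u, 'u) cat"
  defines "X \<equiv> fst A"
  assumes A: "small_monoidal A" and F: "diagram X Y F"
    and p: "presheaf X p" and q: "presheaf X q" and k: "presheaf Y k"
    and mem: "\<And>y x x' s t t'. y \<in> objs Y \<Longrightarrow> x \<in> objs X \<Longrightarrow> x' \<in> objs X \<Longrightarrow>
      s \<in> fobj (fobj F (ten A x x')) y \<Longrightarrow> t \<in> fobj p x \<Longrightarrow> t' \<in> fobj q x' \<Longrightarrow> H y x x' s t t' \<in> fobj k y"
    and nat: "\<And>g x x' s t t'. g \<in> arrs Y \<Longrightarrow> x \<in> objs X \<Longrightarrow> x' \<in> objs X \<Longrightarrow>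
      s \<in> fobj (fobj F (ten A x x')) (tgt Y g) \<Longrightarrow> t \<in> fobj p x \<Longrightarrow> t' \<in> fobj q x' \<Longrightarrow>
      H (src Y g) x x' (act Y (fobj F (ten A x x')) g s) t t' = act Y k g (H (tgt Y g) x x' s t t')"
    and dinat: "\<And>y f f' s t t'. y \<in> objs Y \<Longrightarrow> f \<in> arrs X \<Longrightarrow> f' \<in> arrs X \<Longrightarrow>
      s \<in> fobj (fobj F (ten A (src X f) (src X f'))) y \<Longrightarrow> t \<in> fobj p (tgt X f) \<Longrightarrow> t' \<in> fobj q (tgt X f') \<Longrightarrow>
      H y (src X f) (src X f') s (act X p f t) (act X q f' t') =
      H y (tgt X f) (tgt X f') (ap Y (farr F (tar A f f')) y s) t t'"
  shows "\<exists>m. m \<in> hom (presheaves Y) (kan_obj X Y F (day A p q)) k \<and>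
    (\<forall>y\<in>objs Y. \<forall>x\<in>objs X. \<forall>x'\<in>objs X. \<forall>s\<in>fobj (fobj F (ten A x x')) y. \<forall>t\<in>fobj p x. \<forall>t'\<in>fobj q x'.
      ap Y m y (kel X F (day A p q) y (ten A x x') s (gen A p q x x' t t')) = H y x x' s t t')"
proof -
  note [simp] = diagram_cats[OF F] small_monoidal_simps[OF A p[unfolded X_def] q[unfolded X_def], folded X_def]
    tensor_simps[OF A p[unfolded X_def] q[unfolded X_def], folded X_def]
    presheaf_day[OF A p[unfolded X_def] q[unfolded X_def], folded X_def]
    gen_mem[OF A p[unfolded X_def] q[unfolded X_def], folded X_def]
  note day_cases' = day_cases[OF A p[unfolded X_def] q[unfolded X_def], folded X_def]
  \<comment> \<open>If \<open>w\<close> is the restriction of \<open>t\<close> tensor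
    \<open>t'\<close> along \<open>g\<close>, the coend relation identifies \<open>[s, w]\<close>
    with \<open>[F(g)(s), t tensor t']\<close>, where \<open>H\<close> is available.\<close>
  let ?K = "\<lambda>y z s w. day_lift (\<lambda>x x' g t t'. H y x x' (ap Y (farr F g) y s) t t') w"
  have L: "?K y z s (act X (day A p q) g (gen A p q x x' t t')) = H y x x' (ap Y (farr F g) y s) t t'"
    if "y \<in> objs Y" "g \<in> arrs X" "src X g = z" "tgt X g = ten A x x'" "x \<in> objs X" "x' \<in> objs X"
      "s \<in> fobj (fobj F z) y" "t \<in> fobj p x" "t' \<in> fobj q x'" for y z g x x' s t t'
    using that F
    by (intro day_lift_gen[OF A p[unfolded X_def] q[unfolded X_def], folded X_def, of z]) (simp_all add: dinat)
  have L': "?K y (ten A x x') s (gen A p q x x' t t') = H y x x' s t t'"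
    if "y \<in> objs Y" "x \<in> objs X" "x' \<in> objs X" "s \<in> fobj (fobj F (ten A x x')) y" "t \<in> fobj p x" "t' \<in> fobj q x'"
    for y x x' s t t'
    using L[of y "ident X (ten A x x')" "ten A x x'" x x' s t t'] that F by simp
  have "\<exists>m\<in>hom (presheaves Y) (kan_obj X Y F (day A p q)) k. \<forall>y\<in>objs Y. \<forall>z\<in>objs X.
    \<forall>s\<in>fobj (fobj F z) y. \<forall>w\<in>fobj (day A p q) z. ap Y m y (kel X F (day A p q) y z s w) = ?K y z s w"
  proof (rule kan_arrow_exists[OF F _ k])
    fix y z s w assume y: "y \<in> objs Y" and z: "z \<in> objs X" and s: "s \<in> fobj (fobj F z) y" and w: "w \<in> fobj (day A p q) z"
    show "?K y z s w \<in> fobj k y"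
      by (rule day_cases'[OF w z]) (use y s F in \<open>simp add: L[of _ _ z] mem\<close>)
  next
    fix g z s w assume g: "g \<in> arrs Y" and z: "z \<in> objs X" and s: "s \<in> fobj (fobj F z) (tgt Y g)" and w: "w \<in> fobj (day A p q) z"
    show "?K (src Y g) z (act Y (fobj F z) g s) w = act Y k g (?K (tgt Y g) z s w)"
      by (rule day_cases'[OF w z]) (use g s z F in \<open>simp add: L[of _ _ z] nat\<close>)
  next
    fix f y s w assume f: "f \<in> arrs X" and y: "y \<in> objs Y" and s: "s \<in> fobj (fobj F (src X f)) y"
      and w: "w \<in> fobj (day A p q) (tgt X f)"
    show "?K y (src X f) s (act X (day A p q) f w) = ?K y (tgt X f) (ap Y (farr F f) y s) w"
      by (rule day_cases'[OF w cat_tgt[OF _ f]]) (use f y s F in \<open>simp_all add: act_act L[of _ _ "tgt X f"] L[of _ _ "src X f"]\<close>)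
  qed simp
  then obtain m where "m \<in> hom (presheaves Y) (kan_obj X Y F (day A p q)) k"
    "\<forall>y\<in>objs Y. \<forall>z\<in>objs X. \<forall>s\<in>fobj (fobj F z) y. \<forall>w\<in>fobj (day A p q) z.
      ap Y m y (kel X F (day A p q) y z s w) = ?K y z s w" by (rule bexE)
  then show ?thesis by (intro exI[of _ m]) (simp add: L')
qed

text \<open>By the coend relation along \<open>g\<close>, a restriction of \<open>t\<close> tensor
  \<open>t'\<close> in the second entry can be exchanged for \<open>F(g)\<close> on the first, so
  the classes \<open>[s, t tensor t']\<close> exhaust the Kan extension.\<close>

lemma kan_day_arrow_eqI:
  fixes A :: "('u::universe, 'u) algebra" and Y :: "('u, 'u) cat"
  defines "X \<equiv> fst A"
  assumes A: "small_monoidal A" and F: "diagram X Y F" and p: "presheaf X p" and q: "presheaf X q"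
    and m: "m \<in> hom (presheaves Y) (kan_obj X Y F (day A p q)) k"
    and m': "m' \<in> hom (presheaves Y) (kan_obj X Y F (day A p q)) k"
    and eq: "\<And>y x x' s t t'. y \<in> objs Y \<Longrightarrow> x \<in> objs X \<Longrightarrow> x' \<in> objs X \<Longrightarrow>
      s \<in> fobj (fobj F (ten A x x')) y \<Longrightarrow> t \<in> fobj p x \<Longrightarrow> t' \<in> fobj q x' \<Longrightarrow>
      ap Y m y (kel X F (day A p q) y (ten A x x') s (gen A p q x x' t t')) =
      ap Y m' y (kel X F (day A p q) y (ten A x x') s (gen A p q x x' t t'))"
  shows "m = m'"
proof (rule kan_arrow_eqI[OF m m'])
  note [simp] = small_monoidal_simps[OF A p[unfolded X_def] q[unfolded X_def], folded X_def]
    gen_mem[OF A p[unfolded X_def] q[unfolded X_def], folded X_def]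
  fix y z s w assume y: "y \<in> objs Y" and z: "z \<in> objs X" and s: "s \<in> fobj (fobj F z) y" and w: "w \<in> fobj (day A p q) z"
  obtain x x' g t t' where g: "x \<in> objs X" "x' \<in> objs X" "g \<in> arrs X" "src X g = z" "tgt X g = ten A x x'"
    "t \<in> fobj p x" "t' \<in> fobj q x'" and w: "w = act X (day A p q) g (gen A p q x x' t t')"
    using day_cases[OF A p[unfolded X_def] q[unfolded X_def], folded X_def, OF w z] by metis
  have "kel X F (day A p q) y z s w = kel X F (day A p q) y (ten A x x') (ap Y (farr F g) y s) (gen A p q x x' t t')"
    using kel_dinatural[of g X s F y "gen A p q x x' t t'" "day A p q" Y] g s w by simp
  then show "ap Y m y (kel X F (day A p q) y z s w) = ap Y m' y (kel X F (day A p q) y z s w)"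
    using eq[of y x x' "ap Y (farr F g) y s" t t'] y g s F by simp
qed

text \<open>The part of a pseudomorphism structure on \<open>F\<close> that the cells of \<open>F\<^sup>*\<close> are built from.\<close>

definition tensor_diagram ::
    "('u, 'u) algebra \<Rightarrow> ('u::universe, 'u) algebra \<Rightarrow> 'u pdiagram \<Rightarrow> ('u \<times> 'u \<Rightarrow> 'u psh_arrow) \<Rightarrow> bool" where
  "tensor_diagram A B F c \<longleftrightarrow> small_monoidal A \<and> small_monoidal B \<and> diagram (fst A) (fst B) F \<and>
     (\<forall>x\<in>objs (fst A). \<forall>y\<in>objs (fst A). c (x, y) \<in> hom (PSh B) (day B (fobj F x) (fobj F y)) (fobj F (ten A x y))) \<and>
     (\<forall>f\<in>arrs (fst A). \<forall>g\<in>arrs (fst A). farr F (tar A f g) \<cdot>\<^bsub>PSh B\<^esub> c (src (fst A) f, src (fst A) g) =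
        c (tgt (fst A) f, tgt (fst A) g) \<cdot>\<^bsub>PSh B\<^esub> day_map B (farr F f) (farr F g))"

lemma
  assumes T: "tensor_diagram A B F c"
  shows tensor_diagram_monoidal: "small_monoidal A" "small_monoidal B"
    and tensor_diagram_diagram: "diagram (fst A) (fst B) F"
    and tensor_cell_arr: "x \<in> objs (fst A) \<Longrightarrow> y \<in> objs (fst A) \<Longrightarrow> c (x, y) \<in> arrs (PSh B)"
    and tensor_cell_src: "x \<in> objs (fst A) \<Longrightarrow> y \<in> objs (fst A) \<Longrightarrow>
      src (PSh B) (c (x, y)) = day B (fobj F x) (fobj F y)"
    and tensor_cell_tgt: "x \<in> objs (fst A) \<Longrightarrow> y \<in> objs (fst A) \<Longrightarrow>
      tgt (PSh B) (c (x, y)) = fobj F (ten A x y)"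
    and tensor_cell_natural: "f \<in> arrs (fst A) \<Longrightarrow> g \<in> arrs (fst A) \<Longrightarrow>
      farr F (tar A f g) \<cdot>\<^bsub>PSh B\<^esub> c (src (fst A) f, src (fst A) g) =
        c (tgt (fst A) f, tgt (fst A) g) \<cdot>\<^bsub>PSh B\<^esub> day_map B (farr F f) (farr F g)"
  using T by (auto simp: tensor_diagram_def hom_def)

lemmas tensor_diagram_simps = tensor_diagram_monoidal
  tensor_cell_arr tensor_cell_src tensor_cell_tgt

lemma ap_tensor_cell_natural:
  assumes T: "tensor_diagram A B F c" and f: "f \<in> arrs (fst A)" "g \<in> arrs (fst A)"
    and y: "y \<in> objs (fst B)" and v: "v \<in> fobj (day B (fobj F (src (fst A) f)) (fobj F (src (fst A) g))) y"
  shows "ap (fst B) (farr F (tar A f g)) y (ap (fst B) (c (src (fst A) f, src (fst A) g)) y v) =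
    ap (fst B) (c (tgt (fst A) f, tgt (fst A) g)) y (ap (fst B) (day_map B (farr F f) (farr F g)) y v)"
proof -
  note [simp] = tensor_diagram_simps[OF T]
  have "ap (fst B) (farr F (tar A f g) \<cdot>\<^bsub>PSh B\<^esub> c (src (fst A) f, src (fst A) g)) y v =
    ap (fst B) (c (tgt (fst A) f, tgt (fst A) g) \<cdot>\<^bsub>PSh B\<^esub> day_map B (farr F f) (farr F g)) y v"
    using tensor_cell_natural[OF T f] tensor_diagram_diagram[OF T] by simp
  then show ?thesis using f y v tensor_diagram_diagram[OF T] by simp
qed

definition kan_tensor :: "('u::universe, 'u) algebra \<Rightarrow> ('u, 'u) algebra \<Rightarrow> 'u pdiagram \<Rightarrow>
    ('u \<times> 'u \<Rightarrow> 'u psh_arrow) \<Rightarrow> 'u psh \<Rightarrow> 'u psh \<Rightarrow> 'u psh_arrow" where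
  "kan_tensor A B F c p q = (let X = fst A; Y = fst B; K = kan_obj X Y F in
     SOME m. m \<in> hom (presheaves Y) (day B (K p) (K q)) (K (day A p q)) \<and>
     (\<forall>y\<in>objs Y. \<forall>y'\<in>objs Y. \<forall>x\<in>objs X. \<forall>x'\<in>objs X. \<forall>s\<in>fobj (fobj F x) y. \<forall>s'\<in>fobj (fobj F x') y'.
      \<forall>t\<in>fobj p x. \<forall>t'\<in>fobj q x'.
      ap Y m (ten B y y') (gen B (K p) (K q) y y' (kel X F p y x s t) (kel X F q y' x' s' t')) =
      kel X F (day A p q) (ten B y y') (ten A x x')
        (ap Y (c (x, x')) (ten B y y') (gen B (fobj F x) (fobj F x') y y' s s'))
        (gen A p q x x' t t')))"

context
  fixes A B :: "('u::universe, 'u) algebra" and F c p q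
  assumes T: "tensor_diagram A B F c" and p: "presheaf (fst A) p" and q: "presheaf (fst A) q"
begin

private lemma facts: "small_monoidal A" "small_monoidal B" "diagram (fst A) (fst B) F"
    "presheaf (fst A) p" "presheaf (fst A) q"
  using tensor_diagram_simps[OF T] tensor_diagram_diagram[OF T] p q by auto

text \<open>The formula is well defined because moving \<open>t\<close> and \<open>t'\<close> along
  \<open>f\<close> and \<open>f'\<close> moves \<open>t tensor t'\<close> along
  \<open>tar A f f'\<close>, while naturality of \<open>c\<close> performs the matching move on the
  first entry.\<close>

private lemma kan_tensor_spec:
  "kan_tensor A B F c p q \<in> hom (PSh B)
     (day B (kan_obj (fst A) (fst B) F p) (kan_obj (fst A) (fst B) F q)) (kan_obj (fst A) (fst B) F (day A p q)) \<and>
   (\<forall>y\<in>objs (fst B). \<forall>y'\<in>objs (fst B). \<forall>x\<in>objs (fst A). \<forall>x'\<in>objs (fst A).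
      \<forall>s\<in>fobj (fobj F x) y. \<forall>s'\<in>fobj (fobj F x') y'. \<forall>t\<in>fobj p x. \<forall>t'\<in>fobj q x'.
      ap (fst B) (kan_tensor A B F c p q) (ten B y y')
        (gen B (kan_obj (fst A) (fst B) F p) (kan_obj (fst A) (fst B) F q) y y'
          (kel (fst A) F p y x s t) (kel (fst A) F q y' x' s' t')) =
      kel (fst A) F (day A p q) (ten B y y') (ten A x x')
        (ap (fst B) (c (x, x')) (ten B y y') (gen B (fobj F x) (fobj F x') y y' s s'))
        (gen A p q x x' t t'))"
  unfolding kan_tensor_def Let_def
proof (rule someI_ex, rule day_kan_arrow_exists)
  note [simp] = facts(1,2,4,5) tensor_diagram_simps[OF T]
  fix y y' f f' s s' t t'
  assume a: "y \<in> objs (fst B)" "y' \<in> objs (fst B)" "f \<in> arrs (fst A)" "f' \<in> arrs (fst A)"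
    "s \<in> fobj (fobj F (src (fst A) f)) y" "s' \<in> fobj (fobj F (src (fst A) f')) y'"
    "t \<in> fobj p (tgt (fst A) f)" "t' \<in> fobj q (tgt (fst A) f')"
  show "kel (fst A) F (day A p q) (ten B y y') (ten A (src (fst A) f) (src (fst A) f'))
        (ap (fst B) (c (src (fst A) f, src (fst A) f')) (ten B y y')
          (gen B (fobj F (src (fst A) f)) (fobj F (src (fst A) f')) y y' s s'))
        (gen A p q (src (fst A) f) (src (fst A) f') (act (fst A) p f t) (act (fst A) q f' t')) =
      kel (fst A) F (day A p q) (ten B y y') (ten A (tgt (fst A) f) (tgt (fst A) f'))
        (ap (fst B) (c (tgt (fst A) f, tgt (fst A) f')) (ten B y y')
          (gen B (fobj F (tgt (fst A) f)) (fobj F (tgt (fst A) f')) y y'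
            (ap (fst B) (farr F f) y s) (ap (fst B) (farr F f') y' s')))
        (gen A p q (tgt (fst A) f) (tgt (fst A) f') t t')"
  proof -
    let ?v = "ap (fst B) (c (src (fst A) f, src (fst A) f')) (ten B y y')
      (gen B (fobj F (src (fst A) f)) (fobj F (src (fst A) f')) y y' s s')"
    have v: "?v \<in> fobj (fobj F (src (fst A) (tar A f f'))) (ten B y y')"
      using a facts(3) by simp
    have t: "gen A p q (tgt (fst A) f) (tgt (fst A) f') t t' \<in> fobj (day A p q) (tgt (fst A) (tar A f f'))"
      using a by simp
    \<comment> \<open>The coend relation of \<open>F*\<close> at \<open>day A p q\<close>, taken
      along the arrow \<open>tar A f f'\<close>.\<close>
    have "kel (fst A) F (day A p q) (ten B y y') (src (fst A) (tar A f f')) ?v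
        (act (fst A) (day A p q) (tar A f f') (gen A p q (tgt (fst A) f) (tgt (fst A) f') t t')) =
      kel (fst A) F (day A p q) (ten B y y') (tgt (fst A) (tar A f f'))
        (ap (fst B) (farr F (tar A f f')) (ten B y y') ?v) (gen A p q (tgt (fst A) f) (tgt (fst A) f') t t')"
      using a by (intro kel_dinatural v t) simp
    then show ?thesis
      using a facts(3) by (simp add: gen_natural ap_tensor_cell_natural[OF T])
  qed
qed (use facts tensor_diagram_simps[OF T] in \<open>simp_all add: gen_natural\<close>)

lemmas kan_tensor_hom = kan_tensor_spec[THEN conjunct1]

lemma ap_kan_tensor:
  "y \<in> objs (fst B) \<Longrightarrow> y' \<in> objs (fst B) \<Longrightarrow> x \<in> objs (fst A) \<Longrightarrow> x' \<in> objs (fst A) \<Longrightarrow>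
    s \<in> fobj (fobj F x) y \<Longrightarrow> s' \<in> fobj (fobj F x') y' \<Longrightarrow> t \<in> fobj p x \<Longrightarrow> t' \<in> fobj q x' \<Longrightarrow>
    ap (fst B) (kan_tensor A B F c p q) (ten B y y')
      (gen B (kan_obj (fst A) (fst B) F p) (kan_obj (fst A) (fst B) F q) y y'
        (kel (fst A) F p y x s t) (kel (fst A) F q y' x' s' t')) =
    kel (fst A) F (day A p q) (ten B y y') (ten A x x')
      (ap (fst B) (c (x, x')) (ten B y y') (gen B (fobj F x) (fobj F x') y y' s s'))
      (gen A p q x x' t t')"
  using kan_tensor_spec by blast

lemma kan_tensor_arr: "kan_tensor A B F c p q \<in> arrs (PSh B)"
  and src_kan_tensor: "src (PSh B) (kan_tensor A B F c p q) =
    day B (kan_obj (fst A) (fst B) F p) (kan_obj (fst A) (fst B) F q)"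
  and tgt_kan_tensor: "tgt (PSh B) (kan_tensor A B F c p q) = kan_obj (fst A) (fst B) F (day A p q)"
  using kan_tensor_hom by (auto simp: hom_def)

text \<open>The inverse should send \<open>[s, t tensor t']\<close> to the pair obtained by
  splitting \<open>s\<close> along the inverse of \<open>c\<close> and attaching \<open>t\<close>
  and \<open>t'\<close> to the pieces. That preimage of \<open>s\<close> is an arbitrary element of
  a Day convolution, so the attaching is done by the arrow \<open>?l\<close>, a tensor product of
  two coprojections.\<close>

lemma iso_in_kan_tensor:
  assumes iso: "\<And>x y. x \<in> objs (fst A) \<Longrightarrow> y \<in> objs (fst A) \<Longrightarrow> iso_in (PSh B) (c (x, y))"
  shows "iso_in (PSh B) (kan_tensor A B F c p q)"
proof -
  note [simp] = facts(1,2,4,5) tensor_diagram_simps[OF T] kan_tensor_arr src_kan_tensor tgt_kan_tensor ap_kan_tensor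
  let ?X = "fst A" and ?Y = "fst B" and ?K = "kan_obj (fst A) (fst B) F"
  define d where "d x x' = inverse_in (PSh B) (c (x, x'))" for x x'
  have d[simp]: "d x x' \<in> arrs (PSh B)" "src (PSh B) (d x x') = fobj F (ten A x x')"
      "tgt (PSh B) (d x x') = day B (fobj F x) (fobj F x')"
      "d x x' \<cdot>\<^bsub>PSh B\<^esub> c (x, x') = ident (PSh B) (day B (fobj F x) (fobj F x'))"
      "c (x, x') \<cdot>\<^bsub>PSh B\<^esub> d x x' = ident (PSh B) (fobj F (ten A x x'))"
    if "x \<in> objs ?X" "x' \<in> objs ?X" for x x'
    using inverse_in_hom[OF iso[OF that]] inverse_in_left[OF iso[OF that]] inverse_in_right[OF iso[OF that]] that
    by (simp_all add: d_def hom_def)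
  have dc: "ap ?Y (d x x') y (ap ?Y (c (x, x')) y v) = v"
    if "x \<in> objs ?X" "x' \<in> objs ?X" "y \<in> objs ?Y" "v \<in> fobj (day B (fobj F x) (fobj F x')) y" for x x' y v
    using ap_cmp[of "c (x, x')" ?Y "d x x'" y v] that by simp
  have cd: "ap ?Y (c (x, x')) y (ap ?Y (d x x') y v) = v"
    if "x \<in> objs ?X" "x' \<in> objs ?X" "y \<in> objs ?Y" "v \<in> fobj (fobj F (ten A x x')) y" for x x' y v
    using ap_cmp[of "d x x'" ?Y "c (x, x')" y v] that by simp
  have nat: "d (tgt ?X f) (tgt ?X f') \<cdot>\<^bsub>PSh B\<^esub> farr F (tar A f f') =
      day_map B (farr F f) (farr F f') \<cdot>\<^bsub>PSh B\<^esub> d (src ?X f) (src ?X f')"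
    if f: "f \<in> arrs ?X" "f' \<in> arrs ?X" for f f'
    by (rule inverse_square[OF _ _ _ _ _ _ _ _ _ tensor_cell_natural[OF T f]])
      (use f facts(3) in \<open>simp_all add: hom_def\<close>)
  have nat': "ap ?Y (d (tgt ?X f) (tgt ?X f')) y (ap ?Y (farr F (tar A f f')) y s) =
      ap ?Y (day_map B (farr F f) (farr F f')) y (ap ?Y (d (src ?X f) (src ?X f')) y s)"
    if f: "f \<in> arrs ?X" "f' \<in> arrs ?X" and y: "y \<in> objs ?Y"
      and s: "s \<in> fobj (fobj F (ten A (src ?X f) (src ?X f'))) y" for f f' y s
    using arg_cong[where f="\<lambda>m. ap ?Y m y s", OF nat[OF f]] f y s facts(3) by simp
  \<comment> \<open>On generators \<open>?l\<close> sends \<open>s\<close> tensor \<open>s'\<close>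
    to \<open>[s, t]\<close> tensor \<open>[s', t']\<close>; being an arrow, it applies to every
    element of the Day convolution of \<open>F(x)\<close> and \<open>F(x')\<close>.\<close>
  let ?l = "\<lambda>x x' t t'. day_map B (kel_arrow ?X ?Y F p x t) (kel_arrow ?X ?Y F q x' t')"
  have dm: "?l (src ?X f) (src ?X f') (act ?X p f t) (act ?X q f' t') =
      ?l (tgt ?X f) (tgt ?X f') t t' \<cdot>\<^bsub>PSh B\<^esub> day_map B (farr F f) (farr F f')"
    if f: "f \<in> arrs ?X" "f' \<in> arrs ?X" "t \<in> fobj p (tgt ?X f)" "t' \<in> fobj q (tgt ?X f')" for f f' t t'
    using f facts(3) farr_cmp[OF is_functor_day_tensor[OF facts(2)], of "(farr F f, farr F f')"
        "(kel_arrow ?X ?Y F p (tgt ?X f) t, kel_arrow ?X ?Y F q (tgt ?X f') t')"]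
    by (simp add: kel_arrow_act)
  have "\<exists>m. m \<in> hom (PSh B) (?K (day A p q)) (day B (?K p) (?K q)) \<and>
    (\<forall>y\<in>objs ?Y. \<forall>x\<in>objs ?X. \<forall>x'\<in>objs ?X. \<forall>s\<in>fobj (fobj F (ten A x x')) y. \<forall>t\<in>fobj p x. \<forall>t'\<in>fobj q x'.
      ap ?Y m y (kel ?X F (day A p q) y (ten A x x') s (gen A p q x x' t t')) =
      ap ?Y (?l x x' t t') y (ap ?Y (d x x') y s))"
    by (rule kan_day_arrow_exists) (use facts(3) in \<open>simp_all add: dm nat'\<close>)
  then obtain m where m: "m \<in> hom (PSh B) (?K (day A p q)) (day B (?K p) (?K q))"
    and ap_m: "\<And>y x x' s t t'. y \<in> objs ?Y \<Longrightarrow> x \<in> objs ?X \<Longrightarrow> x' \<in> objs ?X \<Longrightarrow>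
      s \<in> fobj (fobj F (ten A x x')) y \<Longrightarrow> t \<in> fobj p x \<Longrightarrow> t' \<in> fobj q x' \<Longrightarrow>
      ap ?Y m y (kel ?X F (day A p q) y (ten A x x') s (gen A p q x x' t t')) =
      ap ?Y (?l x x' t t') y (ap ?Y (d x x') y s)" by blast
  note m' = hom_arr[OF m] hom_src[OF m] hom_tgt[OF m]
  \<comment> \<open>The formula for \<open>kan_tensor\<close> restated as an equation of arrows. It
    thus holds at all elements of the Day convolution of \<open>F(x)\<close> and
    \<open>F(x')\<close>, in particular at the value of \<open>d x x'\<close> on \<open>s\<close>,
    as the second inverse law requires.\<close>
  have kl: "kan_tensor A B F c p q \<cdot>\<^bsub>PSh B\<^esub> ?l x x' t t' =
      kel_arrow ?X ?Y F (day A p q) (ten A x x') (gen A p q x x' t t') \<cdot>\<^bsub>PSh B\<^esub> c (x, x')"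
    if "x \<in> objs ?X" "x' \<in> objs ?X" "t \<in> fobj p x" "t' \<in> fobj q x'" for x x' t t'
    using that facts(3)
    by (intro day_arrow_eqI[of B "fobj F x" "fobj F x'" _ "?K (day A p q)"]) (simp_all add: hom_def)
  have kl': "ap ?Y (kan_tensor A B F c p q) y (ap ?Y (?l x x' t t') y v) =
      kel ?X F (day A p q) y (ten A x x') (ap ?Y (c (x, x')) y v) (gen A p q x x' t t')"
    if "x \<in> objs ?X" "x' \<in> objs ?X" "t \<in> fobj p x" "t' \<in> fobj q x'" "y \<in> objs ?Y"
      "v \<in> fobj (day B (fobj F x) (fobj F x')) y" for x x' t t' y v
    using arg_cong[where f="\<lambda>m. ap ?Y m y v", OF kl[OF that(1-4)]] that facts(3) by simp
  show ?thesis
  proof (rule iso_in_presheavesI'[OF kan_tensor_hom m])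
    show "m \<cdot>\<^bsub>PSh B\<^esub> kan_tensor A B F c p q = ident (PSh B) (day B (?K p) (?K q))"
    proof (rule day_arrow_eqI[of B "?K p" "?K q" _ "day B (?K p) (?K q)"])
      fix y y' v v' assume y: "y \<in> objs ?Y" "y' \<in> objs ?Y" and v: "v \<in> fobj (?K p) y" "v' \<in> fobj (?K q) y'"
      show "ap ?Y (m \<cdot>\<^bsub>PSh B\<^esub> kan_tensor A B F c p q) (ten B y y') (gen B (?K p) (?K q) y y' v v') =
        ap ?Y (ident (PSh B) (day B (?K p) (?K q))) (ten B y y') (gen B (?K p) (?K q) y y' v v')"
        by (rule kan_obj_cases[OF v(1) y(1)], rule kan_obj_cases[OF v(2) y(2)])
          (use y m' facts(3) in \<open>simp add: ap_m dc\<close>)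
    qed (use m' facts(3) in \<open>simp_all add: hom_def\<close>)
    show "kan_tensor A B F c p q \<cdot>\<^bsub>PSh B\<^esub> m = ident (PSh B) (?K (day A p q))"
      by (rule kan_day_arrow_eqI[of A ?Y F p q _ "?K (day A p q)"])
        (use m' facts(3) in \<open>simp_all add: hom_def ap_m kl' cd\<close>)
  qed
qed

end

lemma kan_tensor_natural:
  assumes T: "tensor_diagram A B F c" and a: "a \<in> arrs (PSh A)" and b: "b \<in> arrs (PSh A)"
  shows "farr (kan (fst A) (fst B) F) (day_map A a b) \<cdot>\<^bsub>PSh B\<^esub> kan_tensor A B F c (src (PSh A) a) (src (PSh A) b) =
    kan_tensor A B F c (tgt (PSh A) a) (tgt (PSh A) b) \<cdot>\<^bsub>PSh B\<^esub>
      day_map B (farr (kan (fst A) (fst B) F) a) (farr (kan (fst A) (fst B) F) b)"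
proof -
  note [simp] = tensor_diagram_simps[OF T] kan_tensor_arr[OF T] src_kan_tensor[OF T] tgt_kan_tensor[OF T]
    ap_kan_tensor[OF T]
  note F = tensor_diagram_diagram[OF T]
  let ?K = "kan_obj (fst A) (fst B) F"
  let ?l = "farr (kan (fst A) (fst B) F) (day_map A a b) \<cdot>\<^bsub>PSh B\<^esub> kan_tensor A B F c (src (PSh A) a) (src (PSh A) b)"
  let ?r = "kan_tensor A B F c (tgt (PSh A) a) (tgt (PSh A) b) \<cdot>\<^bsub>PSh B\<^esub>
      day_map B (farr (kan (fst A) (fst B) F) a) (farr (kan (fst A) (fst B) F) b)"
  show ?thesis
  proof (rule day_arrow_eqI[of B "?K (src (PSh A) a)" "?K (src (PSh A) b)" _
        "?K (day A (tgt (PSh A) a) (tgt (PSh A) b))"])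
    fix y y' v v' assume y: "y \<in> objs (fst B)" "y' \<in> objs (fst B)"
      and v: "v \<in> fobj (?K (src (PSh A) a)) y" "v' \<in> fobj (?K (src (PSh A) b)) y'"
    show "ap (fst B) ?l (ten B y y') (gen B (?K (src (PSh A) a)) (?K (src (PSh A) b)) y y' v v') =
      ap (fst B) ?r (ten B y y') (gen B (?K (src (PSh A) a)) (?K (src (PSh A) b)) y y' v v')"
      by (rule kan_obj_cases[OF v(1) y(1)], rule kan_obj_cases[OF v(2) y(2)]) (use y a b F in simp)
  qed (use a b F in \<open>simp_all add: hom_def\<close>)
qed

lemma is_functor_tensor_pair:
  assumes C: "category C" and F: "is_functor C D F" and T: "is_functor (prod_cat D D) D T"
  shows "is_functor (prod_cat C C) D (make_functor (prod_cat C C)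
    (\<lambda>(x, y). fobj T (fobj F x, fobj F y)) (\<lambda>(f, g). farr T (farr F f, farr F g)))"
proof -
  note F' = functor_simps[OF F]
  have t: "fobj T (x, y) \<in> objs D" if "x \<in> objs D" "y \<in> objs D" for x y
    using fobj_mem[OF T, of "(x, y)"] that by simp
  have a: "farr T (f, g) \<in> arrs D" "src D (farr T (f, g)) = fobj T (src D f, src D g)"
    "tgt D (farr T (f, g)) = fobj T (tgt D f, tgt D g)" if "f \<in> arrs D" "g \<in> arrs D" for f g
    using functor_simps(2-4)[OF T, of "(f, g)"] that by simp_all
  have i: "farr T (ident D x, ident D y) = ident D (fobj T (x, y))" if "x \<in> objs D" "y \<in> objs D" for x y
    using farr_ident[OF T, of "(x, y)"] that by simp
  have c: "farr T (g \<cdot>\<^bsub>D\<^esub> f, g' \<cdot>\<^bsub>D\<^esub> f') = farr T (g, g') \<cdot>\<^bsub>D\<^esub> farr T (f, f')"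
    if "f \<in> arrs D" "g \<in> arrs D" "tgt D f = src D g" "f' \<in> arrs D" "g' \<in> arrs D" "tgt D f' = src D g'"
    for f g f' g'
    using farr_cmp[OF T, of "(f, f')" "(g, g')"] that by simp
  show ?thesis
    using C by (intro is_functor_make_functor) (auto simp: hom_def t a i c F')
qed

section \<open>Pseudomorphisms into presheaves, read on elements\<close>

lemma small_strict_algebraD:
  assumes "small_strict_algebra S A"
  shows "small_monoidal A" and "symmetric_doctrine S \<Longrightarrow> small_symmetric A"
  using assms
  by (auto simp: small_strict_algebra_def strict_algebra_def small_monoidal_def small_symmetric_def
      split: option.splits)

context
  fixes S :: doctrine and A B :: "('u::universe, 'u) algebra" and F P
  assumes A: "small_strict_algebra S A" and B: "small_strict_algebra S B"
    and P: "pseudomorphism S A (PSh B, day_structure B) (F, P)"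
begin

private abbreviation (input) "c x y \<equiv> tensor_cell P (x, y)"

private lemma monoidal[simp]: "small_monoidal A" "small_monoidal B"
  using small_strict_algebraD(1) A B by blast+

lemma pseudomorphism_diagram: "diagram (fst A) (fst B) F"
  using P unfolding diagram_def pseudomorphism_def Let_def
  by (cases A) (use monoidal[THEN small_fst] in auto)

private lemma pseudo:
  shows "nat_iso (prod_cat (fst A) (fst A)) (PSh B)
      (make_functor (prod_cat (fst A) (fst A)) (\<lambda>(x, y). fobj (day_tensor B) (fobj F x, fobj F y))
        (\<lambda>(f, g). farr (day_tensor B) (farr F f, farr F g)))
      (comp_functor (prod_cat (fst A) (fst A)) F (tensor (snd A))) (tensor_cell P)"
    and "unit_cell P \<in> hom (PSh B) (day_unit B) (fobj F (munit (snd A)))" "iso_in (PSh B) (unit_cell P)"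
    and "x \<in> objs (fst A) \<Longrightarrow> y \<in> objs (fst A) \<Longrightarrow> z \<in> objs (fst A) \<Longrightarrow>
       farr F (asc A x y z) \<cdot>\<^bsub>PSh B\<^esub> c (ten A x y) z \<cdot>\<^bsub>PSh B\<^esub>
         farr (day_tensor B) (c x y, ident (PSh B) (fobj F z)) =
       c x (ten A y z) \<cdot>\<^bsub>PSh B\<^esub> farr (day_tensor B) (ident (PSh B) (fobj F x), c y z) \<cdot>\<^bsub>PSh B\<^esub>
         associator (day_structure B) (fobj F x, fobj F y, fobj F z)"
    and "x \<in> objs (fst A) \<Longrightarrow> farr F (lunitor (snd A) x) \<cdot>\<^bsub>PSh B\<^esub> c (munit (snd A)) x \<cdot>\<^bsub>PSh B\<^esub>
        farr (day_tensor B) (unit_cell P, ident (PSh B) (fobj F x)) = lunitor (day_structure B) (fobj F x)"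
    and "x \<in> objs (fst A) \<Longrightarrow> farr F (runitor (snd A) x) \<cdot>\<^bsub>PSh B\<^esub> c x (munit (snd A)) \<cdot>\<^bsub>PSh B\<^esub>
        farr (day_tensor B) (ident (PSh B) (fobj F x), unit_cell P) = runitor (day_structure B) (fobj F x)"
    and "symmetric_doctrine S \<Longrightarrow> x \<in> objs (fst A) \<Longrightarrow> y \<in> objs (fst A) \<Longrightarrow>
        farr F (swp A x y) \<cdot>\<^bsub>PSh B\<^esub> c x y =
        c y x \<cdot>\<^bsub>PSh B\<^esub> the (symmetry (day_structure B)) (fobj F x, fobj F y)"
  using P unfolding pseudomorphism_def Let_def by (cases A; simp)+

lemma pseudomorphism_tensor_diagram: "tensor_diagram A B F (tensor_cell P)"
proof -
  note F = pseudomorphism_diagram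
  show ?thesis
    unfolding tensor_diagram_def
  proof (intro conjI ballI)
    fix x y assume "x \<in> objs (fst A)" "y \<in> objs (fst A)"
    then show "c x y \<in> hom (PSh B) (day B (fobj F x) (fobj F y)) (fobj F (ten A x y))"
      using nat_isoD(1)[OF pseudo(1), of "(x, y)"] F by simp
  next
    fix f g assume "f \<in> arrs (fst A)" "g \<in> arrs (fst A)"
    then show "farr F (tar A f g) \<cdot>\<^bsub>PSh B\<^esub> c (src (fst A) f) (src (fst A) g) =
        c (tgt (fst A) f) (tgt (fst A) g) \<cdot>\<^bsub>PSh B\<^esub> day_map B (farr F f) (farr F g)"
      using nat_isoD(2)[OF pseudo(1), of "(f, g)"] F by simp
  qed (use F in simp_all)
qed

lemma pseudomorphism_iso_in: "x \<in> objs (fst A) \<Longrightarrow> y \<in> objs (fst A) \<Longrightarrow> iso_in (PSh B) (c x y)"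
  using nat_isoD(3)[OF pseudo(1), of "(x, y)"] by simp

lemma pseudomorphism_unit:
  shows "unit_cell P \<in> arrs (PSh B)" "src (PSh B) (unit_cell P) = day_unit B"
    "tgt (PSh B) (unit_cell P) = fobj F (munit (snd A))" "iso_in (PSh B) (unit_cell P)"
  using pseudo(2,3) by (auto simp: hom_def)

private lemmas cell_simps = tensor_diagram_simps[OF pseudomorphism_tensor_diagram] pseudomorphism_unit

text \<open>The associativity axiom of \<open>F\<close> evaluated at
  \<open>(s tensor t) tensor w\<close>. This and the next three lemmas have the shape in which the
  axioms are met when those of \<open>F*\<close> are computed on generators.\<close>

lemma ap_pseudo_assoc:
  assumes x: "x \<in> objs (fst A)" "y \<in> objs (fst A)" "z \<in> objs (fst A)"
    and b: "a \<in> objs (fst B)" "b \<in> objs (fst B)" "d \<in> objs (fst B)"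
    and s: "s \<in> fobj (fobj F x) a" "t \<in> fobj (fobj F y) b" "w \<in> fobj (fobj F z) d"
  shows "ap (fst B) (farr F (asc A x y z)) (ten B (ten B a b) d) (ap (fst B) (c (ten A x y) z) (ten B (ten B a b) d)
      (gen B (fobj F (ten A x y)) (fobj F z) (ten B a b) d
        (ap (fst B) (c x y) (ten B a b) (gen B (fobj F x) (fobj F y) a b s t)) w)) =
    act (fst B) (fobj F (ten A x (ten A y z))) (asc B a b d) (ap (fst B) (c x (ten A y z)) (ten B a (ten B b d))
      (gen B (fobj F x) (fobj F (ten A y z)) a (ten B b d) s
        (ap (fst B) (c y z) (ten B b d) (gen B (fobj F y) (fobj F z) b d t w))))"
proof -
  note [simp] = cell_simps
  note F = pseudomorphism_diagram
  have "ap (fst B) (farr F (asc A x y z) \<cdot>\<^bsub>PSh B\<^esub> c (ten A x y) z \<cdot>\<^bsub>PSh B\<^esub>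
         day_map B (c x y) (ident (PSh B) (fobj F z))) (ten B (ten B a b) d)
         (gen B (day B (fobj F x) (fobj F y)) (fobj F z) (ten B a b) d (gen B (fobj F x) (fobj F y) a b s t) w) =
       ap (fst B) (c x (ten A y z) \<cdot>\<^bsub>PSh B\<^esub> day_map B (ident (PSh B) (fobj F x)) (c y z) \<cdot>\<^bsub>PSh B\<^esub>
         day_assoc B (fobj F x) (fobj F y) (fobj F z)) (ten B (ten B a b) d)
         (gen B (day B (fobj F x) (fobj F y)) (fobj F z) (ten B a b) d (gen B (fobj F x) (fobj F y) a b s t) w)"
    using pseudo(4)[OF x] x F by simp
  then show ?thesis using x b s F by simp
qed

lemma ap_pseudo_lunitor:
  assumes x: "x \<in> objs (fst A)" and b: "a \<in> objs (fst B)" "b \<in> objs (fst B)"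
    and s: "e \<in> hom (fst B) a (munit (snd B))" "s \<in> fobj (fobj F x) b"
  shows "ap (fst B) (farr F (lunitor (snd A) x)) (ten B a b) (ap (fst B) (c (munit (snd A)) x) (ten B a b)
      (gen B (fobj F (munit (snd A))) (fobj F x) a b (ap (fst B) (unit_cell P) a e) s)) =
    act (fst B) (fobj F x) (lunitor (snd B) b \<cdot>\<^bsub>fst B\<^esub> tar B e (ident (fst B) b)) s"
proof -
  note [simp] = cell_simps
  note F = pseudomorphism_diagram
  have "ap (fst B) (farr F (lunitor (snd A) x) \<cdot>\<^bsub>PSh B\<^esub> c (munit (snd A)) x \<cdot>\<^bsub>PSh B\<^esub>
        day_map B (unit_cell P) (ident (PSh B) (fobj F x))) (ten B a b) (gen B (day_unit B) (fobj F x) a b e s) =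
      ap (fst B) (day_lunitor B (fobj F x)) (ten B a b) (gen B (day_unit B) (fobj F x) a b e s)"
    using pseudo(5)[OF x] x F by simp
  then show ?thesis using x b s F by simp
qed

lemma ap_pseudo_runitor:
  assumes x: "x \<in> objs (fst A)" and b: "a \<in> objs (fst B)" "b \<in> objs (fst B)"
    and s: "s \<in> fobj (fobj F x) a" "e \<in> hom (fst B) b (munit (snd B))"
  shows "ap (fst B) (farr F (runitor (snd A) x)) (ten B a b) (ap (fst B) (c x (munit (snd A))) (ten B a b)
      (gen B (fobj F x) (fobj F (munit (snd A))) a b s (ap (fst B) (unit_cell P) b e))) =
    act (fst B) (fobj F x) (runitor (snd B) a \<cdot>\<^bsub>fst B\<^esub> tar B (ident (fst B) a) e) s"
proof -
  note [simp] = cell_simps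
  note F = pseudomorphism_diagram
  have "ap (fst B) (farr F (runitor (snd A) x) \<cdot>\<^bsub>PSh B\<^esub> c x (munit (snd A)) \<cdot>\<^bsub>PSh B\<^esub>
        day_map B (ident (PSh B) (fobj F x)) (unit_cell P)) (ten B a b) (gen B (fobj F x) (day_unit B) a b s e) =
      ap (fst B) (day_runitor B (fobj F x)) (ten B a b) (gen B (fobj F x) (day_unit B) a b s e)"
    using pseudo(6)[OF x] x F by simp
  then show ?thesis using x b s F by simp
qed

lemma ap_pseudo_swap:
  assumes S: "symmetric_doctrine S" and x: "x \<in> objs (fst A)" "y \<in> objs (fst A)"
    and b: "a \<in> objs (fst B)" "b \<in> objs (fst B)" and s: "s \<in> fobj (fobj F x) a" "t \<in> fobj (fobj F y) b"
  shows "ap (fst B) (farr F (swp A x y)) (ten B a b) (ap (fst B) (c x y) (ten B a b)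
      (gen B (fobj F x) (fobj F y) a b s t)) =
    act (fst B) (fobj F (ten A y x)) (swp B a b) (ap (fst B) (c y x) (ten B b a)
      (gen B (fobj F y) (fobj F x) b a t s))"
proof -
  note [simp] = cell_simps small_strict_algebraD(2)[OF A S] small_strict_algebraD(2)[OF B S]
  have s': "symmetry (snd B) \<noteq> None" using small_strict_algebraD(2)[OF B S] by (simp add: small_symmetric_def)
  note F = pseudomorphism_diagram
  have "ap (fst B) (farr F (swp A x y) \<cdot>\<^bsub>PSh B\<^esub> c x y) (ten B a b) (gen B (fobj F x) (fobj F y) a b s t) =
      ap (fst B) (c y x \<cdot>\<^bsub>PSh B\<^esub> day_swap B (fobj F x) (fobj F y)) (ten B a b) (gen B (fobj F x) (fobj F y) a b s t)"
    using pseudo(7)[OF S x] x F s' by simp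
  then show ?thesis using x b s F by simp
qed

end

text \<open>The unit of the presheaves on \<open>A\<close> is the representable at the unit object,
  so \<open>eta\<close> at that object leads from \<open>F\<close> of the unit to \<open>F*\<close>
  of the unit presheaf and completes the unit cell of \<open>F\<close>.\<close>

definition kan_structure :: "('u::universe, 'u) algebra \<Rightarrow> ('u, 'u) algebra \<Rightarrow> 'u presheaf_pseudo \<Rightarrow>
    ('u psh, 'u psh_arrow) pseudo_structure" where
  "kan_structure A B = (\<lambda>(F, P).
     \<lparr>tensor_cell = (\<lambda>(p, q)\<in>objs (PSh A) \<times> objs (PSh A). kan_tensor A B F (tensor_cell P) p q),
      unit_cell = eta (fst A) (fst B) F (munit (snd A)) \<cdot>\<^bsub>PSh B\<^esub> unit_cell P\<rparr>)"

lemma kan_structure_simps[simp]: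
  "presheaf (fst A) p \<Longrightarrow> presheaf (fst A) q \<Longrightarrow>
    tensor_cell (kan_structure A B (F, P)) (p, q) = kan_tensor A B F (tensor_cell P) p q"
  "unit_cell (kan_structure A B (F, P)) = eta (fst A) (fst B) F (munit (snd A)) \<cdot>\<^bsub>PSh B\<^esub> unit_cell P"
  by (simp_all add: kan_structure_def)

text \<open>The coend relation oriented as a rewrite rule: a restriction in the second entry is
  replaced by \<open>F(f)\<close> on the first. This brings both sides of an axiom for
  \<open>F*\<close> to a common second entry.\<close>

lemma kel_act:
  "f \<in> arrs X \<Longrightarrow> s \<in> fobj (fobj F x) y \<Longrightarrow> t \<in> fobj p (tgt X f) \<Longrightarrow> src X f = x \<Longrightarrow>
    kel X F p y x s (act X p f t) = kel X F p y (tgt X f) (ap Y (farr F f) y s) t"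
  using kel_dinatural[of f X s F y t p Y] by auto

lemma day_kan_arrow_eqI:
  assumes B: "small_monoidal B" and F: "diagram X (fst B) F" and F': "diagram X' (fst B) F'"
    and p: "presheaf X p" and q: "presheaf X' q"
    and m: "m \<in> hom (PSh B) (day B (kan_obj X (fst B) F p) (kan_obj X' (fst B) F' q)) k"
    and m': "m' \<in> hom (PSh B) (day B (kan_obj X (fst B) F p) (kan_obj X' (fst B) F' q)) k"
    and eq: "\<And>y y' x x' s s' t t'. y \<in> objs (fst B) \<Longrightarrow> y' \<in> objs (fst B) \<Longrightarrow> x \<in> objs X \<Longrightarrow> x' \<in> objs X' \<Longrightarrow>
      s \<in> fobj (fobj F x) y \<Longrightarrow> s' \<in> fobj (fobj F' x') y' \<Longrightarrow> t \<in> fobj p x \<Longrightarrow> t' \<in> fobj q x' \<Longrightarrow>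
      ap (fst B) m (ten B y y') (gen B (kan_obj X (fst B) F p) (kan_obj X' (fst B) F' q) y y'
        (kel X F p y x s t) (kel X' F' q y' x' s' t')) =
      ap (fst B) m' (ten B y y') (gen B (kan_obj X (fst B) F p) (kan_obj X' (fst B) F' q) y y'
        (kel X F p y x s t) (kel X' F' q y' x' s' t'))"
  shows "m = m'"
proof (rule day_arrow_eqI[OF B _ _ m m'])
  fix y y' v v' assume y: "y \<in> objs (fst B)" "y' \<in> objs (fst B)"
    and v: "v \<in> fobj (kan_obj X (fst B) F p) y" "v' \<in> fobj (kan_obj X' (fst B) F' q) y'"
  show "ap (fst B) m (ten B y y') (gen B (kan_obj X (fst B) F p) (kan_obj X' (fst B) F' q) y y' v v') =
    ap (fst B) m' (ten B y y') (gen B (kan_obj X (fst B) F p) (kan_obj X' (fst B) F' q) y y' v v')"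
    by (rule kan_obj_cases[OF v(1) y(1)], rule kan_obj_cases[OF v(2) y(2)]) (use y in \<open>simp add: eq\<close>)
qed (use p q F F' in simp_all)

text \<open>On generators the structure arrows of \<open>A\<close> occur as restrictions in second
  entries; \<open>kel_act\<close> turns them into values of \<open>F\<close> on first entries, where
  the corresponding axiom of \<open>F\<close> applies.\<close>

lemma pseudomorphism_kan:
  assumes A: "small_strict_algebra S A" and B: "small_strict_algebra S B"
    and P: "pseudomorphism S A (PSh B, day_structure B) (F, P)"
  shows "pseudomorphism S (PSh A, day_structure A) (PSh B, day_structure B)
    (kan (fst A) (fst B) F, kan_structure A B (F, P))"
proof -
  note M[simp] = small_strict_algebraD(1)[OF A] small_strict_algebraD(1)[OF B]
  note T = pseudomorphism_tensor_diagram[OF A B P]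
  note F = pseudomorphism_diagram[OF A B P]
  note [simp] = kan_tensor_arr[OF T] src_kan_tensor[OF T] tgt_kan_tensor[OF T] ap_kan_tensor[OF T]
    tensor_cell_arr[OF T] tensor_cell_src[OF T] tensor_cell_tgt[OF T] pseudomorphism_unit[OF A B P]
    kel_act[where Y="fst B"] ap_pseudo_assoc[OF A B P] ap_pseudo_lunitor[OF A B P] ap_pseudo_runitor[OF A B P]
  let ?X = "fst A" and ?Y = "fst B" and ?K = "kan_obj (fst A) (fst B) F" and ?F = "kan (fst A) (fst B) F"
  let ?k = "kan_tensor A B F (tensor_cell P)"
  let ?u = "eta (fst A) (fst B) F (munit (snd A)) \<cdot>\<^bsub>PSh B\<^esub> unit_cell P"
  note KF = is_functor_kan[OF F]
  have "nat_iso (prod_cat (PSh A) (PSh A)) (PSh B)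
      (make_functor (prod_cat (PSh A) (PSh A)) (\<lambda>(x, y). fobj (day_tensor B) (fobj ?F x, fobj ?F y))
        (\<lambda>(f, g). farr (day_tensor B) (farr ?F f, farr ?F g)))
      (comp_functor (prod_cat (PSh A) (PSh A)) ?F (day_tensor A)) (tensor_cell (kan_structure A B (F, P)))"
    unfolding nat_iso_def nat_trans_def
    using is_functor_tensor_pair[OF _ KF is_functor_day_tensor[OF M(2)]]
      is_functor_comp_functor[OF _ is_functor_day_tensor[OF M(1)] KF] F
    by (auto simp: kan_tensor_hom[OF T] iso_in_kan_tensor[OF T] pseudomorphism_iso_in[OF A B P]
        kan_tensor_natural[OF T])
      (auto simp: kan_structure_def)
  moreover have "?u \<in> hom (PSh B) (day_unit B) (?K (day_unit A))"
    using F by (simp add: hom_def)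
  moreover have "iso_in (PSh B) ?u"
    using F by (intro iso_in_cmp iso_in_eta) simp_all
  moreover have "farr ?F (day_assoc A p q r) \<cdot>\<^bsub>PSh B\<^esub> ?k (day A p q) r \<cdot>\<^bsub>PSh B\<^esub>
      day_map B (?k p q) (ident (PSh B) (?K r)) =
    ?k p (day A q r) \<cdot>\<^bsub>PSh B\<^esub> day_map B (ident (PSh B) (?K p)) (?k q r) \<cdot>\<^bsub>PSh B\<^esub> day_assoc B (?K p) (?K q) (?K r)"
    (is "?l = ?r") if p: "presheaf ?X p" "presheaf ?X q" "presheaf ?X r" for p q r
  proof (rule day_day_arrow_eqI[of B "?K p" "?K q" "?K r" _ "?K (day A p (day A q r))"])
    fix y y' y'' v v' v'' assume y: "y \<in> objs ?Y" "y' \<in> objs ?Y" "y'' \<in> objs ?Y"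
      and v: "v \<in> fobj (?K p) y" "v' \<in> fobj (?K q) y'" "v'' \<in> fobj (?K r) y''"
    show "ap ?Y ?l (ten B (ten B y y') y'') (gen B (day B (?K p) (?K q)) (?K r) (ten B y y') y''
        (gen B (?K p) (?K q) y y' v v') v'') =
      ap ?Y ?r (ten B (ten B y y') y'') (gen B (day B (?K p) (?K q)) (?K r) (ten B y y') y''
        (gen B (?K p) (?K q) y y' v v') v'')"
      by (rule kan_obj_cases[OF v(1) y(1)], rule kan_obj_cases[OF v(2) y(2)], rule kan_obj_cases[OF v(3) y(3)])
        (use y p F in simp)
  qed (use p F in \<open>simp_all add: hom_def\<close>)
  moreover have "farr ?F (day_lunitor A p) \<cdot>\<^bsub>PSh B\<^esub> ?k (day_unit A) p \<cdot>\<^bsub>PSh B\<^esub>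
      day_map B ?u (ident (PSh B) (?K p)) = day_lunitor B (?K p)" (is "?l = ?r") if p: "presheaf ?X p" for p
  proof (rule day_arrow_eqI[of B "day_unit B" "?K p" _ "?K p"])
    fix y y' e v assume y: "y \<in> objs ?Y" "y' \<in> objs ?Y" and e: "e \<in> fobj (day_unit B) y" and v: "v \<in> fobj (?K p) y'"
    have e': "e \<in> hom ?Y y (munit (snd B))" "e \<in> arrs ?Y" "src ?Y e = y" "tgt ?Y e = munit (snd B)"
      using e y by (auto simp: hom_def)
    show "ap ?Y ?l (ten B y y') (gen B (day_unit B) (?K p) y y' e v) =
      ap ?Y ?r (ten B y y') (gen B (day_unit B) (?K p) y y' e v)"
      by (rule kan_obj_cases[OF v y(2)]) (use y e' p F in simp)
  qed (use p F in \<open>simp_all add: hom_def\<close>)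
  moreover have "farr ?F (day_runitor A p) \<cdot>\<^bsub>PSh B\<^esub> ?k p (day_unit A) \<cdot>\<^bsub>PSh B\<^esub>
      day_map B (ident (PSh B) (?K p)) ?u = day_runitor B (?K p)" (is "?l = ?r") if p: "presheaf ?X p" for p
  proof (rule day_arrow_eqI[of B "?K p" "day_unit B" _ "?K p"])
    fix y y' v e assume y: "y \<in> objs ?Y" "y' \<in> objs ?Y" and v: "v \<in> fobj (?K p) y" and e: "e \<in> fobj (day_unit B) y'"
    have e': "e \<in> hom ?Y y' (munit (snd B))" "e \<in> arrs ?Y" "src ?Y e = y'" "tgt ?Y e = munit (snd B)"
      using e y by (auto simp: hom_def)
    show "ap ?Y ?l (ten B y y') (gen B (?K p) (day_unit B) y y' v e) =
      ap ?Y ?r (ten B y y') (gen B (?K p) (day_unit B) y y' v e)"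
      by (rule kan_obj_cases[OF v y(1)]) (use y e' p F in simp)
  qed (use p F in \<open>simp_all add: hom_def\<close>)
  moreover have "farr ?F (the (symmetry (day_structure A)) (p, q)) \<cdot>\<^bsub>PSh B\<^esub> ?k p q =
      ?k q p \<cdot>\<^bsub>PSh B\<^esub> the (symmetry (day_structure B)) (?K p, ?K q)"
    if S: "symmetric_doctrine S" and p: "presheaf ?X p" "presheaf ?X q" for p q
  proof -
    note [simp] = small_strict_algebraD(2)[OF A S] small_strict_algebraD(2)[OF B S] ap_pseudo_swap[OF A B P S]
    have s: "symmetry (snd A) \<noteq> None" "symmetry (snd B) \<noteq> None"
      using small_strict_algebraD(2)[OF A S] small_strict_algebraD(2)[OF B S] by (simp_all add: small_symmetric_def)
    have "farr ?F (day_swap A p q) \<cdot>\<^bsub>PSh B\<^esub> ?k p q = ?k q p \<cdot>\<^bsub>PSh B\<^esub> day_swap B (?K p) (?K q)"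
      by (rule day_kan_arrow_eqI[OF M(2) F F p, of _ "?K (day A q p)"])
        (use p F in \<open>simp_all add: hom_def\<close>)
    then show ?thesis using s p F by simp
  qed
  ultimately show ?thesis
    unfolding pseudomorphism_def Let_def
    using KF F by simp
qed

section \<open>The Yoneda embedding as a pseudomorphism\<close>

definition yoneda_tensor :: "('u::universe, 'u) algebra \<Rightarrow> 'u \<Rightarrow> 'u \<Rightarrow> 'u psh_arrow" where
  "yoneda_tensor A x y = (SOME m.
     m \<in> hom (PSh A) (day A (yoneda_obj (fst A) x) (yoneda_obj (fst A) y)) (yoneda_obj (fst A) (ten A x y)) \<and>
     (\<forall>a\<in>objs (fst A). \<forall>b\<in>objs (fst A). \<forall>g\<in>fobj (yoneda_obj (fst A) x) a. \<forall>h\<in>fobj (yoneda_obj (fst A) y) b.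
        ap (fst A) m (ten A a b) (gen A (yoneda_obj (fst A) x) (yoneda_obj (fst A) y) a b g h) = tar A g h))"

text \<open>A generator of a tensor product of representables is a pair of arrows, and
  \<open>tar A\<close> combines them. The inverse is the Yoneda arrow that names \<open>id\<close>
  tensor \<open>id\<close>.\<close>

lemma
  assumes A: "small_monoidal A" and x: "x \<in> objs (fst A)" "y \<in> objs (fst A)"
  shows yoneda_tensor_hom: "yoneda_tensor A x y \<in>
      hom (PSh A) (day A (yoneda_obj (fst A) x) (yoneda_obj (fst A) y)) (yoneda_obj (fst A) (ten A x y))"
    and ap_yoneda_tensor[simp]: "a \<in> objs (fst A) \<Longrightarrow> b \<in> objs (fst A) \<Longrightarrow> g \<in> hom (fst A) a x \<Longrightarrow> h \<in> hom (fst A) b y \<Longrightarrow>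
      ap (fst A) (yoneda_tensor A x y) (ten A a b) (gen A (yoneda_obj (fst A) x) (yoneda_obj (fst A) y) a b g h) = tar A g h"
    and iso_in_yoneda_tensor: "iso_in (PSh A) (yoneda_tensor A x y)"
proof -
  note [simp] = A
  let ?C = "fst A" and ?y = "yoneda_obj (fst A)"
  let ?P = "\<lambda>m. m \<in> hom (PSh A) (day A (?y x) (?y y)) (?y (ten A x y)) \<and>
     (\<forall>a\<in>objs ?C. \<forall>b\<in>objs ?C. \<forall>g\<in>fobj (?y x) a. \<forall>h\<in>fobj (?y y) b.
        ap ?C m (ten A a b) (gen A (?y x) (?y y) a b g h) = tar A g h)"
  have "\<exists>m. ?P m"
    using x by (intro day_arrow_exists) (auto simp: hom_def tar_cmp)
  then have P: "?P (yoneda_tensor A x y)" unfolding yoneda_tensor_def by (rule someI_ex)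
  then show hom: "yoneda_tensor A x y \<in> hom (PSh A) (day A (?y x) (?y y)) (?y (ten A x y))" by blast
  show ap: "a \<in> objs ?C \<Longrightarrow> b \<in> objs ?C \<Longrightarrow> g \<in> hom ?C a x \<Longrightarrow> h \<in> hom ?C b y \<Longrightarrow>
      ap ?C (yoneda_tensor A x y) (ten A a b) (gen A (?y x) (?y y) a b g h) = tar A g h" for a b g h
    using P by simp
  \<comment> \<open>The universal element: each generator at \<open>g\<close> and \<open>h\<close>
    is its restriction along \<open>tar A g h\<close>, by bilinearity.\<close>
  let ?e = "gen A (?y x) (?y y) x y (ident ?C x) (ident ?C y)"
  let ?m' = "make_arrow ?C (?y (ten A x y)) (day A (?y x) (?y y)) (\<lambda>a f. act ?C (day A (?y x) (?y y)) f ?e)"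
  have e: "?e \<in> fobj (day A (?y x) (?y y)) (ten A x y)" using x by simp
  have m': "?m' \<in> hom (PSh A) (?y (ten A x y)) (day A (?y x) (?y y))"
    by (rule yoneda_arrow) (use x e in simp_all)
  note hom' = hom_arr[OF hom] hom_src[OF hom] hom_tgt[OF hom] hom_arr[OF m'] hom_src[OF m'] hom_tgt[OF m']
  show "iso_in (PSh A) (yoneda_tensor A x y)"
  proof (rule iso_in_presheavesI'[OF hom m'])
    show "?m' \<cdot>\<^bsub>PSh A\<^esub> yoneda_tensor A x y = ident (PSh A) (day A (?y x) (?y y))"
    proof (rule day_arrow_eqI[of A "?y x" "?y y" _ "day A (?y x) (?y y)"])
      fix a b g h assume ab: "a \<in> objs ?C" "b \<in> objs ?C" and gh: "g \<in> fobj (?y x) a" "h \<in> fobj (?y y) b"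
      have g: "g \<in> hom ?C a x" "h \<in> hom ?C b y" "g \<in> arrs ?C" "src ?C g = a" "tgt ?C g = x"
        "h \<in> arrs ?C" "src ?C h = b" "tgt ?C h = y" using ab gh by (auto simp: hom_def)
      have t: "tar A g h \<in> hom ?C (ten A a b) (ten A x y)" using g by (simp add: hom_def)
      have "act ?C (day A (?y x) (?y y)) (tar A g h) ?e = gen A (?y x) (?y y) a b g h"
        using gen_natural[of A "?y x" "?y y" g h "ident ?C x" "ident ?C y" a b] g x by simp
      then show "ap ?C (?m' \<cdot>\<^bsub>PSh A\<^esub> yoneda_tensor A x y) (ten A a b) (gen A (?y x) (?y y) a b g h) =
        ap ?C (ident (PSh A) (day A (?y x) (?y y))) (ten A a b) (gen A (?y x) (?y y) a b g h)"
        using ab g t hom' x by (simp add: ap)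
    qed (use hom' in \<open>simp_all add: hom_def[of "PSh A"]\<close>)
    show "yoneda_tensor A x y \<cdot>\<^bsub>PSh A\<^esub> ?m' = ident (PSh A) (?y (ten A x y))"
    proof (rule presheaf_arrow_eqI[of _ ?C "?y (ten A x y)" "?y (ten A x y)"])
      fix a f assume a: "a \<in> objs ?C" and "f \<in> fobj (?y (ten A x y)) a"
      then have f: "f \<in> hom ?C a (ten A x y)" "f \<in> arrs ?C" "src ?C f = a" "tgt ?C f = ten A x y"
        by (auto simp: hom_def)
      then show "ap ?C (yoneda_tensor A x y \<cdot>\<^bsub>PSh A\<^esub> ?m') a f = ap ?C (ident (PSh A) (?y (ten A x y))) a f"
        using a x e hom' by (simp add: ap)
    qed (use hom' in \<open>simp_all add: hom_def[of "PSh A"]\<close>)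
  qed
qed

lemma
  assumes A: "small_monoidal A" and x: "x \<in> objs (fst A)" "y \<in> objs (fst A)"
  shows yoneda_tensor_arr[simp]: "yoneda_tensor A x y \<in> arrs (PSh A)"
    and src_yoneda_tensor[simp]: "src (PSh A) (yoneda_tensor A x y) = day A (yoneda_obj (fst A) x) (yoneda_obj (fst A) y)"
    and tgt_yoneda_tensor[simp]: "tgt (PSh A) (yoneda_tensor A x y) = yoneda_obj (fst A) (ten A x y)"
  using yoneda_tensor_hom[OF assms] by (auto simp: hom_def)

text \<open>The unit cell can be an identity because the unit of Day convolution was taken to be the
  representable at the unit object.\<close>

definition yoneda_structure :: "('u::universe, 'u) algebra \<Rightarrow> ('u, 'u psh_arrow) pseudo_structure" where
  "yoneda_structure A =
     \<lparr>tensor_cell = (\<lambda>(x, y)\<in>objs (fst A) \<times> objs (fst A). yoneda_tensor A x y),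
      unit_cell = ident (PSh A) (day_unit A)\<rparr>"

lemma yoneda_structure_simps[simp]:
  "x \<in> objs (fst A) \<Longrightarrow> y \<in> objs (fst A) \<Longrightarrow> tensor_cell (yoneda_structure A) (x, y) = yoneda_tensor A x y"
  "unit_cell (yoneda_structure A) = ident (PSh A) (day_unit A)"
  by (simp_all add: yoneda_structure_def)

lemma hom_iff: "f \<in> hom C x y \<longleftrightarrow> f \<in> arrs C \<and> src C f = x \<and> tgt C f = y"
  by (auto simp: hom_def)

text \<open>Elements of representables are arrows of \<open>A\<close>, so on generators each axiom
  becomes naturality in \<open>A\<close> of the associator, of a unitor or of the symmetry, at those
  arrows.\<close>

lemma pseudomorphism_yoneda:
  assumes A: "small_strict_algebra S A"
  shows "pseudomorphism S A (PSh A, day_structure A) (yoneda (fst A), yoneda_structure A)"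
proof -
  note M[simp] = small_strict_algebraD(1)[OF A]
  let ?C = "fst A" and ?P = "PSh A" and ?y = "yoneda_obj (fst A)" and ?Y = "yoneda (fst A)"
  let ?c = "yoneda_tensor A"
  note Y = diagram_yoneda[OF small_fst[OF M]]
  note YF = is_functor_yoneda[OF small_fst[OF M]]
  have g: "g \<in> arrs ?C" "src ?C g = a" "tgt ?C g = x" if "g \<in> fobj (?y x) a" "a \<in> objs ?C" for g a x
    using that by (auto simp: hom_def)
  have nat: "farr ?Y (tar A f h) \<cdot>\<^bsub>?P\<^esub> ?c (src ?C f) (src ?C h) =
      ?c (tgt ?C f) (tgt ?C h) \<cdot>\<^bsub>?P\<^esub> day_map A (farr ?Y f) (farr ?Y h)"
    if "f \<in> arrs ?C" "h \<in> arrs ?C" for f h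
  proof (rule day_arrow_eqI[of A "?y (src ?C f)" "?y (src ?C h)" _ "?y (ten A (tgt ?C f) (tgt ?C h))"])
    fix a b s t assume a: "a \<in> objs ?C" "b \<in> objs ?C" and s: "s \<in> fobj (?y (src ?C f)) a" "t \<in> fobj (?y (src ?C h)) b"
    show "ap ?C (farr ?Y (tar A f h) \<cdot>\<^bsub>?P\<^esub> ?c (src ?C f) (src ?C h)) (ten A a b)
        (gen A (?y (src ?C f)) (?y (src ?C h)) a b s t) =
      ap ?C (?c (tgt ?C f) (tgt ?C h) \<cdot>\<^bsub>?P\<^esub> day_map A (farr ?Y f) (farr ?Y h)) (ten A a b)
        (gen A (?y (src ?C f)) (?y (src ?C h)) a b s t)"
      using that a g[OF s(1) a(1)] g[OF s(2) a(2)] Y by (simp add: hom_iff[of _ ?C] tar_cmp)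
  qed (use that Y in \<open>simp_all add: hom_def[of ?P]\<close>)
  have "nat_iso (prod_cat ?C ?C) ?P
      (make_functor (prod_cat ?C ?C) (\<lambda>(x, y). fobj (day_tensor A) (fobj ?Y x, fobj ?Y y))
        (\<lambda>(f, g). farr (day_tensor A) (farr ?Y f, farr ?Y g)))
      (comp_functor (prod_cat ?C ?C) ?Y (tensor (snd A))) (tensor_cell (yoneda_structure A))"
    unfolding nat_iso_def nat_trans_def
    using is_functor_tensor_pair[OF _ YF is_functor_day_tensor[OF M]]
      is_functor_comp_functor[OF _ tensor_functor[OF M] YF] Y
    by (auto simp: yoneda_tensor_hom iso_in_yoneda_tensor nat)
      (auto simp: yoneda_structure_def)
  moreover have "iso_in ?P (ident ?P (day_unit A))" by (rule iso_in_ident) simp_all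
  moreover have "farr ?Y (asc A x y z) \<cdot>\<^bsub>?P\<^esub> ?c (ten A x y) z \<cdot>\<^bsub>?P\<^esub> day_map A (?c x y) (ident ?P (?y z)) =
      ?c x (ten A y z) \<cdot>\<^bsub>?P\<^esub> day_map A (ident ?P (?y x)) (?c y z) \<cdot>\<^bsub>?P\<^esub> day_assoc A (?y x) (?y y) (?y z)"
    (is "?l = ?r") if x: "x \<in> objs ?C" "y \<in> objs ?C" "z \<in> objs ?C" for x y z
  proof (rule day_day_arrow_eqI[of A "?y x" "?y y" "?y z" _ "?y (ten A x (ten A y z))"])
    fix a b d s t w assume a: "a \<in> objs ?C" "b \<in> objs ?C" "d \<in> objs ?C"
      and s: "s \<in> fobj (?y x) a" "t \<in> fobj (?y y) b" "w \<in> fobj (?y z) d"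
    show "ap ?C ?l (ten A (ten A a b) d) (gen A (day A (?y x) (?y y)) (?y z) (ten A a b) d (gen A (?y x) (?y y) a b s t) w) =
      ap ?C ?r (ten A (ten A a b) d) (gen A (day A (?y x) (?y y)) (?y z) (ten A a b) d (gen A (?y x) (?y y) a b s t) w)"
      using x a g[OF s(1) a(1)] g[OF s(2) a(2)] g[OF s(3) a(3)] Y asc_natural[OF M, of s t w]
      by (simp add: hom_iff[of _ ?C])
  qed (use x Y in \<open>simp_all add: hom_def[of ?P]\<close>)
  moreover have "farr ?Y (lunitor (snd A) x) \<cdot>\<^bsub>?P\<^esub> ?c (munit (snd A)) x \<cdot>\<^bsub>?P\<^esub>
      day_map A (ident ?P (day_unit A)) (ident ?P (?y x)) = day_lunitor A (?y x)" (is "?l = ?r")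
    if x: "x \<in> objs ?C" for x
  proof (rule day_arrow_eqI[of A "day_unit A" "?y x" _ "?y x"])
    fix a b e s assume a: "a \<in> objs ?C" "b \<in> objs ?C" and s: "e \<in> fobj (day_unit A) a" "s \<in> fobj (?y x) b"
    show "ap ?C ?l (ten A a b) (gen A (day_unit A) (?y x) a b e s) = ap ?C ?r (ten A a b) (gen A (day_unit A) (?y x) a b e s)"
      using x a g[OF s(1) a(1)] g[OF s(2) a(2)] Y lunitor_natural[OF M, of s]
      by (simp add: hom_iff[of _ ?C] flip: cmp_assoc) (simp add: cmp_assoc flip: tar_cmp)
  qed (use x Y in \<open>simp_all add: hom_def[of ?P]\<close>)
  moreover have "farr ?Y (runitor (snd A) x) \<cdot>\<^bsub>?P\<^esub> ?c x (munit (snd A)) \<cdot>\<^bsub>?P\<^esub>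
      day_map A (ident ?P (?y x)) (ident ?P (day_unit A)) = day_runitor A (?y x)" (is "?l = ?r")
    if x: "x \<in> objs ?C" for x
  proof (rule day_arrow_eqI[of A "?y x" "day_unit A" _ "?y x"])
    fix a b s e assume a: "a \<in> objs ?C" "b \<in> objs ?C" and s: "s \<in> fobj (?y x) a" "e \<in> fobj (day_unit A) b"
    show "ap ?C ?l (ten A a b) (gen A (?y x) (day_unit A) a b s e) = ap ?C ?r (ten A a b) (gen A (?y x) (day_unit A) a b s e)"
      using x a g[OF s(1) a(1)] g[OF s(2) a(2)] Y runitor_natural[OF M, of s]
      by (simp add: hom_iff[of _ ?C] flip: cmp_assoc) (simp add: cmp_assoc flip: tar_cmp)
  qed (use x Y in \<open>simp_all add: hom_def[of ?P]\<close>)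
  moreover have "farr ?Y (swp A x y) \<cdot>\<^bsub>?P\<^esub> ?c x y = ?c y x \<cdot>\<^bsub>?P\<^esub> the (symmetry (day_structure A)) (?y x, ?y y)"
    if S: "symmetric_doctrine S" and x: "x \<in> objs ?C" "y \<in> objs ?C" for x y
  proof -
    note Sy[simp] = small_strict_algebraD(2)[OF A S]
    have s: "symmetry (snd A) \<noteq> None" using Sy by (simp add: small_symmetric_def)
    have "farr ?Y (swp A x y) \<cdot>\<^bsub>?P\<^esub> ?c x y = ?c y x \<cdot>\<^bsub>?P\<^esub> day_swap A (?y x) (?y y)" (is "?l = ?r")
    proof (rule day_arrow_eqI[of A "?y x" "?y y" _ "?y (ten A y x)"])
      fix a b s t assume a: "a \<in> objs ?C" "b \<in> objs ?C" and s: "s \<in> fobj (?y x) a" "t \<in> fobj (?y y) b"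
      show "ap ?C ?l (ten A a b) (gen A (?y x) (?y y) a b s t) = ap ?C ?r (ten A a b) (gen A (?y x) (?y y) a b s t)"
        using x a g[OF s(1) a(1)] g[OF s(2) a(2)] Y swp_natural[OF Sy, of s t]
        by (simp add: hom_iff[of _ ?C])
    qed (use x Y in \<open>simp_all add: hom_def[of ?P]\<close>)
    then show ?thesis using s x by simp
  qed
  ultimately have "pseudomorphism S (fst A, snd A) (PSh A, day_structure A) (?Y, yoneda_structure A)"
    unfolding pseudomorphism_def Let_def prod.case
    using YF Y by simp
  then show ?thesis by simp
qed

section \<open>The algebra 2-cells of the lifting\<close>

text \<open>The source of \<open>mu\<close> is the Kan extension of a composite. This supplies the
  data on that composite from which its \<open>kan_tensor\<close> is defined and computed on
  generators.\<close>

lemma tensor_diagram_comp: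
  assumes F: "tensor_diagram A B F c" and G: "tensor_diagram B D G d"
  shows "tensor_diagram A D (comp_functor (fst A) (kan (fst B) (fst D) G) F)
    (\<lambda>(x, y)\<in>objs (fst A) \<times> objs (fst A). farr (kan (fst B) (fst D) G) (c (x, y)) \<cdot>\<^bsub>PSh D\<^esub>
      kan_tensor B D G d (fobj F x) (fobj F y))"
proof -
  note [simp] = tensor_diagram_simps[OF F] tensor_diagram_simps[OF G]
    kan_tensor_arr[OF G] src_kan_tensor[OF G] tgt_kan_tensor[OF G]
  note F' = tensor_diagram_diagram[OF F] and G' = tensor_diagram_diagram[OF G]
  let ?K = "kan (fst B) (fst D) G" and ?k = "kan_tensor B D G d"
  have "farr ?K (farr F (tar A f g)) \<cdot>\<^bsub>PSh D\<^esub> farr ?K (c (src (fst A) f, src (fst A) g)) \<cdot>\<^bsub>PSh D\<^esub>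
      ?k (fobj F (src (fst A) f)) (fobj F (src (fst A) g)) =
    (farr ?K (c (tgt (fst A) f, tgt (fst A) g)) \<cdot>\<^bsub>PSh D\<^esub> ?k (fobj F (tgt (fst A) f)) (fobj F (tgt (fst A) g))) \<cdot>\<^bsub>PSh D\<^esub>
      day_map D (farr ?K (farr F f)) (farr ?K (farr F g))" (is "?l = ?r")
    if f: "f \<in> arrs (fst A)" "g \<in> arrs (fst A)" for f g
  proof -
    note cmp = farr_cmp[OF is_functor_kan[OF G'], symmetric]
    \<comment> \<open>The Kan extension of \<open>G\<close> is applied to the naturality square of
      \<open>c\<close>; naturality of \<open>kan_tensor\<close> at \<open>F(f)\<close> and
      \<open>F(g)\<close> then closes the diagram.\<close>
    have "?l = farr ?K (farr F (tar A f g) \<cdot>\<^bsub>PSh B\<^esub> c (src (fst A) f, src (fst A) g)) \<cdot>\<^bsub>PSh D\<^esub>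
        ?k (fobj F (src (fst A) f)) (fobj F (src (fst A) g))"
      using f F' G' by (simp add: cmp flip: cmp_assoc)
    also have "\<dots> = farr ?K (c (tgt (fst A) f, tgt (fst A) g)) \<cdot>\<^bsub>PSh D\<^esub>
        farr ?K (day_map B (farr F f) (farr F g)) \<cdot>\<^bsub>PSh D\<^esub> ?k (fobj F (src (fst A) f)) (fobj F (src (fst A) g))"
      using f F' G' by (simp add: tensor_cell_natural[OF F] farr_cmp[OF is_functor_kan[OF G']] cmp_assoc)
    also have "\<dots> = ?r"
      using f F' G' kan_tensor_natural[OF G, of "farr F f" "farr F g"] by (simp add: cmp_assoc)
    finally show ?thesis .
  qed
  then show ?thesis
    using F' G' diagram_comp_kan[OF F' G'] unfolding tensor_diagram_def by (simp add: hom_def)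
qed

context
  fixes S :: doctrine and A B :: "('u::universe, 'u) algebra" and F P
  assumes A: "small_strict_algebra S A" and B: "small_strict_algebra S B"
    and P: "pseudomorphism S A (PSh B, day_structure B) (F, P)"
begin

text \<open>For the tensor cells, both sides send \<open>s\<close> tensor \<open>s'\<close> to
  \<open>[c(s tensor s'), id]\<close>, where \<open>c\<close> is the tensor cell of
  \<open>F\<close>; on the right this uses that \<open>tar A\<close> of two identities is an
  identity.\<close>

lemma algebra_2cell_eta:
  "algebra_2cell A (PSh B, day_structure B) (F, P)
    (comp_pseudo (fst A) (PSh B) (kan (fst A) (fst B) F, kan_structure A B (F, P)) (yoneda (fst A), yoneda_structure A))
    (eta (fst A) (fst B) F)"
proof -
  note M[simp] = small_strict_algebraD(1)[OF A] small_strict_algebraD(1)[OF B]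
  note T = pseudomorphism_tensor_diagram[OF A B P]
  note F = pseudomorphism_diagram[OF A B P]
  note [simp] = kan_tensor_arr[OF T] src_kan_tensor[OF T] tgt_kan_tensor[OF T] ap_kan_tensor[OF T]
    tensor_cell_arr[OF T] tensor_cell_src[OF T] tensor_cell_tgt[OF T] pseudomorphism_unit[OF A B P]
  let ?X = "fst A" and ?Y = "fst B" and ?K = "kan_obj (fst A) (fst B) F" and ?F = "kan (fst A) (fst B) F"
  let ?k = "kan_tensor A B F (tensor_cell P)" and ?e = "eta (fst A) (fst B) F"
  note Y = diagram_yoneda[OF small_fst[OF M(1)]]
  have id: "ident ?X x \<in> hom ?X x x" if "x \<in> objs ?X" for x using that by simp
  have nat: "farr ?F (farr (yoneda ?X) f) \<cdot>\<^bsub>PSh B\<^esub> ?e (src ?X f) = ?e (tgt ?X f) \<cdot>\<^bsub>PSh B\<^esub> farr F f"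
    if f: "f \<in> arrs ?X" for f
  proof (rule presheaf_arrow_eqI[of _ ?Y "fobj F (src ?X f)" "?K (yoneda_obj ?X (tgt ?X f))"])
    fix y s assume y: "y \<in> objs ?Y" and s: "s \<in> fobj (fobj F (src ?X f)) y"
    have i: "ident ?X (tgt ?X f) \<in> fobj (yoneda_obj ?X (tgt ?X f)) (tgt ?X f)" using f by simp
    \<comment> \<open>Naturality of \<open>eta\<close> is the coend relation along \<open>f\<close>
      itself: \<open>[s, f]\<close> equals \<open>[F(f)(s), id]\<close>.\<close>
    have "kel ?X F (yoneda_obj ?X (tgt ?X f)) y (src ?X f) s f =
      kel ?X F (yoneda_obj ?X (tgt ?X f)) y (tgt ?X f) (ap ?Y (farr F f) y s) (ident ?X (tgt ?X f))"
      using kel_dinatural[OF f s i, of ?Y] f by simp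
    then show "ap ?Y (farr ?F (farr (yoneda ?X) f) \<cdot>\<^bsub>PSh B\<^esub> ?e (src ?X f)) y s =
        ap ?Y (?e (tgt ?X f) \<cdot>\<^bsub>PSh B\<^esub> farr F f) y s"
      using f y s F Y id by simp
  qed (use f F Y in \<open>simp_all add: hom_def[of "PSh B"]\<close>)
  have "nat_trans ?X (PSh B) F (comp_functor ?X ?F (yoneda ?X)) ?e"
    unfolding nat_trans_def
    using diagram_functor[OF F] is_functor_comp_functor[OF _ is_functor_yoneda is_functor_kan[OF F]] eta_hom[OF F]
    by (auto simp: nat) (auto simp: eta_def)
  moreover have "?e (ten A x y) \<cdot>\<^bsub>PSh B\<^esub> tensor_cell P (x, y) =
      (farr ?F (yoneda_tensor A x y) \<cdot>\<^bsub>PSh B\<^esub> ?k (yoneda_obj ?X x) (yoneda_obj ?X y)) \<cdot>\<^bsub>PSh B\<^esub> day_map B (?e x) (?e y)"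
    if x: "x \<in> objs ?X" "y \<in> objs ?X" for x y
    using x F id
    by (intro day_arrow_eqI[of B "fobj F x" "fobj F y" _ "?K (yoneda_obj ?X (ten A x y))"])
      (simp_all add: hom_def[of "PSh B"])
  \<comment> \<open>The unit axiom holds by construction, since the unit cell of \<open>F*\<close>
    was composed from \<open>eta\<close> and that of \<open>F\<close>, and the unit cell of the
    Yoneda embedding is an identity.\<close>
  moreover have "farr ?F (ident (PSh A) (day_unit A)) \<cdot>\<^bsub>PSh B\<^esub> ?e (munit (snd A)) \<cdot>\<^bsub>PSh B\<^esub> unit_cell P =
      ?e (munit (snd A)) \<cdot>\<^bsub>PSh B\<^esub> unit_cell P"
    using F farr_ident[OF is_functor_kan[OF F], of "day_unit A"] by simp
  ultimately have "algebra_2cell (fst A, snd A) (PSh B, day_structure B) (F, P)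
    (comp_pseudo (fst A) (PSh B) (?F, kan_structure A B (F, P)) (yoneda (fst A), yoneda_structure A)) ?e"
    unfolding algebra_2cell_def comp_pseudo_def prod.case using F by simp
  then show ?thesis by simp
qed

end

text \<open>Both sides send \<open>[g, s]\<close> tensor \<open>[h, s']\<close> to the restriction
  of \<open>s\<close> tensor \<open>s'\<close> along \<open>tar A g h\<close>, by
  \<open>gen_natural\<close>; the unit axiom is the defining equation of \<open>theta\<close> at the
  unit object.\<close>

lemma algebra_2cell_theta:
  assumes A: "small_strict_algebra S A"
  shows "algebra_2cell (PSh A, day_structure A) (PSh A, day_structure A)
    (kan (fst A) (fst A) (yoneda (fst A)), kan_structure A A (yoneda (fst A), yoneda_structure A))
    (id_pseudo (PSh A, day_structure A)) (theta (fst A))"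
proof -
  note M[simp] = small_strict_algebraD(1)[OF A]
  note P = pseudomorphism_yoneda[OF A]
  note T = pseudomorphism_tensor_diagram[OF A A P]
  let ?X = "fst A" and ?Y = "yoneda (fst A)" and ?t = "theta (fst A)"
  let ?k = "kan_tensor A A (yoneda (fst A)) (tensor_cell (yoneda_structure A))"
  note Y = diagram_yoneda[OF small_fst[OF M]]
  note X = small_fst[OF M]
  note [simp] = kan_tensor_arr[OF T] src_kan_tensor[OF T] tgt_kan_tensor[OF T] ap_kan_tensor[OF T]
  have t: "?t p \<in> arrs (PSh A)" "src (PSh A) (?t p) = kan_obj ?X ?X ?Y p" "tgt (PSh A) (?t p) = p"
    if "presheaf ?X p" for p
    using theta_cell_hom[OF X that] that by (auto simp: theta_eq_cell[OF X] hom_def)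
  have ap_t: "ap ?X (?t p) y (kel ?X ?Y p y x g s) = act ?X p g s"
    if "presheaf ?X p" "y \<in> objs ?X" "x \<in> objs ?X" "g \<in> hom ?X y x" "s \<in> fobj p x" for p x y g s
    using ap_theta_cell[OF X] that by (simp add: theta_eq_cell[OF X])
  have "?t (day A p q) \<cdot>\<^bsub>PSh A\<^esub> ?k p q = ident (PSh A) (day A p q) \<cdot>\<^bsub>PSh A\<^esub> day_map A (?t p) (?t q)"
    if p: "presheaf ?X p" "presheaf ?X q" for p q
  proof (rule day_kan_arrow_eqI[OF M Y Y p])
    fix a b x y g h s s'
    assume a: "a \<in> objs ?X" "b \<in> objs ?X" and x: "x \<in> objs ?X" "y \<in> objs ?X"
      and g: "g \<in> fobj (fobj ?Y x) a" "h \<in> fobj (fobj ?Y y) b" and s: "s \<in> fobj p x" "s' \<in> fobj q y"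
    have g': "g \<in> hom ?X a x" "h \<in> hom ?X b y" "g \<in> arrs ?X" "src ?X g = a" "tgt ?X g = x"
      "h \<in> arrs ?X" "src ?X h = b" "tgt ?X h = y" using g a x by (auto simp: hom_def)
    have "tar A g h \<in> hom ?X (ten A a b) (ten A x y)" using g' by (simp add: hom_def)
    then show "ap ?X (?t (day A p q) \<cdot>\<^bsub>PSh A\<^esub> ?k p q) (ten A a b)
        (gen A (kan_obj ?X ?X ?Y p) (kan_obj ?X ?X ?Y q) a b (kel ?X ?Y p a x g s) (kel ?X ?Y q b y h s')) =
      ap ?X (ident (PSh A) (day A p q) \<cdot>\<^bsub>PSh A\<^esub> day_map A (?t p) (?t q)) (ten A a b)
        (gen A (kan_obj ?X ?X ?Y p) (kan_obj ?X ?X ?Y q) a b (kel ?X ?Y p a x g s) (kel ?X ?Y q b y h s'))"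
      using a x g' s p t ap_t Y by (simp add: gen_natural)
  qed (use p t Y in \<open>simp_all add: hom_def[of "PSh A"]\<close>)
  moreover have "?t (day_unit A) \<cdot>\<^bsub>PSh A\<^esub> eta ?X ?X ?Y (munit (snd A)) \<cdot>\<^bsub>PSh A\<^esub> ident (PSh A) (day_unit A) =
      ident (PSh A) (day_unit A)"
    using theta_eta[OF X, of "munit (snd A)"] Y by simp
  ultimately show ?thesis
    unfolding algebra_2cell_def id_pseudo_def prod.case
    using theta_nat_iso[OF X] by (simp add: nat_iso_def t)
qed

text \<open>With \<open>c\<close> and \<open>d\<close> the tensor cells of \<open>F\<close> and
  \<open>G\<close>, both sides send \<open>[[r, s], t]\<close> tensor \<open>[[r', s'], t']\<close>
  to \<open>[d(r tensor r'), [c(s tensor s'), t tensor t']]\<close>.\<close>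

lemma algebra_2cell_mu:
  assumes A: "small_strict_algebra S A" and B: "small_strict_algebra S B" and D: "small_strict_algebra S D"
    and P: "pseudomorphism S A (PSh B, day_structure B) (F, P)"
    and Q: "pseudomorphism S B (PSh D, day_structure D) (G, Q)"
  defines "GF \<equiv> comp_pseudo (fst A) (PSh D) (kan (fst B) (fst D) G, kan_structure B D (G, Q)) (F, P)"
  shows "algebra_2cell (PSh A, day_structure A) (PSh D, day_structure D)
    (kan (fst A) (fst D) (fst GF), kan_structure A D GF)
    (comp_pseudo (PSh A) (PSh D) (kan (fst B) (fst D) G, kan_structure B D (G, Q))
      (kan (fst A) (fst B) F, kan_structure A B (F, P)))
    (mu (fst A) (fst B) (fst D) G F)"
proof -
  note M[simp] = small_strict_algebraD(1)[OF A] small_strict_algebraD(1)[OF B] small_strict_algebraD(1)[OF D]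
  note T = pseudomorphism_tensor_diagram[OF A B P] and T' = pseudomorphism_tensor_diagram[OF B D Q]
  note F = pseudomorphism_diagram[OF A B P] and G = pseudomorphism_diagram[OF B D Q]
  let ?X = "fst A" and ?Y = "fst B" and ?Z = "fst D"
  let ?G = "kan ?Y ?Z G" and ?H = "comp_functor ?X (kan ?Y ?Z G) F"
  let ?c = "\<lambda>(x, y)\<in>objs ?X \<times> objs ?X. farr ?G (tensor_cell P (x, y)) \<cdot>\<^bsub>PSh D\<^esub>
      kan_tensor B D G (tensor_cell Q) (fobj F x) (fobj F y)"
  let ?kF = "kan_tensor A B F (tensor_cell P)" and ?kG = "kan_tensor B D G (tensor_cell Q)"
    and ?kH = "kan_tensor A D ?H ?c" and ?m = "mu ?X ?Y ?Z G F"
  have F_obj: "fobj F x \<in> objs (PSh B)" if "x \<in> objs ?X" for x using that F by simp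
  \<comment> \<open>The tensor cell of the composite pseudomorphism is the one of
    \<open>tensor_diagram_comp\<close>, because \<open>kan_structure\<close> at the presheaves
    \<open>F(x)\<close> and \<open>F(y)\<close> is \<open>kan_tensor\<close>.\<close>
  have c_eq: "tensor_cell (snd GF) = ?c"
    using F by (auto simp: GF_def comp_pseudo_def restrict_def fun_eq_iff)
  have GF: "GF = (?H, snd GF)"
    by (simp add: GF_def comp_pseudo_def)
  have u_eq: "unit_cell (snd GF) = farr ?G (unit_cell P) \<cdot>\<^bsub>PSh D\<^esub> eta ?Y ?Z G (munit (snd B)) \<cdot>\<^bsub>PSh D\<^esub> unit_cell Q"
    by (simp add: GF_def comp_pseudo_def)
  note TH = tensor_diagram_comp[OF T T']
  note H = tensor_diagram_diagram[OF TH]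
  note [simp] = kan_tensor_arr[OF T] src_kan_tensor[OF T] tgt_kan_tensor[OF T] ap_kan_tensor[OF T]
    kan_tensor_arr[OF T'] src_kan_tensor[OF T'] tgt_kan_tensor[OF T'] ap_kan_tensor[OF T']
    kan_tensor_arr[OF TH] src_kan_tensor[OF TH] tgt_kan_tensor[OF TH] ap_kan_tensor[OF TH]
    tensor_cell_arr[OF T] tensor_cell_src[OF T] tensor_cell_tgt[OF T] pseudomorphism_unit[OF A B P]
    tensor_cell_arr[OF T'] tensor_cell_src[OF T'] tensor_cell_tgt[OF T'] pseudomorphism_unit[OF B D Q]
    ap_mu[OF F G]
  have m: "?m p \<in> arrs (PSh D)" "src (PSh D) (?m p) = kan_obj ?X ?Z ?H p"
    "tgt (PSh D) (?m p) = kan_obj ?Y ?Z G (kan_obj ?X ?Y F p)" if "presheaf ?X p" for p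
    using nat_isoD(1)[OF mu_nat_iso[OF F G], of p] that F by (simp_all add: hom_def)
  have "?m (day A p q) \<cdot>\<^bsub>PSh D\<^esub> ?kH p q =
      (farr ?G (?kF p q) \<cdot>\<^bsub>PSh D\<^esub> ?kG (kan_obj ?X ?Y F p) (kan_obj ?X ?Y F q)) \<cdot>\<^bsub>PSh D\<^esub> day_map D (?m p) (?m q)"
    (is "?l = ?r") if p: "presheaf ?X p" "presheaf ?X q" for p q
  proof (rule day_kan_arrow_eqI[OF M(3) H H p])
    fix z z' x x' v v' t t'
    assume z: "z \<in> objs ?Z" "z' \<in> objs ?Z" and x: "x \<in> objs ?X" "x' \<in> objs ?X"
      and v: "v \<in> fobj (fobj ?H x) z" "v' \<in> fobj (fobj ?H x') z'" and t: "t \<in> fobj p x" "t' \<in> fobj q x'"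
    have v': "v \<in> fobj (kan_obj ?Y ?Z G (fobj F x)) z" "v' \<in> fobj (kan_obj ?Y ?Z G (fobj F x')) z'"
      using v x F by simp_all
    show "ap ?Z ?l (ten D z z') (gen D (kan_obj ?X ?Z ?H p) (kan_obj ?X ?Z ?H q) z z'
        (kel ?X ?H p z x v t) (kel ?X ?H q z' x' v' t')) =
      ap ?Z ?r (ten D z z') (gen D (kan_obj ?X ?Z ?H p) (kan_obj ?X ?Z ?H q) z z'
        (kel ?X ?H p z x v t) (kel ?X ?H q z' x' v' t'))"
      by (rule kan_obj_cases[OF v'(1) z(1)], rule kan_obj_cases[OF v'(2) z(2)])
        (use z x t p m F G H in simp)
  qed (use p m F G H in \<open>simp_all add: hom_def[of "PSh D"]\<close>)
  moreover have "?m (day_unit A) \<cdot>\<^bsub>PSh D\<^esub> eta ?X ?Z ?H (munit (snd A)) \<cdot>\<^bsub>PSh D\<^esub> unit_cell (snd GF) =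
    farr ?G (eta ?X ?Y F (munit (snd A)) \<cdot>\<^bsub>PSh B\<^esub> unit_cell P) \<cdot>\<^bsub>PSh D\<^esub> eta ?Y ?Z G (munit (snd B)) \<cdot>\<^bsub>PSh D\<^esub> unit_cell Q"
  proof -
    \<comment> \<open>Rebracketing exposes \<open>mu\<close> after \<open>eta\<close> at the unit
      object, which the defining equation \<open>mu_eta\<close> rewrites to the Kan extension of
      \<open>G\<close> applied to \<open>eta\<close>.\<close>
    have "?m (day_unit A) \<cdot>\<^bsub>PSh D\<^esub> eta ?X ?Z ?H (munit (snd A)) \<cdot>\<^bsub>PSh D\<^esub> unit_cell (snd GF) =
      (?m (day_unit A) \<cdot>\<^bsub>PSh D\<^esub> eta ?X ?Z ?H (munit (snd A))) \<cdot>\<^bsub>PSh D\<^esub> unit_cell (snd GF)"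
      using m F G H unfolding u_eq by (simp add: cmp_assoc)
    also have "\<dots> = farr ?G (eta ?X ?Y F (munit (snd A))) \<cdot>\<^bsub>PSh D\<^esub> unit_cell (snd GF)"
      using mu_eta[OF F G] by simp
    also have "\<dots> = farr ?G (eta ?X ?Y F (munit (snd A)) \<cdot>\<^bsub>PSh B\<^esub> unit_cell P) \<cdot>\<^bsub>PSh D\<^esub>
        eta ?Y ?Z G (munit (snd B)) \<cdot>\<^bsub>PSh D\<^esub> unit_cell Q"
      using F G unfolding u_eq by (simp add: cmp_assoc farr_cmp[OF is_functor_kan[OF G]])
    finally show ?thesis .
  qed
  moreover have "nat_trans (PSh A) (PSh D) (kan ?X ?Z ?H) (comp_functor (PSh A) ?G (kan ?X ?Y F)) ?m"
    using mu_nat_iso[OF F G] by (simp add: nat_iso_def)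
  ultimately show ?thesis
    \<comment> \<open>\<open>GF\<close> is displayed as an explicit pair at its two occurrences, so
      that the rules for \<open>kan_structure\<close> on pairs apply.\<close>
    using F by (subst (1 2) GF) (simp add: algebra_2cell_def comp_pseudo_def c_eq m)
qed

theorem theorem7p3:
  fixes S :: doctrine
  shows "\<exists>(alg :: 'u::universe small_algebra \<Rightarrow> ('u psh, 'u psh_arrow) algebra_structure) ext yon.
    is_lifting S alg ext yon"
proof (intro exI)
  show "is_lifting S (day_structure :: 'u small_algebra \<Rightarrow> _) kan_structure yoneda_structure"
    unfolding is_lifting_def Let_def
  proof (intro conjI ballI)
    fix A B D :: "'u small_algebra" and FP GQ
    assume A: "A \<in> Collect (small_strict_algebra S)" and B: "B \<in> Collect (small_strict_algebra S)"
      and D: "D \<in> Collect (small_strict_algebra S)"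
      and F: "FP \<in> Collect (pseudomorphism S A (PSh B, day_structure B))"
      and G: "GQ \<in> Collect (pseudomorphism S B (PSh D, day_structure D))"
    show "algebra_2cell (PSh A, day_structure A) (PSh D, day_structure D)
      (kan (fst A) (fst D) (fst (comp_pseudo (fst A) (PSh D)
          (kan (fst B) (fst D) (fst GQ), kan_structure B D GQ) FP)),
        kan_structure A D (comp_pseudo (fst A) (PSh D)
          (kan (fst B) (fst D) (fst GQ), kan_structure B D GQ) FP))
      (comp_pseudo (PSh A) (PSh D) (kan (fst B) (fst D) (fst GQ), kan_structure B D GQ)
        (kan (fst A) (fst B) (fst FP), kan_structure A B FP))
      (mu (fst A) (fst B) (fst D) (fst GQ) (fst FP))"
      using algebra_2cell_mu[of S A B D "fst FP" "snd FP" "fst GQ" "snd GQ"] A B D F G by simp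
  next
    fix A B :: "'u small_algebra" and FP
    assume A: "A \<in> Collect (small_strict_algebra S)" and B: "B \<in> Collect (small_strict_algebra S)"
      and F: "FP \<in> Collect (pseudomorphism S A (PSh B, day_structure B))"
    show "pseudomorphism S (PSh A, day_structure A) (PSh B, day_structure B)
        (kan (fst A) (fst B) (fst FP), kan_structure A B FP)"
      using pseudomorphism_kan[of S A B "fst FP" "snd FP"] A B F by simp
    show "algebra_2cell A (PSh B, day_structure B) FP
      (comp_pseudo (fst A) (PSh B) (kan (fst A) (fst B) (fst FP), kan_structure A B FP)
        (yoneda (fst A), yoneda_structure A)) (eta (fst A) (fst B) (fst FP))"
      using algebra_2cell_eta[of S A B "fst FP" "snd FP"] A B F by simp
  next
    fix A :: "'u small_algebra"
    assume A: "A \<in> Collect (small_strict_algebra S)"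
    then show "strict_algebra TYPE('u) S (PSh A, day_structure A)"
      "pseudomorphism S A (PSh A, day_structure A) (yoneda (fst A), yoneda_structure A)"
      "algebra_2cell (PSh A, day_structure A) (PSh A, day_structure A)
        (kan (fst A) (fst A) (fst (yoneda (fst A), yoneda_structure A)),
          kan_structure A A (yoneda (fst A), yoneda_structure A))
        (id_pseudo (PSh A, day_structure A)) (theta (fst A))"
      using strict_algebra_day[of S A] pseudomorphism_yoneda[of S A] algebra_2cell_theta[of S A] by simp_all
  qed
qed

end
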